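(* Let $\Omega,\Gamma_D,\Gamma_N,\Gamma_R$, $T>0$, the physical data $K,n_e,S_s,\eta,N,\alpha,h_{\rm ext}$, the interval $I=[m,M]$, and the coefficients $S_{\rm ph},\mathcal T_{\rm ph}$ be as in the context. Let $S,\mathcal T:\Omega\times\mathbb R\to\mathbb R$ coincide with $S_{\rm ph},\mathcal T_{\rm ph}$ on $\Omega\times I$ and satisfy (H1), let $\beta$ satisfy (H2), and let $h_0,q,g$ satisfy (H3) (hypotheses spelled out in the context). Let $h$ be a weak solution of the extended problem with coefficients $S,\mathcal T,\beta$ and data $h_0,q,g$. Suppose in addition that (i) $h(x,t)\in I=[m,M]$ for a.e. $(x,t)\in\Omega\times(0,T)$; (ii) on $I$ the abstract boundary law coincides with the physical one: $\beta(x,t,r)=\alpha(r)(r-h_{\rm ext}(x,t))$ for $(x,t)\in\Gamma_R\times(0,T)$ and $r\in I$; (iii) $q=N$, viewed as an element of $L^2(0,T;V')$. Then $S(x,h)=S_{\rm ph}(x,h)$ and $\mathcal T(x,h)=\mathcal T_{\rm ph}(x,h)$ a.e. in $\Omega\times(0,T)$, and $h$ is a weak solution of the physical model $$\bigl(n_e+S_s(h-\eta)\bigr)h_t-K\operatorname{div}\bigl((h-\eta)\nabla h\bigr)=N\quad\text{in }\Omega\times(0,T)$$ with boundary conditions $h=0$ on $\Gamma_D\times(0,T)$, $-\mathcal T_{\rm ph}(x,h)\partial_nh=g$ on $\Gamma_N\times(0,T)$, $-\mathcal T_{\rm ph}(x,h)\partial_nh=\alpha(h)(h-h_{\rm ext})$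 on $\Gamma_R\times(0,T)$, and initial condition $h(\cdot,0)=h_0$ in $\Omega$.
   Context: Geometry. $\Omega\subset\mathbb R^2$ is a bounded Lipschitz domain, $\partial\Omega=\overline{\Gamma_D}\cup\overline{\Gamma_N}\cup\overline{\Gamma_R}$, where $\Gamma_D,\Gamma_N,\Gamma_R$ are pairwise disjoint relatively open subsets of $\partial\Omega$ and $|\Gamma_D|>0$ (surface measure). Put $\Sigma_R:=\Gamma_R\times(0,T)$. Physical coefficients. $K>0$, $n_e>0$, $S_s\ge0$ are constants, $\eta\in W^{1,\infty}(\Omega)$, $N$ is a source term, $\alpha$ is the exchange coefficient (a function of the head) and $h_{\rm ext}$ an external head on $\Sigma_R$. Set $$S_{\rm ph}(x,r)=n_e+S_s(r-\eta(x)),\qquad \mathcal T_{\rm ph}(x,r)=K(r-\eta(x)).$$ The interval $I=[m,M]$ is such that, for some $\delta>0$, $r-\eta(x)\ge\delta$ for a.e. $x\in\Omega$ and every $r\in I$. Spaces. $\operatorname{Tr}$ is the trace operator. $V:=\{v\in H^1(\Omega):\operatorname{Tr}v=0\text{ on }\Gamma_D\}$ with norm $\|\nabla v\|_{L^2(\Omega)}$; $V\hookrightarrow L^2(\Omega)\hookrightarrow V'$ is a Gelfand triple ($w\in L^2(\Omega)$ is identified with $v\mapsto(w,v)_{L^2}$). $\partial_t$ is the distributional time derivative. $H^{-1/2}(\Gamma_N)$ is the dual of $H^{1/2}(\Gamma_N)$, paired with traces on $\Gamma_N$. In boundary integrals functions stand for their traces. (H1) $S,\mathcal T$ are Carathéodory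 (measurable in $x$, continuous in $r$), and for constants $S_0,S_1,T_0,T_1>0$: $S_0\le S(x,r)\le S_1$, $T_0\le\mathcal T(x,r)\le T_1$ for a.e. $x\in\Omega$ and all $r\in\mathbb R$. With $B(x,r):=\int_0^rS(x,s)\,ds$, for every $u\in H^1(\Omega)$ one has $B(\cdot,u)\in H^1(\Omega)$ and $\nabla[B(x,u(x))]=S(x,u(x))\nabla u(x)+\nabla_xB(x,u(x))$ a.e., where $\nabla_xB$ is the gradient in $x$ at fixed $r$ and $|\nabla_xB(x,r)|\le C_B(1+|r|)$ for some $C_B>0$, a.e. $x\in\Omega$ and all $r\in\mathbb R$. (H2) $\beta:\Sigma_R\times\mathbb R\to\mathbb R$ is Carathéodory, nondecreasing in its last variable, and $|\beta(x,t,r)|\le b_0(x,t)+b_1|r|$ with $b_0\in L^2(\Sigma_R)$, $b_1\ge0$. (H3) $h_0\in L^2(\Omega)$, $q\in L^2(0,T;V')$, $g\in L^2(0,T;H^{-1/2}(\Gamma_N))$. Weak solution of the extended problem: $h\in L^\infty(0,T;L^2(\Omega))\cap L^2(0,T;V)$ with $B(\cdot,h)\in L^2(0,T;H^1(\Omega))$, $\partial_tB(\cdot,h)\in L^2(0,T;V')$, and, for every $v\in V$ and $\psi\in C^1([0,T])$ with $\psi(T)=0$, $$-\int_0^T (B(\cdot,h),v)_{L^2}\psi'\,dt+\int_0^T\!\int_\Omega \mathcal T(x,h)\nabla h\cdot\nabla v\,\psi\,dx\,dt+\int_0^T\!\int_{\Gamma_R}\beta(x,t,h)v\psi\,dS\,dt$$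 $$=\int_0^T\bigl(\langle q,v\rangle_{V',V}-\langle g,\operatorname{Tr}v\rangle_{H^{-1/2},H^{1/2}}\bigr)\psi\,dt+(B(\cdot,h_0),v)_{L^2}\psi(0).$$ Weak solution of the physical model: the same definition with $S,\mathcal T,B$ replaced by $S_{\rm ph}$, $\mathcal T_{\rm ph}$, $B_{\rm ph}(x,r):=\int_0^rS_{\rm ph}(x,s)\,ds=n_er+\tfrac{S_s}{2}r^2-S_s\eta(x)r$, with $\beta(x,t,h)$ replaced by $\alpha(h)(h-h_{\rm ext})$, and with $q$ replaced by $N$. *)

theory Defs
  imports "HOL-Analysis.Analysis"
begin

type_synonym pt = "real^2"

section \<open>Test functions\<close>

primrec C_k :: "nat \<Rightarrow> ('a::euclidean_space \<Rightarrow> real) \<Rightarrow> bool" where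
  "C_k 0 f \<longleftrightarrow> continuous_on UNIV f"
| "C_k (Suc k) f \<longleftrightarrow> (\<forall>x. f differentiable (at x)) \<and>
     (\<forall>b\<in>Basis. C_k k (\<lambda>x. frechet_derivative f (at x) b))"

definition C_infinity :: "('a::euclidean_space \<Rightarrow> real) \<Rightarrow> bool" where
  "C_infinity f \<longleftrightarrow> (\<forall>k. C_k k f)"

definition test_functions :: "'a::euclidean_space set \<Rightarrow> ('a \<Rightarrow> real) set" where
  "test_functions U = {\<phi>. C_infinity \<phi> \<and>
     compact (closure {x. \<phi> x \<noteq> 0}) \<and> closure {x. \<phi> x \<noteq> 0} \<subseteq> U}"


section \<open>Lebesgue and Sobolev spaces\<close>

text \<open>Elements of all function spaces are represented by functions; classes modulo null sets are
  never formed. Consequently the norms below are seminorms on representatives.\<close>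

definition L2 :: "'a measure \<Rightarrow> ('a \<Rightarrow> 'b::euclidean_space) set" where
  "L2 M = {f \<in> borel_measurable M. integrable M (\<lambda>x. (norm (f x))\<^sup>2)}"

definition L2_norm :: "'a measure \<Rightarrow> ('a \<Rightarrow> 'b::euclidean_space) \<Rightarrow> real" where
  "L2_norm M f = sqrt (\<integral>x. (norm (f x))\<^sup>2 \<partial>M)"

definition L2_inner :: "pt set \<Rightarrow> (pt \<Rightarrow> real) \<Rightarrow> (pt \<Rightarrow> real) \<Rightarrow> real" where
  "L2_inner \<Omega> u v = (\<integral>x. u x * v x \<partial>lebesgue_on \<Omega>)"

definition L_infinity :: "'a measure \<Rightarrow> ('a \<Rightarrow> 'b::euclidean_space) set" where
  "L_infinity M = {f \<in> borel_measurable M. \<exists>C. AE x in M. norm (f x) \<le> C}"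

definition has_weak_gradient :: "pt set \<Rightarrow> (pt \<Rightarrow> real) \<Rightarrow> (pt \<Rightarrow> pt) \<Rightarrow> bool" where
  "has_weak_gradient \<Omega> u G \<longleftrightarrow>
     (\<forall>C. compact C \<and> C \<subseteq> \<Omega> \<longrightarrow> u absolutely_integrable_on C \<and> G absolutely_integrable_on C) \<and>
     (\<forall>\<phi>\<in>test_functions \<Omega>. \<forall>b\<in>Basis.
        (\<integral>x. u x * frechet_derivative \<phi> (at x) b \<partial>lebesgue_on \<Omega>)
          = - (\<integral>x. (G x \<bullet> b) * \<phi> x \<partial>lebesgue_on \<Omega>))"

text \<open>The weak gradient is unique only up to null sets; this picks some representative.\<close>

definition weak_gradient :: "pt set \<Rightarrow> (pt \<Rightarrow> real) \<Rightarrow> pt \<Rightarrow> pt" where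
  "weak_gradient \<Omega> u = (SOME G. has_weak_gradient \<Omega> u G)"

definition H1 :: "pt set \<Rightarrow> (pt \<Rightarrow> real) set" where
  "H1 \<Omega> = {u \<in> L2 (lebesgue_on \<Omega>). \<exists>G \<in> L2 (lebesgue_on \<Omega>). has_weak_gradient \<Omega> u G}"

definition H1_norm :: "pt set \<Rightarrow> (pt \<Rightarrow> real) \<Rightarrow> real" where
  "H1_norm \<Omega> u =
     sqrt ((L2_norm (lebesgue_on \<Omega>) u)\<^sup>2 + (L2_norm (lebesgue_on \<Omega>) (weak_gradient \<Omega> u))\<^sup>2)"

definition W1_infinity :: "pt set \<Rightarrow> (pt \<Rightarrow> real) set" where
  "W1_infinity \<Omega> =
     {u \<in> L_infinity (lebesgue_on \<Omega>). \<exists>G \<in> L_infinity (lebesgue_on \<Omega>). has_weak_gradient \<Omega> u G}"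


section \<open>Lipschitz domains, surface measure and traces\<close>

definition lipschitz_domain :: "pt set \<Rightarrow> bool" where
  "lipschitz_domain \<Omega> \<longleftrightarrow> open \<Omega> \<and> connected \<Omega> \<and> \<Omega> \<noteq> {} \<and>
     (\<forall>p\<in>frontier \<Omega>. \<exists>e1 e2 r L \<gamma>.
        norm e1 = 1 \<and> norm e2 = 1 \<and> e1 \<bullet> e2 = 0 \<and> r > 0 \<and> L-lipschitz_on UNIV \<gamma> \<and>
        (\<forall>x\<in>ball p r. x \<in> \<Omega> \<longleftrightarrow> \<gamma> ((x - p) \<bullet> e1) < (x - p) \<bullet> e2))"

text \<open>Surface measure on a curve in the plane is the one-dimensional Hausdorff measure. In dimension
  one the usual normalising constant is 1, so plain diameters are summed. The outer measure is
  countably additive on the Borel sets, where \<open>measure_of\<close> therefore agrees with it.\<close>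

definition hausdorff_outer :: "pt set \<Rightarrow> ennreal" where
  "hausdorff_outer A = (SUP \<delta>\<in>{0<..}.
     INF U\<in>{U :: nat \<Rightarrow> pt set. A \<subseteq> (\<Union>i. U i) \<and> (\<forall>i. bounded (U i) \<and> diameter (U i) \<le> \<delta>)}.
       (\<Sum>i. ennreal (diameter (U i))))"

definition surface_measure :: "pt measure" where
  "surface_measure = completion (measure_of UNIV (sets borel) hausdorff_outer)"

abbreviation surface_on :: "pt set \<Rightarrow> pt measure" where
  "surface_on \<Gamma> \<equiv> restrict_space surface_measure \<Gamma>"

text \<open>The trace operator is the continuous extension to \<open>H1 \<Omega>\<close> of the restriction
  \<open>\<phi> \<mapsto> \<phi>|\<^sub>\<partial>\<^sub>\<Omega>\<close> of functions that are smooth up to the boundary: the trace of \<open>u\<close> is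
  the \<open>L2\<close>-limit of the restrictions of any such sequence converging to \<open>u\<close> in \<open>H1 \<Omega>\<close>. On a bounded
  Lipschitz domain every \<open>u\<close> in \<open>H1 \<Omega>\<close> has a trace, unique up to a null set of the boundary.\<close>

definition has_trace :: "pt set \<Rightarrow> (pt \<Rightarrow> real) \<Rightarrow> (pt \<Rightarrow> real) \<Rightarrow> bool" where
  "has_trace \<Omega> u \<tau> \<longleftrightarrow> u \<in> H1 \<Omega> \<and> \<tau> \<in> L2 (surface_on (frontier \<Omega>)) \<and>
     (\<exists>\<phi> :: nat \<Rightarrow> pt \<Rightarrow> real. (\<forall>n. C_infinity (\<phi> n)) \<and>
        (\<lambda>n. H1_norm \<Omega> (\<phi> n - u)) \<longlonglongrightarrow> 0 \<and>
        (\<lambda>n. L2_norm (surface_on (frontier \<Omega>)) (\<phi> n - \<tau>)) \<longlonglongrightarrow> 0)"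

definition boundary_trace :: "pt set \<Rightarrow> (pt \<Rightarrow> real) \<Rightarrow> pt \<Rightarrow> real" where
  "boundary_trace \<Omega> u = (SOME \<tau>. has_trace \<Omega> u \<tau>)"

definition V_space :: "pt set \<Rightarrow> pt set \<Rightarrow> (pt \<Rightarrow> real) set" where
  "V_space \<Omega> \<Gamma>\<^sub>D = {v \<in> H1 \<Omega>. \<exists>\<tau>. has_trace \<Omega> v \<tau> \<and> (AE x in surface_on \<Gamma>\<^sub>D. \<tau> x = 0)}"

definition V_norm :: "pt set \<Rightarrow> (pt \<Rightarrow> real) \<Rightarrow> real" where
  "V_norm \<Omega> v = L2_norm (lebesgue_on \<Omega>) (weak_gradient \<Omega> v)"

text \<open>\<open>H_half \<Omega> \<Gamma>\<close> is the trace space \<open>H\<^sup>1\<^sup>/\<^sup>2(\<Gamma>)\<close> on a part \<open>\<Gamma>\<close> of the boundary,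
  with its quotient norm.\<close>

definition H_half :: "pt set \<Rightarrow> pt set \<Rightarrow> (pt \<Rightarrow> real) set" where
  "H_half \<Omega> \<Gamma> = {\<phi>. \<exists>u \<tau>. has_trace \<Omega> u \<tau> \<and> (AE x in surface_on \<Gamma>. \<phi> x = \<tau> x)}"

definition H_half_norm :: "pt set \<Rightarrow> pt set \<Rightarrow> (pt \<Rightarrow> real) \<Rightarrow> real" where
  "H_half_norm \<Omega> \<Gamma> \<phi> =
     Inf {H1_norm \<Omega> u |u. \<exists>\<tau>. has_trace \<Omega> u \<tau> \<and> (AE x in surface_on \<Gamma>. \<phi> x = \<tau> x)}"


section \<open>Dual spaces\<close>

text \<open>A functional on a space \<open>X\<close> of representatives is a total function of which only the values
  on \<open>X\<close> matter. Boundedness by the seminorm makes it independent of representatives.\<close>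

definition dual_space ::
  "(pt \<Rightarrow> real) set \<Rightarrow> ((pt \<Rightarrow> real) \<Rightarrow> real) \<Rightarrow> ((pt \<Rightarrow> real) \<Rightarrow> real) set" where
  "dual_space X N = {F.
     (\<forall>u\<in>X. \<forall>w\<in>X. \<forall>a b. F (\<lambda>x. a * u x + b * w x) = a * F u + b * F w) \<and>
     (\<exists>C. \<forall>u\<in>X. \<bar>F u\<bar> \<le> C * N u)}"

definition dual_norm ::
  "(pt \<Rightarrow> real) set \<Rightarrow> ((pt \<Rightarrow> real) \<Rightarrow> real) \<Rightarrow> ((pt \<Rightarrow> real) \<Rightarrow> real) \<Rightarrow> real" where
  "dual_norm X N F = (SUP u\<in>{u\<in>X. N u \<le> 1}. \<bar>F u\<bar>)"

abbreviation V_dual :: "pt set \<Rightarrow> pt set \<Rightarrow> ((pt \<Rightarrow> real) \<Rightarrow> real) set" where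
  "V_dual \<Omega> \<Gamma>\<^sub>D \<equiv> dual_space (V_space \<Omega> \<Gamma>\<^sub>D) (V_norm \<Omega>)"

abbreviation V_dual_norm :: "pt set \<Rightarrow> pt set \<Rightarrow> ((pt \<Rightarrow> real) \<Rightarrow> real) \<Rightarrow> real" where
  "V_dual_norm \<Omega> \<Gamma>\<^sub>D \<equiv> dual_norm (V_space \<Omega> \<Gamma>\<^sub>D) (V_norm \<Omega>)"

abbreviation H_minus_half :: "pt set \<Rightarrow> pt set \<Rightarrow> ((pt \<Rightarrow> real) \<Rightarrow> real) set" where
  "H_minus_half \<Omega> \<Gamma> \<equiv> dual_space (H_half \<Omega> \<Gamma>) (H_half_norm \<Omega> \<Gamma>)"

abbreviation H_minus_half_norm :: "pt set \<Rightarrow> pt set \<Rightarrow> ((pt \<Rightarrow> real) \<Rightarrow> real) \<Rightarrow> real" where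
  "H_minus_half_norm \<Omega> \<Gamma> \<equiv> dual_norm (H_half \<Omega> \<Gamma>) (H_half_norm \<Omega> \<Gamma>)"


section \<open>Bochner spaces\<close>

abbreviation time :: "real \<Rightarrow> real measure" where
  "time T \<equiv> lebesgue_on {0<..<T}"

text \<open>Strong (Bochner) measurability of a curve in the space \<open>X\<close> with norm \<open>N\<close>: almost everywhere
  limit of simple functions with values in \<open>X\<close>.\<close>

definition strongly_measurable ::
  "real \<Rightarrow> 'a::minus set \<Rightarrow> ('a \<Rightarrow> real) \<Rightarrow> (real \<Rightarrow> 'a) \<Rightarrow> bool" where
  "strongly_measurable T X N f \<longleftrightarrow> (AE t in time T. f t \<in> X) \<and>
     (\<exists>s. (\<forall>n::nat. simple_function (time T) (s n) \<and> (\<forall>t\<in>{0<..<T}. s n t \<in> X)) \<and>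
          (AE t in time T. (\<lambda>n. N (s n t - f t)) \<longlonglongrightarrow> 0))"

definition bochner_L2 ::
  "real \<Rightarrow> 'a::minus set \<Rightarrow> ('a \<Rightarrow> real) \<Rightarrow> (real \<Rightarrow> 'a) set" where
  "bochner_L2 T X N =
     {f. strongly_measurable T X N f \<and> integrable (time T) (\<lambda>t. (N (f t))\<^sup>2)}"

definition bochner_L_infinity ::
  "real \<Rightarrow> 'a::minus set \<Rightarrow> ('a \<Rightarrow> real) \<Rightarrow> (real \<Rightarrow> 'a) set" where
  "bochner_L_infinity T X N =
     {f. strongly_measurable T X N f \<and> (\<exists>C. AE t in time T. N (f t) \<le> C)}"

text \<open>\<open>w\<close> is the distributional time derivative of \<open>u\<close> as a distribution with values in the dual of
  \<open>V\<close>, where \<open>u t\<close> is embedded through the Gelfand triple; an identity in the dual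
  is tested against all elements of \<open>V\<close>.\<close>

definition has_time_derivative ::
  "pt set \<Rightarrow> pt set \<Rightarrow> real \<Rightarrow> (real \<Rightarrow> pt \<Rightarrow> real) \<Rightarrow> (real \<Rightarrow> (pt \<Rightarrow> real) \<Rightarrow> real) \<Rightarrow> bool" where
  "has_time_derivative \<Omega> \<Gamma>\<^sub>D T u w \<longleftrightarrow>
     (\<forall>\<phi>\<in>test_functions {0<..<T}. \<forall>v\<in>V_space \<Omega> \<Gamma>\<^sub>D.
        (\<integral>t. L2_inner \<Omega> (u t) v * deriv \<phi> t \<partial>time T) = - (\<integral>t. w t v * \<phi> t \<partial>time T))"


section \<open>Data and weak solutions\<close>

definition caratheodory :: "'a measure \<Rightarrow> ('a \<Rightarrow> real \<Rightarrow> real) \<Rightarrow> bool" where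
  "caratheodory M f \<longleftrightarrow> (\<forall>r. (\<lambda>x. f x r) \<in> borel_measurable M) \<and>
     (AE x in M. continuous_on UNIV (f x))"

text \<open>The interval integral is oriented, hence correct for negative \<open>r\<close> as well.\<close>

definition primitive :: "(pt \<Rightarrow> real \<Rightarrow> real) \<Rightarrow> pt \<Rightarrow> real \<Rightarrow> real" where
  "primitive S x r = (LBINT s=ereal 0..ereal r. S x s)"

text \<open>In \<open>hyp_H1\<close>, \<open>D x r\<close> is the (weak) gradient of \<open>primitive S\<close> in \<open>x\<close> at fixed \<open>r\<close>.\<close>

definition hyp_H1 :: "pt set \<Rightarrow> (pt \<Rightarrow> real \<Rightarrow> real) \<Rightarrow> (pt \<Rightarrow> real \<Rightarrow> real) \<Rightarrow> bool" where
  "hyp_H1 \<Omega> S \<T> \<longleftrightarrow>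
     caratheodory (lebesgue_on \<Omega>) S \<and> caratheodory (lebesgue_on \<Omega>) \<T> \<and>
     (\<exists>S0>0. \<exists>S1>0. \<exists>T0>0. \<exists>T1>0. AE x in lebesgue_on \<Omega>. \<forall>r.
        S0 \<le> S x r \<and> S x r \<le> S1 \<and> T0 \<le> \<T> x r \<and> \<T> x r \<le> T1) \<and>
     (\<exists>D :: pt \<Rightarrow> real \<Rightarrow> pt.
        (\<forall>r. has_weak_gradient \<Omega> (\<lambda>x. primitive S x r) (\<lambda>x. D x r)) \<and>
        (\<exists>C\<^sub>B>0. AE x in lebesgue_on \<Omega>. \<forall>r. norm (D x r) \<le> C\<^sub>B * (1 + \<bar>r\<bar>)) \<and>
        (\<forall>u\<in>H1 \<Omega>. (\<lambda>x. primitive S x (u x)) \<in> H1 \<Omega> \<and>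
           (AE x in lebesgue_on \<Omega>. weak_gradient \<Omega> (\<lambda>y. primitive S y (u y)) x
              = S x (u x) *\<^sub>R weak_gradient \<Omega> u x + D x (u x))))"

definition \<Sigma>_measure :: "pt set \<Rightarrow> real \<Rightarrow> (pt \<times> real) measure" where
  "\<Sigma>_measure \<Gamma>\<^sub>R T = completion (surface_on \<Gamma>\<^sub>R \<Otimes>\<^sub>M time T)"

definition hyp_H2 :: "pt set \<Rightarrow> real \<Rightarrow> (pt \<Rightarrow> real \<Rightarrow> real \<Rightarrow> real) \<Rightarrow> bool" where
  "hyp_H2 \<Gamma>\<^sub>R T \<beta> \<longleftrightarrow>
     caratheodory (\<Sigma>_measure \<Gamma>\<^sub>R T) (\<lambda>(x, t). \<beta> x t) \<and>
     (AE (x, t) in \<Sigma>_measure \<Gamma>\<^sub>R T. mono (\<beta> x t)) \<and>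
     (\<exists>b0 b1. (\<lambda>(x, t). b0 x t) \<in> L2 (\<Sigma>_measure \<Gamma>\<^sub>R T) \<and> 0 \<le> b1 \<and>
        (AE (x, t) in \<Sigma>_measure \<Gamma>\<^sub>R T. \<forall>r. \<bar>\<beta> x t r\<bar> \<le> b0 x t + b1 * \<bar>r\<bar>))"

definition hyp_H3 :: "pt set \<Rightarrow> pt set \<Rightarrow> pt set \<Rightarrow> real \<Rightarrow> (pt \<Rightarrow> real) \<Rightarrow>
    (real \<Rightarrow> (pt \<Rightarrow> real) \<Rightarrow> real) \<Rightarrow> (real \<Rightarrow> (pt \<Rightarrow> real) \<Rightarrow> real) \<Rightarrow> bool" where
  "hyp_H3 \<Omega> \<Gamma>\<^sub>D \<Gamma>\<^sub>N T h0 q g \<longleftrightarrow>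
     h0 \<in> L2 (lebesgue_on \<Omega>) \<and>
     q \<in> bochner_L2 T (V_dual \<Omega> \<Gamma>\<^sub>D) (V_dual_norm \<Omega> \<Gamma>\<^sub>D) \<and>
     g \<in> bochner_L2 T (H_minus_half \<Omega> \<Gamma>\<^sub>N) (H_minus_half_norm \<Omega> \<Gamma>\<^sub>N)"

text \<open>Weak gradients and traces of \<open>h t\<close> are chosen separately for each \<open>t\<close>, so their joint
  measurability in \<open>(t, x)\<close> depends on the choice; iterated integrals do not.\<close>

definition iterated_integrable :: "'a measure \<Rightarrow> 'b measure \<Rightarrow> ('a \<Rightarrow> 'b \<Rightarrow> real) \<Rightarrow> bool" where
  "iterated_integrable M N f \<longleftrightarrow>
     (AE t in M. integrable N (f t)) \<and>
     integrable M (\<lambda>t. \<integral>x. f t x \<partial>N) \<and>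
     integrable M (\<lambda>t. \<integral>x. \<bar>f t x\<bar> \<partial>N)"

text \<open>\<open>h t x\<close> is the value at time \<open>t\<close> and position \<open>x\<close>. The common definition covers the extended
  problem (boundary law \<open>\<beta>\<close>, source \<open>q\<close>) and the physical model. Since the integral of a
  non-integrable function is 0 by convention, the existence of the diffusion and boundary integrals is
  demanded explicitly; for the extended problem it follows from the growth conditions.\<close>

definition weak_solution ::
  "pt set \<Rightarrow> pt set \<Rightarrow> pt set \<Rightarrow> real \<Rightarrow> (pt \<Rightarrow> real \<Rightarrow> real) \<Rightarrow> (pt \<Rightarrow> real \<Rightarrow> real) \<Rightarrow>
   (pt \<Rightarrow> real \<Rightarrow> real \<Rightarrow> real) \<Rightarrow> (pt \<Rightarrow> real) \<Rightarrow> (real \<Rightarrow> (pt \<Rightarrow> real) \<Rightarrow> real) \<Rightarrow>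
   (real \<Rightarrow> (pt \<Rightarrow> real) \<Rightarrow> real) \<Rightarrow> (real \<Rightarrow> pt \<Rightarrow> real) \<Rightarrow> bool" where
  "weak_solution \<Omega> \<Gamma>\<^sub>D \<Gamma>\<^sub>R T S \<T> \<beta> h0 q g h \<longleftrightarrow>
     (let B = primitive S; V = V_space \<Omega> \<Gamma>\<^sub>D; Bh = (\<lambda>t x. B x (h t x));
          diffusion = (\<lambda>v t x. \<T> x (h t x) * (weak_gradient \<Omega> (h t) x \<bullet> weak_gradient \<Omega> v x));
          exchange = (\<lambda>v t x. \<beta> x t (boundary_trace \<Omega> (h t) x) * boundary_trace \<Omega> v x)
      in
        (\<lambda>(x, t). h t x) \<in> borel_measurable (lebesgue_on (\<Omega> \<times> {0<..<T})) \<and>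
        h \<in> bochner_L_infinity T (L2 (lebesgue_on \<Omega>)) (L2_norm (lebesgue_on \<Omega>)) \<and>
        h \<in> bochner_L2 T V (V_norm \<Omega>) \<and>
        Bh \<in> bochner_L2 T (H1 \<Omega>) (H1_norm \<Omega>) \<and>
        (\<exists>w \<in> bochner_L2 T (V_dual \<Omega> \<Gamma>\<^sub>D) (V_dual_norm \<Omega> \<Gamma>\<^sub>D). has_time_derivative \<Omega> \<Gamma>\<^sub>D T Bh w) \<and>
        (\<forall>v\<in>V.
           iterated_integrable (time T) (lebesgue_on \<Omega>) (diffusion v) \<and>
           iterated_integrable (time T) (surface_on \<Gamma>\<^sub>R) (exchange v)) \<and>
        (\<forall>v\<in>V. \<forall>\<psi> \<psi>'.
           (\<forall>t\<in>{0..T}. (\<psi> has_real_derivative \<psi>' t) (at t within {0..T})) \<and>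
           continuous_on {0..T} \<psi>' \<and> \<psi> T = 0 \<longrightarrow>
           - (\<integral>t. L2_inner \<Omega> (Bh t) v * \<psi>' t \<partial>time T)
             + (\<integral>t. (\<integral>x. diffusion v t x * \<psi> t \<partial>lebesgue_on \<Omega>) \<partial>time T)
             + (\<integral>t. (\<integral>x. exchange v t x * \<psi> t \<partial>surface_on \<Gamma>\<^sub>R) \<partial>time T)
           = (\<integral>t. (q t v - g t (boundary_trace \<Omega> v)) * \<psi> t \<partial>time T)
             + L2_inner \<Omega> (\<lambda>x. B x (h0 x)) v * \<psi> 0))"


section \<open>The physical coefficients\<close>

definition S_ph :: "real \<Rightarrow> real \<Rightarrow> (pt \<Rightarrow> real) \<Rightarrow> pt \<Rightarrow> real \<Rightarrow> real" where
  "S_ph n\<^sub>e S\<^sub>s \<eta> x r = n\<^sub>e + S\<^sub>s * (r - \<eta> x)"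

definition T_ph :: "real \<Rightarrow> (pt \<Rightarrow> real) \<Rightarrow> pt \<Rightarrow> real \<Rightarrow> real" where
  "T_ph K \<eta> x r = K * (r - \<eta> x)"

lemma primitive_S_ph:
  "primitive (S_ph n\<^sub>e S\<^sub>s \<eta>) x r = n\<^sub>e * r + S\<^sub>s / 2 * r\<^sup>2 - S\<^sub>s * \<eta> x * r"
proof -
  let ?F = "\<lambda>r. n\<^sub>e * r + S\<^sub>s / 2 * r\<^sup>2 - S\<^sub>s * \<eta> x * r"
  have "(LBINT s=ereal 0..ereal r. S_ph n\<^sub>e S\<^sub>s \<eta> x s) = ?F r - ?F 0"
    by (rule interval_integral_FTC_finite)
       (auto intro!: continuous_intros derivative_eq_intros
             simp: S_ph_def has_real_derivative_iff_has_vector_derivative[symmetric] algebra_simps)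
  then show ?thesis
    by (simp add: primitive_def)
qed

end

theory Submission
  imports Defs
begin

text \<open>
  Where the solution takes its values in \<open>I = {m..M}\<close>, the extended coefficients are the physical ones,
  so the theorem is a substitution in the weak formulation. Three of the substitutions need an
  argument.

  The storage term. The coefficients agree only on \<open>I\<close>, but their primitives \<open>B\<close> and \<open>B\<^sub>p\<^sub>h\<close> start at \<open>0\<close>,
  which may lie outside of \<open>I\<close>. On \<open>I\<close> they differ by the function \<open>c(x) = B(x,m) - B\<^sub>p\<^sub>h(x,m)\<close>
  (\<open>primitive_diff_cong\<close>). It belongs to \<open>H1\<close>, so \<open>B\<^sub>p\<^sub>h(h)\<close> is again square integrable in time with values
  in \<open>H1\<close> (\<open>bochner_L2_H1_diff\<close>), and since it is constant in time, the time derivative is unchanged and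
  the storage term of the weak formulation changes by \<open>(c,v) \<integral> \<psi>' = - (c,v) \<psi>(0)\<close>
  (\<open>integral_L2_inner_diff\<close>). The initial term changes by the same amount, provided that
  \<open>B\<^sub>p\<^sub>h(h\<^sub>0) = B(h\<^sub>0) - c\<close>, that is, provided that \<open>h\<^sub>0\<close> has its values in \<open>I\<close>, too.

  The initial datum. This property of \<open>h\<^sub>0\<close> is a consequence of the weak formulation
  (\<open>initial_datum_mem\<close>). Test functions in time that concentrate at \<open>t = 0\<close> exhibit \<open>(B(h\<^sub>0), v)\<close> as a limit of
  averages of \<open>(B(h(t)), v)\<close>. For \<open>v \<ge> 0\<close> these lie between \<open>(B(m), v)\<close> and \<open>(B(M), v)\<close>. The fundamental lemma
  of the calculus of variations (\<open>AE_nonneg_if_test_nonneg\<close>) yields \<open>B(m) \<le> B(h\<^sub>0) \<le> B(M)\<close> almost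
  everywhere, and \<open>B\<close> is strictly increasing in \<open>r\<close>.

  The exchange term. The boundary laws agree at levels in \<open>I\<close>, so the trace of \<open>h(t)\<close> must take its values
  in \<open>I\<close> (\<open>trace_AE_mem\<close>). In a Lipschitz chart, a smooth approximation of \<open>h(t)\<close> at a boundary point is
  compared with its values on a short segment that enters the domain: there the approximation is close
  to \<open>I\<close> in the mean, and the variation along the segment is controlled by the gradient on a thin strip.
  The exceptional parameters of the chart form a null set, and a Lipschitz map turns it into a null
  set of the one-dimensional Hausdorff measure.

  Weak gradients and traces are chosen representatives. The fundamental lemma makes weak gradients
  unique up to null sets, which turns \<open>H1_norm\<close> into a seminorm that does not depend on
  representatives; strong measurability in \<open>H1\<close> rests on this.
\<close>

section \<open>Complete measures\<close>

lemma (in complete_measure) borel_measurable_AE_eq: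
  fixes f g :: "'a \<Rightarrow> 'b::topological_space"
  assumes f: "f \<in> borel_measurable M" and ae: "AE x in M. f x = g x"
  shows "g \<in> borel_measurable M"
proof (rule measurableI)
  fix A :: "'b set" assume A: "A \<in> sets borel"
  have "f -` A \<inter> space M \<in> sets M"
    using f A by (rule measurable_sets)
  moreover have "AE x in M. x \<in> f -` A \<inter> space M \<longleftrightarrow> x \<in> g -` A \<inter> space M"
    using ae by eventually_elim auto
  ultimately show "g -` A \<inter> space M \<in> sets M"
    using in_sets_AE[of "f -` A \<inter> space M" "g -` A \<inter> space M"] by simp
qed auto

lemma (in complete_measure) complete_restrict_space:
  assumes "\<Omega> \<in> sets M"
  shows "complete_measure (restrict_space M \<Omega>)"
proof
  fix A B assume "A \<subseteq> B" "B \<in> null_sets (restrict_space M \<Omega>)"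
  then show "A \<in> sets (restrict_space M \<Omega>)"
    using assms complete by (fastforce simp: null_sets_restrict_space sets_restrict_space_iff)
qed

lemma (in complete_measure) integrable_AE_eq_iff:
  fixes f g :: "'a \<Rightarrow> real"
  assumes ae: "AE x in M. f x = g x"
  shows "integrable M f \<longleftrightarrow> integrable M g"
  by (smt (verit, ccfv_SIG) AE_cong ae borel_measurable_AE_eq borel_measurable_integrable eventually_mono
      integrable_cong_AE)

lemma (in complete_measure) integral_AE_eq:
  fixes f g :: "'a \<Rightarrow> real"
  assumes ae: "AE x in M. f x = g x"
  shows "integral\<^sup>L M f = integral\<^sup>L M g"
proof (cases "integrable M f")
  case True
  then have "integrable M g" using integrable_AE_eq_iff[OF ae] by simp
  with True ae show ?thesis by (intro integral_cong_AE) auto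
next
  case False
  then have "\<not> integrable M g" using integrable_AE_eq_iff[OF ae] by simp
  with False show ?thesis by (simp add: not_integrable_integral_eq)
qed

lemma complete_lebesgue_on: "\<Omega> \<in> sets lebesgue \<Longrightarrow> complete_measure (lebesgue_on \<Omega>)"
  by (rule completion.complete_restrict_space)

section \<open>Smooth bumps\<close>

text \<open>The functions \<open>p(1/t) exp(-1/t)\<close> for a polynomial \<open>p\<close>, extended by zero to \<open>t \<le> 0\<close>: a family
  that contains \<open>exp(-1/t)\<close> and is closed under differentiation.\<close>

definition flat_exp :: "real poly \<Rightarrow> real \<Rightarrow> real" where
  "flat_exp p t = (if t > 0 then poly p (1 / t) * exp (- (1 / t)) else 0)"

lemma poly_div_exp_tendsto_0: "((\<lambda>s. poly p s / exp s) \<longlongrightarrow> (0::real)) at_top"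
proof -
  have "((\<lambda>s. \<Sum>i\<le>degree p. coeff p i * (s ^ i / exp s)) \<longlongrightarrow> (\<Sum>i\<le>degree p. coeff p i * 0)) at_top"
    by (intro tendsto_intros tendsto_power_div_exp_0)
  then show ?thesis
    by (simp add: poly_altdef sum_divide_distrib)
qed

lemma flat_exp_tendsto_0: "(flat_exp p \<longlongrightarrow> 0) (at_right 0)"
proof -
  have "((\<lambda>t. poly p (inverse t) / exp (inverse t)) \<longlongrightarrow> 0) (at_right (0::real))"
    by (rule filterlim_compose[OF poly_div_exp_tendsto_0 filterlim_inverse_at_top_right])
  moreover have "\<forall>\<^sub>F t in at_right 0. poly p (inverse t) / exp (inverse t) = flat_exp p t"
    by (auto simp: eventually_at_filter flat_exp_def exp_minus field_simps)
  ultimately show ?thesis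
    by (rule Lim_transform_eventually)
qed

text \<open>In the variable \<open>s = 1/t\<close> the derivative is \<open>-s\<^sup>2 d/ds\<close>, which turns \<open>p exp(-s)\<close> into
  \<open>s\<^sup>2 (p - p') exp(-s)\<close>. At \<open>t = 0\<close> the difference quotient is \<open>s p exp(-s)\<close>, again a member of the
  family, and tends to zero.\<close>

lemma flat_exp_deriv:
  "(flat_exp p has_real_derivative flat_exp (pCons 0 (pCons 0 (p - pderiv p))) t) (at t)"
proof -
  let ?q = "pCons 0 (pCons 0 (p - pderiv p))"
  consider "t > 0" | "t < 0" | "t = 0" by linarith
  then show ?thesis
  proof cases
    case 1
    have *: "((\<lambda>t. poly p (1 / t) * exp (- (1 / t))) has_real_derivative flat_exp ?q t) (at t)"
      using 1 by (auto intro!: derivative_eq_intros simp: flat_exp_def field_simps power2_eq_square)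
    show ?thesis
      by (rule has_field_derivative_transform_within_open[OF *, of "{0<..}"])
         (use 1 in \<open>auto simp: flat_exp_def\<close>)
  next
    case 2
    have *: "((\<lambda>t. 0) has_real_derivative flat_exp ?q t) (at t)"
      using 2 by (auto intro!: derivative_eq_intros simp: flat_exp_def)
    show ?thesis
      by (rule has_field_derivative_transform_within_open[OF *, of "{..<0}"])
         (use 2 in \<open>auto simp: flat_exp_def\<close>)
  next
    case 3
    have "((\<lambda>h. flat_exp p h / h) \<longlongrightarrow> 0) (at_right 0)"
    proof (rule Lim_transform_eventually[OF flat_exp_tendsto_0])
      show "\<forall>\<^sub>F h in at_right 0. flat_exp (pCons 0 p) h = flat_exp p h / h"
        by (auto simp: eventually_at_filter flat_exp_def)
    qed
    moreover have "((\<lambda>h. flat_exp p h / h) \<longlongrightarrow> 0) (at_left 0)"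
      by (rule tendsto_eventually) (auto simp: eventually_at_filter flat_exp_def)
    ultimately have "((\<lambda>h. flat_exp p h / h) \<longlongrightarrow> 0) (at 0)"
      by (simp add: filterlim_split_at_real)
    then show ?thesis using 3
      by (simp add: has_field_derivative_iff flat_exp_def)
  qed
qed

text \<open>All directional derivatives of a member are members (\<open>bump_algebra_deriv\<close>), so smoothness of the
  whole algebra follows by one induction on the order of differentiation.\<close>

inductive_set bump_algebra :: "('a::euclidean_space \<Rightarrow> real) set" where
  flat: "(\<lambda>x. flat_exp p (a + x \<bullet> v)) \<in> bump_algebra"
| const: "(\<lambda>x. c) \<in> bump_algebra"
| add: "f \<in> bump_algebra \<Longrightarrow> g \<in> bump_algebra \<Longrightarrow> (\<lambda>x. f x + g x) \<in> bump_algebra"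
| mult: "f \<in> bump_algebra \<Longrightarrow> g \<in> bump_algebra \<Longrightarrow> (\<lambda>x. f x * g x) \<in> bump_algebra"

lemma bump_algebra_deriv:
  "f \<in> bump_algebra \<Longrightarrow>
    \<exists>D. (\<forall>x. (f has_derivative D x) (at x)) \<and> (\<forall>b. (\<lambda>x. D x b) \<in> bump_algebra)"
proof (induction rule: bump_algebra.induct)
  case (flat p a v)
  let ?q = "pCons 0 (pCons 0 (p - pderiv p))"
  have "((\<lambda>x. flat_exp p (a + x \<bullet> v)) has_derivative (\<lambda>h. (h \<bullet> v) * flat_exp ?q (a + x \<bullet> v))) (at x)" for x
    by (rule has_derivative_eq_rhs, rule DERIV_compose_FDERIV[OF flat_exp_deriv])
       (auto intro!: derivative_eq_intros)
  then show ?case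
    by (intro exI[of _ "\<lambda>x h. (h \<bullet> v) * flat_exp ?q (a + x \<bullet> v)"])
       (auto intro: bump_algebra.intros)
next
  case (const c)
  show ?case by (intro exI[of _ "\<lambda>x h. 0"]) (auto intro: bump_algebra.intros)
next
  case (add f g)
  then obtain D E where
    "\<And>x. (f has_derivative D x) (at x)" "\<And>b. (\<lambda>x. D x b) \<in> bump_algebra"
    "\<And>x. (g has_derivative E x) (at x)" "\<And>b. (\<lambda>x. E x b) \<in> bump_algebra" by blast
  then show ?case
    by (intro exI[of _ "\<lambda>x h. D x h + E x h"]) (auto intro!: bump_algebra.intros derivative_intros)
next
  case (mult f g)
  then obtain D E where
    "\<And>x. (f has_derivative D x) (at x)" "\<And>b. (\<lambda>x. D x b) \<in> bump_algebra"
    "\<And>x. (g has_derivative E x) (at x)" "\<And>b. (\<lambda>x. E x b) \<in> bump_algebra" by blast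
  with mult.hyps show ?case
    by (intro exI[of _ "\<lambda>x h. f x * E x h + D x h * g x"])
      (auto intro!: bump_algebra.intros derivative_intros)
qed

lemma C_k_bump_algebra: "f \<in> bump_algebra \<Longrightarrow> C_k k f"
proof (induction k arbitrary: f)
  case 0
  then obtain D where "\<And>x. (f has_derivative D x) (at x)"
    using bump_algebra_deriv by blast
  then show ?case
    by (auto intro!: continuous_at_imp_continuous_on has_derivative_continuous)
next
  case (Suc k)
  then obtain D where D: "\<And>x. (f has_derivative D x) (at x)" "\<And>b. (\<lambda>x. D x b) \<in> bump_algebra"
    using bump_algebra_deriv by blast
  then have "\<And>x. frechet_derivative f (at x) = D x"
    using frechet_derivative_at by metis
  with D Suc.IH show ?case
    by (auto simp: differentiable_def)
qed

lemma prod_bump_algebra: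
  "finite I \<Longrightarrow> (\<And>i. i \<in> I \<Longrightarrow> f i \<in> bump_algebra) \<Longrightarrow> (\<lambda>x. \<Prod>i\<in>I. f i x) \<in> bump_algebra"
  by (induction rule: finite_induct) (auto intro: bump_algebra.intros)

text \<open>As \<open>n\<close> grows, these smooth functions, which vanish outside the open box, converge to its
  indicator function.\<close>

definition box_bump :: "'a::euclidean_space \<Rightarrow> 'a \<Rightarrow> nat \<Rightarrow> 'a \<Rightarrow> real" where
  "box_bump a b n x = (\<Prod>i\<in>Basis. flat_exp 1 (real (Suc n) * (x \<bullet> i - a \<bullet> i)) * flat_exp 1
      (real (Suc n) * (b \<bullet> i - x \<bullet> i)))"

lemma flat_exp_1_bounds: "0 \<le> flat_exp 1 t" "flat_exp 1 t \<le> 1"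
  by (auto simp: flat_exp_def)

lemma box_bump_bounds: "0 \<le> box_bump a b n x" "box_bump a b n x \<le> 1"
  unfolding box_bump_def
  by (auto intro!: prod_nonneg prod_le_1 mult_nonneg_nonneg mult_le_one flat_exp_1_bounds)

lemma box_bump_eq_0: "x \<notin> box a b \<Longrightarrow> box_bump a b n x = 0"
  by (auto simp: box_bump_def mem_box flat_exp_def not_less zero_less_mult_iff
      intro!: prod_zero bexI)

lemma box_bump_tendsto: "(\<lambda>n. box_bump a b n x) \<longlonglongrightarrow> indicator (box a b) x"
proof (cases "x \<in> box a b")
  case False
  then show ?thesis by (simp add: box_bump_eq_0)
next
  case True
  have *: "(\<lambda>n. flat_exp 1 (real (Suc n) * t)) \<longlonglongrightarrow> 1" if "t > 0" for t
  proof -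
    have "(\<lambda>n. exp (- (1 / (real (Suc n) * t)))) \<longlonglongrightarrow> exp (- 0)"
    proof (intro tendsto_intros)
      have "(\<lambda>n. (1 / t) * inverse (real (Suc n))) \<longlonglongrightarrow> (1 / t) * 0"
        by (intro tendsto_intros LIMSEQ_inverse_real_of_nat)
      then show "(\<lambda>n. 1 / (real (Suc n) * t)) \<longlonglongrightarrow> 0"
        by (simp add: field_simps)
    qed
    then show ?thesis using that by (simp add: flat_exp_def)
  qed
  have "(\<lambda>n. box_bump a b n x) \<longlonglongrightarrow> (\<Prod>i\<in>(Basis::'a set). 1 * 1)"
    unfolding box_bump_def
  proof (rule tendsto_prod, rule tendsto_mult)
    fix i :: 'a assume "i \<in> Basis"
    then have pos: "x \<bullet> i - a \<bullet> i > 0" "b \<bullet> i - x \<bullet> i > 0" using True by (auto simp: mem_box)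
    show "(\<lambda>n. flat_exp 1 (real (Suc n) * (x \<bullet> i - a \<bullet> i))) \<longlonglongrightarrow> 1"
      by (rule *[OF pos(1)])
    show "(\<lambda>n. flat_exp 1 (real (Suc n) * (b \<bullet> i - x \<bullet> i))) \<longlonglongrightarrow> 1"
      by (rule *[OF pos(2)])
  qed
  then show ?thesis using True by simp
qed

lemma box_bump_test_function:
  assumes "cbox a b \<subseteq> U"
  shows "box_bump a b n \<in> test_functions U"
proof -
  have "(\<lambda>x. \<Prod>i\<in>Basis. flat_exp 1 ((- real (Suc n) * (a \<bullet> i)) + x \<bullet> (real (Suc n) *\<^sub>R i)) *
      flat_exp 1 ((real (Suc n) * (b \<bullet> i)) + x \<bullet> (- real (Suc n) *\<^sub>R i))) \<in> bump_algebra"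
    by (intro prod_bump_algebra bump_algebra.intros finite_Basis)
  moreover have "(\<lambda>x. \<Prod>i\<in>Basis. flat_exp 1 ((- real (Suc n) * (a \<bullet> i)) + x \<bullet> (real (Suc n) *\<^sub>R i)) *
      flat_exp 1 ((real (Suc n) * (b \<bullet> i)) + x \<bullet> (- real (Suc n) *\<^sub>R i))) = box_bump a b n"
    by (simp add: fun_eq_iff box_bump_def algebra_simps)
  ultimately have "C_infinity (box_bump a b n)"
    by (simp add: C_infinity_def C_k_bump_algebra)
  moreover have "closure {x. box_bump a b n x \<noteq> 0} \<subseteq> cbox a b"
    by (rule closure_minimal) (use box_bump_eq_0 box_subset_cbox in fastforce)+
  ultimately show ?thesis
    using assms by (auto simp: test_functions_def compact_eq_bounded_closed
        intro: bounded_subset[OF bounded_cbox])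
qed

section \<open>Integration against smooth functions\<close>

lemma C_infinity_differentiable: "C_infinity f \<Longrightarrow> f differentiable at x"
  unfolding C_infinity_def by (metis C_k.simps(2))

lemma C_infinity_has_derivative: "C_infinity f \<Longrightarrow> (f has_derivative frechet_derivative f (at x)) (at x)"
  by (simp add: C_infinity_differentiable frechet_derivative_works[symmetric])

lemma C_infinity_partial: "C_infinity f \<Longrightarrow> b \<in> Basis \<Longrightarrow> C_infinity (\<lambda>x. frechet_derivative f (at x) b)"
  unfolding C_infinity_def by (metis C_k.simps(2))

lemma C_infinity_continuous: "C_infinity f \<Longrightarrow> continuous_on S f"
  unfolding C_infinity_def by (metis C_k.simps(1) continuous_on_subset subset_UNIV)

lemma C_infinity_const: "C_infinity (\<lambda>x. c)"
  unfolding C_infinity_def using C_k_bump_algebra bump_algebra.const by blast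

lemma test_functionD:
  assumes "\<phi> \<in> test_functions U"
  shows "C_infinity \<phi>" "compact (closure {x. \<phi> x \<noteq> 0})" "closure {x. \<phi> x \<noteq> 0} \<subseteq> U"
  using assms by (auto simp: test_functions_def)

lemma frechet_derivative_outside_support:
  assumes "x \<notin> closure {x. \<phi> x \<noteq> 0}"
  shows "frechet_derivative \<phi> (at x) b = (0::real)"
proof -
  have "(\<phi> has_derivative (\<lambda>_. 0)) (at x)"
  proof (rule has_derivative_transform_within_open[of "\<lambda>_. 0" _ _ _ "- closure {x. \<phi> x \<noteq> 0}"])
    fix y assume "y \<in> - closure {x. \<phi> x \<noteq> 0}"
    then have "y \<notin> {x. \<phi> x \<noteq> 0}" using closure_subset[of "{x. \<phi> x \<noteq> 0}"] by blast
    then show "0 = \<phi> y" by simp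
  qed (use assms in auto)
  from frechet_derivative_at[OF this, symmetric] show ?thesis by simp
qed

text \<open>By translation invariance the difference quotients \<open>(f (x + h v) - f x) / h\<close> have integral zero.
  They are bounded by the maximum of the derivative and vanish outside a fixed ball, so dominated
  convergence passes the property to the derivative. Applied to a product \<open>f \<phi>\<close> this is integration
  by parts.\<close>

lemma integral_derivative_compact_support:
  fixes f :: "'a::euclidean_space \<Rightarrow> real"
  assumes diff: "\<And>x. (f has_derivative D x) (at x)"
    and cont: "continuous_on UNIV (\<lambda>x. D x v)"
    and K: "compact K" "\<And>x. x \<notin> K \<Longrightarrow> f x = 0" "\<And>x. x \<notin> K \<Longrightarrow> D x v = 0"
  shows "(\<integral>x. D x v \<partial>lborel) = 0"
proof -
  have contf: "continuous_on UNIV f"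
    by (auto intro!: continuous_at_imp_continuous_on has_derivative_continuous diff)
  then have f_meas[measurable]: "f \<in> borel_measurable borel"
    by (rule borel_measurable_continuous_onI)
  define h where "h n = inverse (real (Suc n))" for n
  have h: "0 < h n" "h n \<le> 1" for n
    by (auto simp: h_def field_simps)
  define q where "q n x = (f (x + h n *\<^sub>R v) - f x) / h n" for n x
  obtain R where R: "R \<ge> 0" "\<And>x. x \<in> K \<Longrightarrow> norm x \<le> R"
    using compact_imp_bounded[OF K(1)] unfolding bounded_iff by (meson dual_order.trans linear)
  have "bounded ((\<lambda>x. D x v) ` K)"
    by (intro compact_imp_bounded compact_continuous_image continuous_on_subset[OF cont] K(1)) auto
  then obtain L where "\<And>x. x \<in> K \<Longrightarrow> \<bar>D x v\<bar> \<le> L"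
    unfolding bounded_iff by auto
  then have L: "\<bar>D x v\<bar> \<le> max L 0" for x
    using K(3)[of x] by (cases "x \<in> K") (auto simp: le_max_iff_disj)
  have int_f: "integrable lborel f"
  proof -
    have "integrable lborel (\<lambda>x. indicator K x *\<^sub>R f x)"
      by (intro borel_integrable_compact continuous_on_subset[OF contf] K(1)) auto
    moreover have "(\<lambda>x. indicator K x *\<^sub>R f x) = f"
      using K(2) by (auto simp: indicator_def fun_eq_iff)
    ultimately show ?thesis by simp
  qed
  have int_shift: "integrable lborel (\<lambda>x. f (x + a))" "(\<integral>x. f (x + a) \<partial>lborel) = (\<integral>x. f x \<partial>lborel)" for a
  proof -
    have eq: "distr lborel borel (\<lambda>x. x + a) = (lborel :: 'a measure)"
      using lborel_distr_plus[of a] by (simp add: add.commute[of a, abs_def])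
    have "integrable (distr lborel borel (\<lambda>x. x + a)) f"
      unfolding eq by (rule int_f)
    then show "integrable lborel (\<lambda>x. f (x + a))"
      by (rule integrable_distr[rotated]) simp
    have "(\<integral>x. f x \<partial>distr lborel borel (\<lambda>x. x + a)) = (\<integral>x. f (x + a) \<partial>lborel)"
      by (rule integral_distr) simp_all
    then show "(\<integral>x. f (x + a) \<partial>lborel) = (\<integral>x. f x \<partial>lborel)"
      unfolding eq by simp
  qed
  have "(\<lambda>n. \<integral>x. q n x \<partial>lborel) \<longlonglongrightarrow> (\<integral>x. D x v \<partial>lborel)"
  proof (rule integral_dominated_convergence[where w = "\<lambda>x. max L 0 * indicator (cball 0 (R + norm v)) x"])
    show "AE x in lborel. (\<lambda>n. q n x) \<longlonglongrightarrow> D x v"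
    proof (intro AE_I2)
      fix x
      have "((\<lambda>t. f (x + t *\<^sub>R v)) has_derivative (\<lambda>t. D x (t *\<^sub>R v))) (at 0)"
        by (rule has_derivative_compose[of "\<lambda>t. x + t *\<^sub>R v", where g = f])
           (auto intro!: derivative_eq_intros diff)
      then have "((\<lambda>t. f (x + t *\<^sub>R v)) has_real_derivative D x v) (at 0)"
        using linear_cmul[OF has_derivative_linear[OF diff[of x]]]
        by (simp add: has_field_derivative_def mult_commute_abs)
      then have "((\<lambda>t. (f (x + t *\<^sub>R v) - f x) / t) \<longlongrightarrow> D x v) (at 0)"
        by (simp add: has_field_derivative_iff)
      moreover have "filterlim h (at 0) sequentially"
        unfolding filterlim_at using LIMSEQ_inverse_real_of_nat h(1)
        by (auto simp: h_def[abs_def])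
      ultimately show "(\<lambda>n. q n x) \<longlonglongrightarrow> D x v"
        unfolding q_def by (rule filterlim_compose)
    qed
    show "AE x in lborel. norm (q n x) \<le> max L 0 * indicator (cball 0 (R + norm v)) x" for n
    proof (intro AE_I2)
      fix x
      show "norm (q n x) \<le> max L 0 * indicator (cball 0 (R + norm v)) x"
      proof (cases "x \<in> cball 0 (R + norm v)")
        case True
        have "((\<lambda>t. f (x + t *\<^sub>R v)) has_real_derivative D (x + t *\<^sub>R v) v) (at t)" for t
        proof -
          have "((\<lambda>t. f (x + t *\<^sub>R v)) has_derivative (\<lambda>s. D (x + t *\<^sub>R v) (s *\<^sub>R v))) (at t)"
            by (rule has_derivative_compose[of "\<lambda>t. x + t *\<^sub>R v", where g = f])
               (auto intro!: derivative_eq_intros diff)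
          then show ?thesis
            using linear_cmul[OF has_derivative_linear[OF diff]]
            by (simp add: has_field_derivative_def mult_commute_abs)
        qed
        then obtain z where "f (x + h n *\<^sub>R v) - f (x + 0 *\<^sub>R v) = (h n - 0) * D (x + z *\<^sub>R v) v"
          using MVT2[of 0 "h n" "\<lambda>t. f (x + t *\<^sub>R v)" "\<lambda>t. D (x + t *\<^sub>R v) v"] h(1) by blast
        then have "q n x = D (x + z *\<^sub>R v) v"
          using h(1)[of n] by (simp add: q_def field_simps)
        then show ?thesis using True L by simp
      next
        case False
        then have "x \<notin> K" using R by (auto simp: mem_cball) (smt (verit) norm_ge_zero)
        moreover have "x + h n *\<^sub>R v \<notin> K"
        proof
          assume "x + h n *\<^sub>R v \<in> K"
          then have "norm (x + h n *\<^sub>R v) \<le> R" using R by auto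
          moreover have "norm (h n *\<^sub>R v) \<le> norm v"
            using h[of n] by (simp add: mult_left_le_one_le)
          ultimately show False using False norm_triangle_ineq4[of "x + h n *\<^sub>R v" "h n *\<^sub>R v"]
            by simp
        qed
        ultimately show ?thesis using False K(2) by (simp add: q_def)
      qed
    qed
    show "(\<lambda>x. D x v) \<in> borel_measurable lborel"
      using borel_measurable_continuous_onI[OF cont] by simp
    show "q n \<in> borel_measurable lborel" for n
      unfolding q_def by measurable
    show "integrable lborel (\<lambda>x. max L 0 * indicator (cball 0 (R + norm v)) x)"
      by (intro integrable_mult_right integrable_real_indicator)
        (use emeasure_bounded_finite[OF bounded_cball] in auto)
  qed
  moreover have "(\<integral>x. q n x \<partial>lborel) = 0" for n
    unfolding q_def using int_f int_shift by simp
  ultimately show ?thesis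
    by (simp add: LIMSEQ_const_iff)
qed

lemma integral_lebesgue_on_supported:
  fixes f :: "'a::euclidean_space \<Rightarrow> real"
  assumes "\<Omega> \<in> sets lebesgue" "\<And>x. x \<notin> \<Omega> \<Longrightarrow> f x = 0"
  shows "(\<integral>x. f x \<partial>lebesgue_on \<Omega>) = (\<integral>x. f x \<partial>lebesgue)"
    and "integrable (lebesgue_on \<Omega>) f \<longleftrightarrow> integrable lebesgue f"
proof -
  have eq: "(\<lambda>x. if x \<in> \<Omega> then f x else 0) = f" using assms(2) by auto
  show "(\<integral>x. f x \<partial>lebesgue_on \<Omega>) = (\<integral>x. f x \<partial>lebesgue)"
    using Lebesgue_Measure.integral_restrict_UNIV[OF assms(1), of f] by (simp add: eq)
  show "integrable (lebesgue_on \<Omega>) f \<longleftrightarrow> integrable lebesgue f"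
    using Lebesgue_Measure.integrable_restrict_UNIV[OF assms(1), of f] by (simp add: eq)
qed

lemma integrable_loc_mult:
  fixes u \<phi> :: "'a::euclidean_space \<Rightarrow> real"
  assumes \<Omega>: "\<Omega> \<in> sets lebesgue" and C: "compact C" "C \<subseteq> \<Omega>"
    and u: "u absolutely_integrable_on C"
    and \<phi>: "continuous_on UNIV \<phi>" "\<And>x. x \<notin> C \<Longrightarrow> \<phi> x = 0"
  shows "integrable (lebesgue_on \<Omega>) (\<lambda>x. u x * \<phi> x)"
proof -
  have "bounded (\<phi> ` C)"
    by (intro compact_imp_bounded compact_continuous_image continuous_on_subset[OF \<phi>(1)] C(1)) auto
  then obtain K where K: "\<And>x. x \<in> C \<Longrightarrow> \<bar>\<phi> x\<bar> \<le> K"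
    unfolding bounded_iff by auto
  have u': "integrable lebesgue (\<lambda>x. indicator C x * u x)"
    using u by (simp add: set_integrable_def)
  have "integrable lebesgue (\<lambda>x. (indicator C x * u x) * \<phi> x)"
  proof (rule Bochner_Integration.integrable_bound[OF integrable_mult_right[OF u', of K]])
    have "\<phi> \<in> borel_measurable lebesgue"
      using borel_measurable_continuous_onI[OF \<phi>(1)] by (simp add: measurable_completion)
    then show "(\<lambda>x. (indicator C x * u x) * \<phi> x) \<in> borel_measurable lebesgue"
      using u' by auto
    show "AE x in lebesgue. norm (indicator C x * u x * \<phi> x) \<le> norm (K * (indicator C x * u x))"
    proof (intro AE_I2)
      fix x
      have "\<bar>\<phi> x\<bar> \<le> \<bar>K\<bar>" if "x \<in> C" using K[OF that] by linarith
      then show "norm (indicator C x * u x * \<phi> x) \<le> norm (K * (indicator C x * u x))"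
        by (auto simp: indicator_def abs_mult mult.commute[of "\<bar>u x\<bar>"] intro!: mult_right_mono)
    qed
  qed
  moreover have "(\<lambda>x. (indicator C x * u x) * \<phi> x) = (\<lambda>x. u x * \<phi> x)"
    using \<phi>(2) by (auto simp: indicator_def fun_eq_iff)
  ultimately have "integrable lebesgue (\<lambda>x. u x * \<phi> x)" by simp
  then show ?thesis
    using integral_lebesgue_on_supported(2)[OF \<Omega>, of "\<lambda>x. u x * \<phi> x"] C(2) \<phi>(2)
    by (metis mult_zero_right subsetD)
qed

lemma continuous_absolutely_integrable_compact:
  fixes f :: "'a::euclidean_space \<Rightarrow> 'b::euclidean_space"
  assumes "compact C" "continuous_on C f"
  shows "f absolutely_integrable_on C"
proof -
  have "integrable lborel (\<lambda>x. indicator C x *\<^sub>R f x)"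
    using assms by (rule borel_integrable_compact)
  then show ?thesis
    unfolding set_integrable_def by (subst integrable_completion) auto
qed

section \<open>The fundamental lemma of the calculus of variations\<close>

text \<open>Test with the bumps of the box and pass to the limit.\<close>

lemma integral_box_nonneg:
  fixes f :: "'a::euclidean_space \<Rightarrow> real"
  assumes \<Omega>: "open \<Omega>" and f: "\<And>C. compact C \<Longrightarrow> C \<subseteq> \<Omega> \<Longrightarrow> f absolutely_integrable_on C"
    and nonneg: "\<And>\<phi>. \<phi> \<in> test_functions \<Omega> \<Longrightarrow> (\<And>x. 0 \<le> \<phi> x) \<Longrightarrow> 0 \<le> (\<integral>x. f x * \<phi> x \<partial>lebesgue_on \<Omega>)"
    and ab: "cbox a b \<subseteq> \<Omega>"
  shows "0 \<le> integral (cbox a b) f"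
proof -
  have \<Omega>l: "\<Omega> \<in> sets lebesgue" using \<Omega> by simp
  have fc: "integrable lebesgue (\<lambda>x. indicator (cbox a b) x * f x)"
    using f[OF compact_cbox ab] by (simp add: set_integrable_def)
  have fb: "f absolutely_integrable_on box a b"
    using f[OF compact_cbox ab] by (rule set_integrable_subset) (auto simp: box_subset_cbox)
  have bump_meas: "box_bump a b n \<in> borel_measurable lebesgue" for n
  proof -
    have "continuous_on UNIV (box_bump a b n)"
      by (intro C_infinity_continuous test_functionD(1)[of _ \<Omega>] box_bump_test_function ab)
    then show ?thesis by (intro measurable_completion) (simp add: borel_measurable_continuous_onI)
  qed
  have "(\<lambda>n. \<integral>x. (indicator (cbox a b) x * f x) * box_bump a b n x \<partial>lebesgue)
      \<longlonglongrightarrow> (\<integral>x. (indicator (cbox a b) x * f x) * indicator (box a b) x \<partial>lebesgue)"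
  proof (rule integral_dominated_convergence[where w = "\<lambda>x. \<bar>indicator (cbox a b) x * f x\<bar>"])
    show "AE x in lebesgue. (\<lambda>n. indicator (cbox a b) x * f x * box_bump a b n x)
        \<longlonglongrightarrow> indicator (cbox a b) x * f x * indicator (box a b) x"
      by (intro AE_I2 tendsto_intros box_bump_tendsto)
    show "AE x in lebesgue. norm (indicator (cbox a b) x * f x * box_bump a b n x)
        \<le> \<bar>indicator (cbox a b) x * f x\<bar>" for n
      by (intro AE_I2) (simp add: abs_mult mult_left_le box_bump_bounds)
  qed (use fc bump_meas in \<open>auto intro!: borel_measurable_times[OF borel_measurable_integrable[OF fc]]
      borel_measurable_indicator\<close>)
  moreover have "0 \<le> (\<integral>x. (indicator (cbox a b) x * f x) * box_bump a b n x \<partial>lebesgue)" for n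
  proof -
    have "(\<integral>x. f x * box_bump a b n x \<partial>lebesgue_on \<Omega>) = (\<integral>x. f x * box_bump a b n x \<partial>lebesgue)"
    proof (rule integral_lebesgue_on_supported(1)[OF \<Omega>l])
      fix x assume "x \<notin> \<Omega>"
      then have "x \<notin> box a b" using ab box_subset_cbox by blast
      then show "f x * box_bump a b n x = 0" by (simp add: box_bump_eq_0)
    qed
    moreover have "(\<lambda>x. f x * box_bump a b n x) = (\<lambda>x. (indicator (cbox a b) x * f x) * box_bump a b n x)"
    proof
      fix x
      show "f x * box_bump a b n x = (indicator (cbox a b) x * f x) * box_bump a b n x"
        using box_bump_eq_0[of x a b n] box_subset_cbox[of a b] by (cases "x \<in> box a b") auto
    qed
    ultimately show ?thesis
      using nonneg[OF box_bump_test_function[OF ab, of n] box_bump_bounds(1)] by simp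
  qed
  ultimately have "0 \<le> (\<integral>x. (indicator (cbox a b) x * f x) * indicator (box a b) x \<partial>lebesgue)"
    by (intro LIMSEQ_le_const) auto
  also have "(\<lambda>x. (indicator (cbox a b) x * f x) * indicator (box a b) x) = (\<lambda>x. indicator (box a b) x *\<^sub>R f x)"
    using box_subset_cbox[of a b] by (auto simp: indicator_def fun_eq_iff)
  also have "(\<integral>x. indicator (box a b) x *\<^sub>R f x \<partial>lebesgue) = integral (box a b) f"
    using set_lebesgue_integral_eq_integral(2)[OF fb] by (simp add: set_lebesgue_integral_def)
  finally show ?thesis by (simp add: integral_open_interval)
qed

text \<open>The averages of \<open>f\<close> over small cubes are nonnegative and converge to \<open>f\<close> almost everywhere.
  This differentiation theorem concerns functions that are integrable on every box, so \<open>f\<close> is cut off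
  outside a box contained in \<open>\<Omega>\<close>; countably many such boxes cover \<open>\<Omega>\<close>.\<close>

lemma AE_nonneg_if_test_nonneg:
  fixes f :: "'a::euclidean_space \<Rightarrow> real"
  assumes \<Omega>: "open \<Omega>" and f: "\<And>C. compact C \<Longrightarrow> C \<subseteq> \<Omega> \<Longrightarrow> f absolutely_integrable_on C"
    and nonneg: "\<And>\<phi>. \<phi> \<in> test_functions \<Omega> \<Longrightarrow> (\<And>x. 0 \<le> \<phi> x) \<Longrightarrow> 0 \<le> (\<integral>x. f x * \<phi> x \<partial>lebesgue_on \<Omega>)"
  shows "AE x in lebesgue_on \<Omega>. 0 \<le> f x"
proof -
  have box: "AE x in lebesgue. x \<in> cbox a b \<longrightarrow> 0 \<le> f x" if ab: "cbox a b \<subseteq> \<Omega>" for a b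
  proof -
    define g where "g x = (if x \<in> cbox a b then f x else 0)" for x
    have "f integrable_on cbox a b"
      using f[OF compact_cbox ab] by (rule set_lebesgue_integral_eq_integral(1))
    then have "g integrable_on UNIV"
      unfolding g_def by (simp add: Henstock_Kurzweil_Integration.integrable_restrict_UNIV)
    then have "g integrable_on cbox c d" for c d
      by (rule integrable_on_subcbox) auto
    then obtain N where N: "negligible N"
      "\<And>x e. \<lbrakk>x \<notin> N; 0 < e\<rbrakk> \<Longrightarrow> \<exists>d>0. \<forall>h. 0 < h \<and> h < d \<longrightarrow>
          norm (integral (cbox x (x + h *\<^sub>R One)) g /\<^sub>R h ^ DIM('a) - g x) < e"
      using integrable_ccontinuous_explicit by metis
    have "0 \<le> f x" if x: "x \<in> box a b" "x \<notin> N" for x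
    proof (rule ccontr)
      assume "\<not> 0 \<le> f x"
      then obtain d where d: "d > 0" "\<And>h. 0 < h \<Longrightarrow> h < d \<Longrightarrow>
          norm (integral (cbox x (x + h *\<^sub>R One)) g /\<^sub>R h ^ DIM('a) - g x) < - f x"
        using N(2)[OF x(2), of "- f x"] by auto
      have gx: "g x = f x" using x(1) box_subset_cbox by (auto simp: g_def)
      have "((\<lambda>h. x + h *\<^sub>R One) \<longlongrightarrow> x + 0 *\<^sub>R One) (at_right 0)"
        by (intro tendsto_intros)
      then have "\<forall>\<^sub>F h in at_right 0. x + h *\<^sub>R One \<in> box a b"
        using topological_tendstoD[OF _ open_box] x(1) by fastforce
      moreover have "\<forall>\<^sub>F h in at_right 0. h \<in> {0<..<d}"
        using d(1) by (rule eventually_at_right_real)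
      ultimately have "\<forall>\<^sub>F h in at_right 0. x + h *\<^sub>R One \<in> box a b \<and> h < d \<and> 0 < h"
        by eventually_elim auto
      then obtain h where h: "x + h *\<^sub>R One \<in> box a b" "h < d" "0 < h"
        by (metis (mono_tags, lifting) eventually_happens' trivial_limit_at_right_real)
      have sub: "cbox x (x + h *\<^sub>R One) \<subseteq> cbox a b"
        using x(1) h(1) by (fastforce simp: subset_box mem_box)
      have "integral (cbox x (x + h *\<^sub>R One)) g = integral (cbox x (x + h *\<^sub>R One)) f"
        by (rule integral_cong) (use sub in \<open>auto simp: g_def\<close>)
      also have "\<dots> \<ge> 0"
        by (rule integral_box_nonneg[OF \<Omega> f nonneg]) (use sub ab in auto)
      finally have "0 \<le> integral (cbox x (x + h *\<^sub>R One)) g /\<^sub>R h ^ DIM('a)"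
        using h(3) by simp
      with d(2)[OF h(3,2)] gx show False by simp
    qed
    moreover have "negligible (N \<union> (cbox a b - box a b))"
      by (intro negligible_Un N(1) negligible_frontier_interval)
    ultimately show ?thesis
      by (intro AE_I'[of "N \<union> (cbox a b - box a b)"]) (auto simp: negligible_iff_null_sets)
  qed
  obtain \<D> where \<D>: "countable \<D>" "\<D> \<subseteq> Pow \<Omega>" "\<And>X. X \<in> \<D> \<Longrightarrow> \<exists>a b. X = cbox a b" "\<Union>\<D> = \<Omega>"
    using open_countable_Union_open_cbox[OF \<Omega>] by metis
  have "AE x in lebesgue. \<forall>X\<in>\<D>. x \<in> X \<longrightarrow> 0 \<le> f x"
    using \<D>(2,3) box by (intro AE_ball_countable' \<D>(1)) blast
  then have "AE x in lebesgue. x \<in> \<Omega> \<longrightarrow> 0 \<le> f x"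
    by eventually_elim (use \<D>(4) in auto)
  then show ?thesis
    using \<Omega> by (simp add: AE_restrict_space_iff)
qed

lemma AE_zero_if_test_zero:
  fixes f :: "'a::euclidean_space \<Rightarrow> real"
  assumes \<Omega>: "open \<Omega>" and f: "\<And>C. compact C \<Longrightarrow> C \<subseteq> \<Omega> \<Longrightarrow> f absolutely_integrable_on C"
    and zero: "\<And>\<phi>. \<phi> \<in> test_functions \<Omega> \<Longrightarrow> (\<integral>x. f x * \<phi> x \<partial>lebesgue_on \<Omega>) = 0"
  shows "AE x in lebesgue_on \<Omega>. f x = 0"
proof -
  have "AE x in lebesgue_on \<Omega>. 0 \<le> f x"
    by (rule AE_nonneg_if_test_nonneg[OF \<Omega> f]) (auto simp: zero)
  moreover have "AE x in lebesgue_on \<Omega>. 0 \<le> - f x"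
    by (rule AE_nonneg_if_test_nonneg[OF \<Omega>]) (use f in \<open>auto simp: zero set_integrable_def\<close>)
  ultimately show ?thesis by eventually_elim auto
qed

section \<open>Square-integrable functions\<close>

lemma L2_D:
  assumes "f \<in> L2 M"
  shows "f \<in> borel_measurable M" "integrable M (\<lambda>x. (norm (f x))\<^sup>2)"
  using assms by (auto simp: L2_def)

lemma L2_norm_nonneg: "0 \<le> L2_norm M f"
  by (simp add: L2_norm_def)

lemma L2_norm_power2: "(L2_norm M f)\<^sup>2 = (\<integral>x. (norm (f x))\<^sup>2 \<partial>M)"
  by (simp add: L2_norm_def)

lemma L2_add:
  assumes "f \<in> L2 M" "g \<in> L2 M"
  shows "(\<lambda>x. f x + g x) \<in> L2 M"
proof -
  have [measurable]: "f \<in> borel_measurable M" "g \<in> borel_measurable M"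
    using assms by (auto simp: L2_def)
  have "integrable M (\<lambda>x. 2 * (norm (f x))\<^sup>2 + 2 * (norm (g x))\<^sup>2)"
    using assms by (auto simp: L2_def)
  then have "integrable M (\<lambda>x. (norm (f x + g x))\<^sup>2)"
  proof (rule Bochner_Integration.integrable_bound)
    show "AE x in M. norm ((norm (f x + g x))\<^sup>2) \<le> norm (2 * (norm (f x))\<^sup>2 + 2 * (norm (g x))\<^sup>2)"
    proof (intro AE_I2)
      fix x
      have "(norm (f x + g x))\<^sup>2 \<le> (norm (f x) + norm (g x))\<^sup>2"
        by (intro power_mono norm_triangle_ineq) auto
      also have "\<dots> \<le> 2 * (norm (f x))\<^sup>2 + 2 * (norm (g x))\<^sup>2"
        using sum_squares_bound[of "norm (f x)" "norm (g x)"] by (simp add: power2_sum)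
      finally show "norm ((norm (f x + g x))\<^sup>2) \<le> norm (2 * (norm (f x))\<^sup>2 + 2 * (norm (g x))\<^sup>2)"
        by simp
    qed
  qed measurable
  then show ?thesis by (simp add: L2_def)
qed

lemma L2_scaleR: "f \<in> L2 M \<Longrightarrow> (\<lambda>x. c *\<^sub>R f x) \<in> L2 M"
  by (auto simp: L2_def power_mult_distrib)

lemma L2_cmult: "f \<in> L2 M \<Longrightarrow> (\<lambda>x. c * f x :: real) \<in> L2 M"
  using L2_scaleR[of f M c] by simp

lemma L2_diff:
  assumes "f \<in> L2 M" "g \<in> L2 M"
  shows "(\<lambda>x. f x - g x) \<in> L2 M"
  using L2_add[OF assms(1) L2_scaleR[OF assms(2), of "-1"]] by simp

lemma L2_bound:
  fixes g :: "'a \<Rightarrow> 'b::euclidean_space" and f :: "'a \<Rightarrow> 'c::euclidean_space"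
  assumes "f \<in> L2 M" "g \<in> borel_measurable M" "AE x in M. norm (g x) \<le> norm (f x)"
  shows "g \<in> L2 M"
proof -
  have "integrable M (\<lambda>x. (norm (g x))\<^sup>2)"
  proof (rule Bochner_Integration.integrable_bound[OF L2_D(2)[OF assms(1)]])
    show "AE x in M. norm ((norm (g x))\<^sup>2) \<le> norm ((norm (f x))\<^sup>2)"
      using assms(3) by eventually_elim (auto intro: power_mono)
  qed (use assms(2) in measurable)
  then show ?thesis using assms(2) by (simp add: L2_def)
qed

lemma L2_const:
  fixes c :: "'b::euclidean_space"
  assumes "emeasure M (space M) < \<infinity>"
  shows "(\<lambda>x. c) \<in> L2 M"
proof -
  interpret finite_measure M by standard (use assms in auto)
  show ?thesis by (simp add: L2_def)
qed

lemma L2_product_integrable: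
  assumes "f \<in> L2 M" "g \<in> L2 M"
  shows "integrable M (\<lambda>x. norm (f x) * norm (g x))"
proof (rule Bochner_Integration.integrable_bound)
  show "integrable M (\<lambda>x. (norm (f x))\<^sup>2 + (norm (g x))\<^sup>2)"
    using assms by (auto simp: L2_def)
  have [measurable]: "f \<in> borel_measurable M" "g \<in> borel_measurable M"
    using assms by (auto simp: L2_def)
  show "(\<lambda>x. norm (f x) * norm (g x)) \<in> borel_measurable M" by measurable
  show "AE x in M. norm (norm (f x) * norm (g x)) \<le> norm ((norm (f x))\<^sup>2 + (norm (g x))\<^sup>2)"
  proof (intro AE_I2)
    fix x
    have "norm (f x) * norm (g x) \<le> 2 * norm (f x) * norm (g x)" by simp
    also have "\<dots> \<le> (norm (f x))\<^sup>2 + (norm (g x))\<^sup>2" by (rule sum_squares_bound)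
    finally show "norm (norm (f x) * norm (g x)) \<le> norm ((norm (f x))\<^sup>2 + (norm (g x))\<^sup>2)" by simp
  qed
qed

lemma L2_mult_integrable:
  fixes f g :: "'a \<Rightarrow> real"
  assumes "f \<in> L2 M" "g \<in> L2 M"
  shows "integrable M (\<lambda>x. f x * g x)"
  using L2_product_integrable[OF assms] assms
  by (intro Bochner_Integration.integrable_bound[OF L2_product_integrable[OF assms]]) (auto simp: L2_def abs_mult)

text \<open>Young's inequality, weighted by the quotient of the two norms. Adding \<open>e > 0\<close> to both norms keeps
  the weights defined when a norm vanishes; in the end \<open>e\<close> tends to zero.\<close>

lemma L2_Cauchy_Schwarz:
  assumes f: "f \<in> L2 M" and g: "g \<in> L2 M"
  shows "(\<integral>x. norm (f x) * norm (g x) \<partial>M) \<le> L2_norm M f * L2_norm M g"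
proof -
  let ?A = "L2_norm M f" and ?B = "L2_norm M g"
  have le: "(\<integral>x. norm (f x) * norm (g x) \<partial>M) \<le> (?A + e) * (?B + e)" if e: "e > 0" for e
  proof -
    let ?a = "?A + e" and ?b = "?B + e"
    have ab: "?a > 0" "?b > 0" using L2_norm_nonneg[of M f] L2_norm_nonneg[of M g] e by linarith+
    have "(\<integral>x. norm (f x) * norm (g x) \<partial>M)
        \<le> (\<integral>x. ?b / (2 * ?a) * (norm (f x))\<^sup>2 + ?a / (2 * ?b) * (norm (g x))\<^sup>2 \<partial>M)"
    proof (rule integral_mono)
      show "integrable M (\<lambda>x. norm (f x) * norm (g x))" by (rule L2_product_integrable[OF f g])
      show "integrable M (\<lambda>x. ?b / (2 * ?a) * (norm (f x))\<^sup>2 + ?a / (2 * ?b) * (norm (g x))\<^sup>2)"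
        using f g by (auto simp: L2_def)
      fix x
      have "2 * (?b * norm (f x)) * (?a * norm (g x)) \<le> (?b * norm (f x))\<^sup>2 + (?a * norm (g x))\<^sup>2"
        by (rule sum_squares_bound)
      then show "norm (f x) * norm (g x) \<le> ?b / (2 * ?a) * (norm (f x))\<^sup>2 + ?a / (2 * ?b) * (norm (g x))\<^sup>2"
        using ab by (simp add: divide_simps power2_eq_square) (simp add: algebra_simps)
    qed
    also have "\<dots> = ?b / (2 * ?a) * ?A\<^sup>2 + ?a / (2 * ?b) * ?B\<^sup>2"
      using f g by (subst Bochner_Integration.integral_add) (auto simp: L2_def L2_norm_power2)
    also have "\<dots> \<le> ?b / (2 * ?a) * ?a\<^sup>2 + ?a / (2 * ?b) * ?b\<^sup>2"
      using ab e L2_norm_nonneg[of M f] L2_norm_nonneg[of M g]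
      by (intro add_mono mult_left_mono power_mono) auto
    also have "\<dots> = ?a * ?b"
    proof -
      have "b / (2 * a) * a\<^sup>2 + a / (2 * b) * b\<^sup>2 = a * b" if "a > 0" "b > 0" for a b :: real
        using that by (simp add: power2_eq_square)
      from this[OF ab] show ?thesis .
    qed
    finally show ?thesis .
  qed
  have "((\<lambda>e. (?A + e) * (?B + e)) \<longlongrightarrow> (?A + 0) * (?B + 0)) (at_right 0)"
    by (intro tendsto_intros)
  then have "(\<integral>x. norm (f x) * norm (g x) \<partial>M) \<le> (?A + 0) * (?B + 0)"
    by (rule tendsto_lowerbound) (auto simp: eventually_at_filter le)
  then show ?thesis by simp
qed

lemma L2_norm_triangle:
  assumes f: "f \<in> L2 M" and g: "g \<in> L2 M"
  shows "L2_norm M (\<lambda>x. f x + g x) \<le> L2_norm M f + L2_norm M g"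
proof (rule power2_le_imp_le)
  have "(L2_norm M (\<lambda>x. f x + g x))\<^sup>2 \<le> (\<integral>x. (norm (f x))\<^sup>2 + 2 * (norm (f x) * norm (g x)) + (norm (g x))\<^sup>2 \<partial>M)"
    unfolding L2_norm_power2
  proof (rule integral_mono)
    fix x
    have "(norm (f x + g x))\<^sup>2 \<le> (norm (f x) + norm (g x))\<^sup>2"
      by (intro power_mono norm_triangle_ineq) auto
    then show "(norm (f x + g x))\<^sup>2 \<le> (norm (f x))\<^sup>2 + 2 * (norm (f x) * norm (g x)) + (norm (g x))\<^sup>2"
      by (simp add: power2_sum)
  qed (use L2_D(2)[OF L2_add[OF f g]] L2_product_integrable[OF f g] f g in \<open>auto simp: L2_def\<close>)
  also have "\<dots> = (L2_norm M f)\<^sup>2 + 2 * (\<integral>x. norm (f x) * norm (g x) \<partial>M) + (L2_norm M g)\<^sup>2"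
    using L2_product_integrable[OF f g] f g by (simp add: L2_norm_power2 L2_def)
  also have "\<dots> \<le> (L2_norm M f)\<^sup>2 + 2 * (L2_norm M f * L2_norm M g) + (L2_norm M g)\<^sup>2"
    using L2_Cauchy_Schwarz[OF f g] by simp
  also have "\<dots> = (L2_norm M f + L2_norm M g)\<^sup>2" by (simp add: power2_sum)
  finally show "(L2_norm M (\<lambda>x. f x + g x))\<^sup>2 \<le> (L2_norm M f + L2_norm M g)\<^sup>2" .
qed (simp add: L2_norm_nonneg)

lemma (in complete_measure) L2_AE_eq:
  fixes f g :: "'a \<Rightarrow> 'b::euclidean_space"
  assumes "f \<in> L2 M" "AE x in M. f x = g x"
  shows "g \<in> L2 M"
proof (rule L2_bound[OF assms(1)])
  show "g \<in> borel_measurable M" using borel_measurable_AE_eq assms L2_D(1) by blast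
  show "AE x in M. norm (g x) \<le> norm (f x)" using assms(2) by eventually_elim simp
qed

lemma (in complete_measure) L2_norm_AE_eq:
  fixes f g :: "'a \<Rightarrow> 'b::euclidean_space"
  assumes "AE x in M. f x = g x"
  shows "L2_norm M f = L2_norm M g"
  unfolding L2_norm_def using assms by (intro arg_cong[where f = sqrt] integral_AE_eq) auto

section \<open>Weak gradients\<close>

lemma integrable_loc_mult_test:
  fixes u \<phi> :: "'a::euclidean_space \<Rightarrow> real"
  assumes \<Omega>: "open \<Omega>" and u: "\<And>C. compact C \<Longrightarrow> C \<subseteq> \<Omega> \<Longrightarrow> u absolutely_integrable_on C"
    and \<phi>: "\<phi> \<in> test_functions \<Omega>"
  shows "integrable (lebesgue_on \<Omega>) (\<lambda>x. u x * \<phi> x)"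
    and "b \<in> Basis \<Longrightarrow> integrable (lebesgue_on \<Omega>) (\<lambda>x. u x * frechet_derivative \<phi> (at x) b)"
proof -
  let ?C = "closure {x. \<phi> x \<noteq> 0}"
  have C: "compact ?C" "?C \<subseteq> \<Omega>" using test_functionD[OF \<phi>] by auto
  show "integrable (lebesgue_on \<Omega>) (\<lambda>x. u x * \<phi> x)"
  proof (rule integrable_loc_mult[OF _ C u[OF C]])
    show "continuous_on UNIV \<phi>" by (rule C_infinity_continuous[OF test_functionD(1)[OF \<phi>]])
    fix x assume "x \<notin> ?C"
    then have "x \<notin> {x. \<phi> x \<noteq> 0}" using closure_subset[of "{x. \<phi> x \<noteq> 0}"] by blast
    then show "\<phi> x = 0" by simp
  qed (use \<Omega> in simp)
  show "integrable (lebesgue_on \<Omega>) (\<lambda>x. u x * frechet_derivative \<phi> (at x) b)" if b: "b \<in> Basis"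
  proof (rule integrable_loc_mult[OF _ C u[OF C]])
    show "continuous_on UNIV (\<lambda>x. frechet_derivative \<phi> (at x) b)"
      by (rule C_infinity_continuous[OF C_infinity_partial[OF test_functionD(1)[OF \<phi>] b]])
    fix x assume "x \<notin> ?C"
    then show "frechet_derivative \<phi> (at x) b = 0" by (rule frechet_derivative_outside_support)
  qed (use \<Omega> in simp)
qed

lemma absolutely_integrable_inner_left:
  "G absolutely_integrable_on C \<Longrightarrow> (\<lambda>x. G x \<bullet> b) absolutely_integrable_on C"
  unfolding set_integrable_def using integrable_inner_left[of b lebesgue "\<lambda>x. indicator C x *\<^sub>R G x"] by simp

lemma has_weak_gradientD:
  assumes "has_weak_gradient \<Omega> u G"
  shows "compact C \<Longrightarrow> C \<subseteq> \<Omega> \<Longrightarrow> u absolutely_integrable_on C"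
    and "compact C \<Longrightarrow> C \<subseteq> \<Omega> \<Longrightarrow> G absolutely_integrable_on C"
    and "compact C \<Longrightarrow> C \<subseteq> \<Omega> \<Longrightarrow> (\<lambda>x. G x \<bullet> b) absolutely_integrable_on C"
    and "\<phi> \<in> test_functions \<Omega> \<Longrightarrow> b \<in> Basis \<Longrightarrow>
      (\<integral>x. u x * frechet_derivative \<phi> (at x) b \<partial>lebesgue_on \<Omega>) = - (\<integral>x. (G x \<bullet> b) * \<phi> x \<partial>lebesgue_on \<Omega>)"
proof -
  note * = assms[unfolded has_weak_gradient_def]
  show u: "u absolutely_integrable_on C" if "compact C" "C \<subseteq> \<Omega>" using * that by simp
  show G: "G absolutely_integrable_on C" if "compact C" "C \<subseteq> \<Omega>" using * that by simp
  show "(\<lambda>x. G x \<bullet> b) absolutely_integrable_on C" if "compact C" "C \<subseteq> \<Omega>"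
    by (rule absolutely_integrable_inner_left[OF G[OF that]])
  show "(\<integral>x. u x * frechet_derivative \<phi> (at x) b \<partial>lebesgue_on \<Omega>) = - (\<integral>x. (G x \<bullet> b) * \<phi> x \<partial>lebesgue_on \<Omega>)"
    if "\<phi> \<in> test_functions \<Omega>" "b \<in> Basis"
    using conjunct2[OF *, rule_format, OF that] .
qed

lemma has_weak_gradient_integrable:
  assumes \<Omega>: "open \<Omega>" and u: "has_weak_gradient \<Omega> u G" and \<phi>: "\<phi> \<in> test_functions \<Omega>"
  shows "integrable (lebesgue_on \<Omega>) (\<lambda>x. (G x \<bullet> b) * \<phi> x)"
    and "b \<in> Basis \<Longrightarrow> integrable (lebesgue_on \<Omega>) (\<lambda>x. u x * frechet_derivative \<phi> (at x) b)"
proof -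
  show "integrable (lebesgue_on \<Omega>) (\<lambda>x. (G x \<bullet> b) * \<phi> x)"
    by (rule integrable_loc_mult_test(1)[OF \<Omega> _ \<phi>]) (rule has_weak_gradientD(3)[OF u])
  show "integrable (lebesgue_on \<Omega>) (\<lambda>x. u x * frechet_derivative \<phi> (at x) b)" if "b \<in> Basis"
    by (rule integrable_loc_mult_test(2)[OF \<Omega> _ \<phi> that]) (rule has_weak_gradientD(1)[OF u])
qed

lemma has_weak_gradient_unique:
  assumes \<Omega>: "open \<Omega>" and G: "has_weak_gradient \<Omega> u G" and H: "has_weak_gradient \<Omega> u H"
  shows "AE x in lebesgue_on \<Omega>. G x = H x"
proof -
  have "AE x in lebesgue_on \<Omega>. (G x - H x) \<bullet> b = 0" if b: "b \<in> Basis" for b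
  proof (rule AE_zero_if_test_zero[OF \<Omega>])
    show "(\<lambda>x. (G x - H x) \<bullet> b) absolutely_integrable_on C" if "compact C" "C \<subseteq> \<Omega>" for C
      by (intro absolutely_integrable_inner_left set_integral_diff has_weak_gradientD(2)[OF G that]
          has_weak_gradientD(2)[OF H that])
    fix \<phi> assume \<phi>: "\<phi> \<in> test_functions \<Omega>"
    note i = has_weak_gradient_integrable(1)[OF \<Omega> G \<phi>, of b] has_weak_gradient_integrable(1)[OF \<Omega> H \<phi>, of b]
    have "(\<integral>x. (G x \<bullet> b) * \<phi> x \<partial>lebesgue_on \<Omega>) = (\<integral>x. (H x \<bullet> b) * \<phi> x \<partial>lebesgue_on \<Omega>)"
      using has_weak_gradientD(4)[OF G \<phi> b] has_weak_gradientD(4)[OF H \<phi> b] by linarith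
    then show "(\<integral>x. (G x - H x) \<bullet> b * \<phi> x \<partial>lebesgue_on \<Omega>) = 0"
      using i by (simp add: inner_diff_left left_diff_distrib)
  qed
  then have "AE x in lebesgue_on \<Omega>. \<forall>b\<in>Basis. (G x - H x) \<bullet> b = 0"
    by (intro AE_ball_countable') (auto intro: countable_finite)
  then show ?thesis
  proof eventually_elim
    case (elim x)
    then show ?case by (intro euclidean_eqI[of "G x" "H x"]) (simp add: inner_diff_left)
  qed
qed

lemma absolutely_integrable_AE_eq:
  fixes u w :: "'a::euclidean_space \<Rightarrow> real"
  assumes \<Omega>: "\<Omega> \<in> sets lebesgue" and ae: "AE x in lebesgue_on \<Omega>. u x = w x"
    and C: "C \<subseteq> \<Omega>" and u: "u absolutely_integrable_on C"
  shows "w absolutely_integrable_on C"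
proof -
  have "AE x in lebesgue. indicator C x *\<^sub>R u x = indicator C x *\<^sub>R w x"
  proof -
    have "AE x in lebesgue. x \<in> \<Omega> \<longrightarrow> u x = w x"
      using ae \<Omega> by (simp add: AE_restrict_space_iff)
    then show ?thesis by eventually_elim (use C in \<open>auto simp: indicator_def\<close>)
  qed
  from completion.integrable_AE_eq_iff[OF this] u show ?thesis
    by (simp add: set_integrable_def)
qed

lemma has_weak_gradient_AE_eq:
  assumes \<Omega>: "open \<Omega>" and ae: "AE x in lebesgue_on \<Omega>. u x = w x" and u: "has_weak_gradient \<Omega> u G"
  shows "has_weak_gradient \<Omega> w G"
proof -
  have \<Omega>l: "\<Omega> \<in> sets lebesgue" using \<Omega> by simp
  interpret complete_measure "lebesgue_on \<Omega>" by (rule complete_lebesgue_on[OF \<Omega>l])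
  have "(\<integral>x. u x * frechet_derivative \<phi> (at x) b \<partial>lebesgue_on \<Omega>)
      = (\<integral>x. w x * frechet_derivative \<phi> (at x) b \<partial>lebesgue_on \<Omega>)" for \<phi> b
    using ae by (intro integral_AE_eq) auto
  note eq = this
  show ?thesis
    unfolding has_weak_gradient_def
  proof (intro conjI allI impI ballI)
    fix C assume "compact C \<and> C \<subseteq> \<Omega>"
    then have C: "compact C" "C \<subseteq> \<Omega>" by auto
    show "w absolutely_integrable_on C"
      by (rule absolutely_integrable_AE_eq[OF \<Omega>l ae C(2) has_weak_gradientD(1)[OF u C]])
    show "G absolutely_integrable_on C" by (rule has_weak_gradientD(2)[OF u C])
  next
    fix \<phi> and b :: pt assume \<phi>: "\<phi> \<in> test_functions \<Omega>" "b \<in> Basis"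
    show "(\<integral>x. w x * frechet_derivative \<phi> (at x) b \<partial>lebesgue_on \<Omega>) = - (\<integral>x. (G x \<bullet> b) * \<phi> x \<partial>lebesgue_on \<Omega>)"
      unfolding eq[symmetric] by (rule has_weak_gradientD(4)[OF u \<phi>])
  qed
qed

text \<open>Functions that agree almost everywhere have the same set of weak gradients, so the choice
  operator selects literally the same one for both.\<close>

lemma weak_gradient_AE_eq:
  assumes \<Omega>: "open \<Omega>" and ae: "AE x in lebesgue_on \<Omega>. u x = w x"
  shows "weak_gradient \<Omega> u = weak_gradient \<Omega> w"
proof -
  have "AE x in lebesgue_on \<Omega>. w x = u x" using ae by eventually_elim simp
  then have "has_weak_gradient \<Omega> u = has_weak_gradient \<Omega> w"
    using has_weak_gradient_AE_eq[OF \<Omega> ae] has_weak_gradient_AE_eq[OF \<Omega>, of w u] by (intro ext iffI)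
  then show ?thesis by (simp add: weak_gradient_def)
qed

lemma has_weak_gradient_lincomb:
  assumes \<Omega>: "open \<Omega>" and u: "has_weak_gradient \<Omega> u G" and w: "has_weak_gradient \<Omega> w H"
  shows "has_weak_gradient \<Omega> (\<lambda>x. a * u x + c * w x) (\<lambda>x. a *\<^sub>R G x + c *\<^sub>R H x)"
  unfolding has_weak_gradient_def
proof (intro conjI allI impI ballI)
  fix C assume C: "compact C \<and> C \<subseteq> \<Omega>"
  then have C: "compact C" "C \<subseteq> \<Omega>" by auto
  note * = has_weak_gradientD(1)[OF u C] has_weak_gradientD(1)[OF w C] has_weak_gradientD(2)[OF u C]
      has_weak_gradientD(2)[OF w C]
  show "(\<lambda>x. a * u x + c * w x) absolutely_integrable_on C"
    using *(1,2) by (intro set_integral_add set_integrable_mult_right)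
  show "(\<lambda>x. a *\<^sub>R G x + c *\<^sub>R H x) absolutely_integrable_on C"
    using *(3,4) by (intro set_integral_add set_integrable_scaleR_right)
next
  fix \<phi> and b :: pt assume \<phi>: "\<phi> \<in> test_functions \<Omega>" and b: "b \<in> Basis"
  note i = has_weak_gradient_integrable(1)[OF \<Omega> u \<phi>, of b] has_weak_gradient_integrable(1)[OF \<Omega> w \<phi>, of b]
    has_weak_gradient_integrable(2)[OF \<Omega> u \<phi> b] has_weak_gradient_integrable(2)[OF \<Omega> w \<phi> b]
  note e = has_weak_gradientD(4)[OF u \<phi> b] has_weak_gradientD(4)[OF w \<phi> b]
  have "(\<integral>x. (a * u x + c * w x) * frechet_derivative \<phi> (at x) b \<partial>lebesgue_on \<Omega>)
      = a * (\<integral>x. u x * frechet_derivative \<phi> (at x) b \<partial>lebesgue_on \<Omega>)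
        + c * (\<integral>x. w x * frechet_derivative \<phi> (at x) b \<partial>lebesgue_on \<Omega>)"
    using i by (simp add: distrib_right mult.assoc)
  also have "\<dots> = - (a * (\<integral>x. (G x \<bullet> b) * \<phi> x \<partial>lebesgue_on \<Omega>) + c * (\<integral>x. (H x \<bullet> b) * \<phi> x \<partial>lebesgue_on \<Omega>))"
    by (simp add: e)
  also have "\<dots> = - (\<integral>x. (a *\<^sub>R G x + c *\<^sub>R H x) \<bullet> b * \<phi> x \<partial>lebesgue_on \<Omega>)"
    using i by (simp add: inner_add_left distrib_right mult.assoc)
  finally show "(\<integral>x. (a * u x + c * w x) * frechet_derivative \<phi> (at x) b \<partial>lebesgue_on \<Omega>)
    = - (\<integral>x. (a *\<^sub>R G x + c *\<^sub>R H x) \<bullet> b * \<phi> x \<partial>lebesgue_on \<Omega>)" .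
qed

definition gradient :: "('a::euclidean_space \<Rightarrow> real) \<Rightarrow> 'a \<Rightarrow> 'a" where
  "gradient f x = (\<Sum>b\<in>Basis. frechet_derivative f (at x) b *\<^sub>R b)"

lemma gradient_inner: "C_infinity f \<Longrightarrow> gradient f x \<bullet> v = frechet_derivative f (at x) v"
proof -
  assume f: "C_infinity f"
  have lin: "linear (frechet_derivative f (at x))"
    by (rule has_derivative_linear[OF C_infinity_has_derivative[OF f]])
  have "frechet_derivative f (at x) v = frechet_derivative f (at x) (\<Sum>b\<in>Basis. (v \<bullet> b) *\<^sub>R b)"
    by (simp add: euclidean_representation)
  also have "\<dots> = (\<Sum>b\<in>Basis. (v \<bullet> b) * frechet_derivative f (at x) b)"
    using lin by (simp add: linear_sum linear_cmul)
  also have "\<dots> = gradient f x \<bullet> v"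
    by (simp add: gradient_def inner_sum_left inner_commute[of v] mult.commute)
  finally show ?thesis by simp
qed

lemma continuous_gradient: "C_infinity f \<Longrightarrow> continuous_on S (gradient f)"
  unfolding gradient_def[abs_def]
  by (intro continuous_intros C_infinity_continuous C_infinity_partial)

lemma has_weak_gradient_smooth:
  assumes \<Omega>: "open \<Omega>" and f: "C_infinity f"
  shows "has_weak_gradient \<Omega> f (gradient f)"
  unfolding has_weak_gradient_def
proof (intro conjI allI impI ballI)
  fix C assume "compact C \<and> C \<subseteq> \<Omega>"
  then show "f absolutely_integrable_on C" "gradient f absolutely_integrable_on C"
    by (auto intro!: continuous_absolutely_integrable_compact C_infinity_continuous continuous_gradient f)
next
  fix \<phi> and b :: pt assume \<phi>: "\<phi> \<in> test_functions \<Omega>" and b: "b \<in> Basis"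
  note \<phi>' = test_functionD[OF \<phi>]
  let ?C = "closure {x. \<phi> x \<noteq> 0}"
  let ?f = "frechet_derivative f" and ?p = "frechet_derivative \<phi>"
  have out: "\<phi> x = 0" "?p (at x) b = 0" if "x \<notin> ?C" for x
    using that closure_subset[of "{x. \<phi> x \<noteq> 0}"] frechet_derivative_outside_support[OF that] by auto
  have cont: "continuous_on UNIV (\<lambda>x. f x * ?p (at x) b + ?f (at x) b * \<phi> x)"
    by (intro continuous_intros C_infinity_continuous C_infinity_partial \<phi>'(1) f b)
  have zero: "(\<integral>x. f x * ?p (at x) b + ?f (at x) b * \<phi> x \<partial>lborel) = 0"
  proof (rule integral_derivative_compact_support[where f = "\<lambda>x. f x * \<phi> x" and K = ?C
          and D = "\<lambda>x h. f x * ?p (at x) h + ?f (at x) h * \<phi> x"])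
    show "((\<lambda>x. f x * \<phi> x) has_derivative (\<lambda>h. f x * ?p (at x) h + ?f (at x) h * \<phi> x)) (at x)" for x
      by (intro has_derivative_mult C_infinity_has_derivative f \<phi>'(1))
    show "f x * ?p (at x) b + ?f (at x) b * \<phi> x = 0" if "x \<notin> ?C" for x
      unfolding out[OF that] by simp
    show "f x * \<phi> x = 0" if "x \<notin> ?C" for x
      unfolding out[OF that] by simp
  qed (fact cont \<phi>'(2))+
  have i: "integrable (lebesgue_on \<Omega>) (\<lambda>x. f x * ?p (at x) b)" "integrable (lebesgue_on \<Omega>) (\<lambda>x. ?f (at x) b * \<phi> x)"
     by (rule integrable_loc_mult_test(2)[OF \<Omega> _ \<phi> b], rule continuous_absolutely_integrable_compact,
          assumption, rule C_infinity_continuous[OF f])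
        (rule integrable_loc_mult_test(1)[OF \<Omega> _ \<phi>], rule continuous_absolutely_integrable_compact,
          assumption, rule C_infinity_continuous[OF C_infinity_partial[OF f b]])
  have "(\<integral>x. f x * ?p (at x) b \<partial>lebesgue_on \<Omega>) + (\<integral>x. ?f (at x) b * \<phi> x \<partial>lebesgue_on \<Omega>)
      = (\<integral>x. f x * ?p (at x) b + ?f (at x) b * \<phi> x \<partial>lebesgue_on \<Omega>)"
    using i by simp
  also have "\<dots> = (\<integral>x. f x * ?p (at x) b + ?f (at x) b * \<phi> x \<partial>lebesgue)"
  proof (rule integral_lebesgue_on_supported(1))
    fix x assume "x \<notin> \<Omega>"
    then have "x \<notin> ?C" using \<phi>'(3) by blast
    then show "f x * ?p (at x) b + ?f (at x) b * \<phi> x = 0"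
      unfolding out[OF \<open>x \<notin> ?C\<close>] by simp
  qed (use \<Omega> in simp)
  also have "\<dots> = 0"
    using zero borel_measurable_continuous_onI[OF cont] by (subst integral_completion) auto
  finally have "(\<integral>x. f x * ?p (at x) b \<partial>lebesgue_on \<Omega>) = - (\<integral>x. ?f (at x) b * \<phi> x \<partial>lebesgue_on \<Omega>)"
    by linarith
  then show "(\<integral>x. f x * ?p (at x) b \<partial>lebesgue_on \<Omega>) = - (\<integral>x. gradient f x \<bullet> b * \<phi> x \<partial>lebesgue_on \<Omega>)"
    unfolding gradient_inner[OF f] .
qed

section \<open>First-order Sobolev functions\<close>

lemma has_weak_gradient_weak_gradient:
  assumes "has_weak_gradient \<Omega> u G"
  shows "has_weak_gradient \<Omega> u (weak_gradient \<Omega> u)"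
  unfolding weak_gradient_def using assms by (rule someI[where P = "has_weak_gradient \<Omega> u"])

lemma weak_gradient_AE:
  assumes \<Omega>: "open \<Omega>" and u: "has_weak_gradient \<Omega> u G"
  shows "AE x in lebesgue_on \<Omega>. weak_gradient \<Omega> u x = G x"
  by (rule has_weak_gradient_unique[OF \<Omega> has_weak_gradient_weak_gradient[OF u] u])

lemma H1_I:
  assumes "u \<in> L2 (lebesgue_on \<Omega>)" "has_weak_gradient \<Omega> u G" "G \<in> L2 (lebesgue_on \<Omega>)"
  shows "u \<in> H1 \<Omega>"
proof -
  have "\<exists>G\<in>L2 (lebesgue_on \<Omega>). has_weak_gradient \<Omega> u G"
    by (rule bexI[where x = G]) (rule assms)+
  then show ?thesis using assms(1) unfolding H1_def by simp
qed

lemma H1_D: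
  assumes \<Omega>: "open \<Omega>" and u: "u \<in> H1 \<Omega>"
  shows "u \<in> L2 (lebesgue_on \<Omega>)" "has_weak_gradient \<Omega> u (weak_gradient \<Omega> u)"
    "weak_gradient \<Omega> u \<in> L2 (lebesgue_on \<Omega>)"
proof -
  interpret complete_measure "lebesgue_on \<Omega>" using \<Omega> by (intro complete_lebesgue_on) simp
  obtain G where G: "G \<in> L2 (lebesgue_on \<Omega>)" "has_weak_gradient \<Omega> u G"
    using u by (auto simp: H1_def)
  show "u \<in> L2 (lebesgue_on \<Omega>)" using u by (simp add: H1_def)
  show "has_weak_gradient \<Omega> u (weak_gradient \<Omega> u)" by (rule has_weak_gradient_weak_gradient[OF G(2)])
  have "AE x in lebesgue_on \<Omega>. G x = weak_gradient \<Omega> u x"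
    using weak_gradient_AE[OF \<Omega> G(2)] by eventually_elim simp
  then show "weak_gradient \<Omega> u \<in> L2 (lebesgue_on \<Omega>)" by (rule L2_AE_eq[OF G(1)])
qed

lemma H1_lincomb:
  assumes \<Omega>: "open \<Omega>" and u: "u \<in> H1 \<Omega>" and w: "w \<in> H1 \<Omega>"
  shows "(\<lambda>x. a * u x + c * w x) \<in> H1 \<Omega>"
    and "AE x in lebesgue_on \<Omega>. weak_gradient \<Omega> (\<lambda>x. a * u x + c * w x) x
           = a *\<^sub>R weak_gradient \<Omega> u x + c *\<^sub>R weak_gradient \<Omega> w x"
proof -
  note u' = H1_D[OF \<Omega> u] and w' = H1_D[OF \<Omega> w]
  have *: "has_weak_gradient \<Omega> (\<lambda>x. a * u x + c * w x) (\<lambda>x. a *\<^sub>R weak_gradient \<Omega> u x + c *\<^sub>R weak_gradient \<Omega> w x)"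
    by (rule has_weak_gradient_lincomb[OF \<Omega> u'(2) w'(2)])
  show "(\<lambda>x. a * u x + c * w x) \<in> H1 \<Omega>"
    by (rule H1_I[OF _ *]) (intro L2_add L2_cmult L2_scaleR u' w')+
  show "AE x in lebesgue_on \<Omega>. weak_gradient \<Omega> (\<lambda>x. a * u x + c * w x) x
           = a *\<^sub>R weak_gradient \<Omega> u x + c *\<^sub>R weak_gradient \<Omega> w x"
    by (rule weak_gradient_AE[OF \<Omega> *])
qed

lemma H1_diff: "open \<Omega> \<Longrightarrow> u \<in> H1 \<Omega> \<Longrightarrow> w \<in> H1 \<Omega> \<Longrightarrow> (\<lambda>x. u x - w x) \<in> H1 \<Omega>"
  using H1_lincomb(1)[of \<Omega> u w 1 "-1"] by simp

lemma H1_cmult: "open \<Omega> \<Longrightarrow> u \<in> H1 \<Omega> \<Longrightarrow> (\<lambda>x. c * u x) \<in> H1 \<Omega>"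
  using H1_lincomb(1)[of \<Omega> u u c 0] by simp

lemma H1_AE_eq:
  assumes \<Omega>: "open \<Omega>" and ae: "AE x in lebesgue_on \<Omega>. u x = w x" and u: "u \<in> H1 \<Omega>"
  shows "w \<in> H1 \<Omega>"
proof -
  interpret complete_measure "lebesgue_on \<Omega>" using \<Omega> by (intro complete_lebesgue_on) simp
  show ?thesis
    by (rule H1_I[OF L2_AE_eq[OF H1_D(1)[OF \<Omega> u] ae] has_weak_gradient_AE_eq[OF \<Omega> ae H1_D(2)[OF \<Omega> u]]
        H1_D(3)[OF \<Omega> u]])
qed

lemma H1_norm_AE_eq:
  assumes \<Omega>: "open \<Omega>" and ae: "AE x in lebesgue_on \<Omega>. u x = w x"
  shows "H1_norm \<Omega> u = H1_norm \<Omega> w"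
proof -
  interpret complete_measure "lebesgue_on \<Omega>" using \<Omega> by (intro complete_lebesgue_on) simp
  show ?thesis
    unfolding H1_norm_def L2_norm_AE_eq[OF ae] weak_gradient_AE_eq[OF \<Omega> ae] ..
qed

lemma H1_norm_nonneg: "0 \<le> H1_norm \<Omega> u"
  by (simp add: H1_norm_def)

lemma L2_norm_le_H1_norm: "L2_norm (lebesgue_on \<Omega>) u \<le> H1_norm \<Omega> u"
  "L2_norm (lebesgue_on \<Omega>) (weak_gradient \<Omega> u) \<le> H1_norm \<Omega> u"
  unfolding H1_norm_def by (rule real_le_rsqrt, simp)+

lemma L2_norm_minus: "L2_norm M (\<lambda>x. - f x) = L2_norm M f"
  by (simp add: L2_norm_def)

lemma H1_norm_triangle_diff:
  assumes \<Omega>: "open \<Omega>" and u: "u \<in> H1 \<Omega>" and w: "w \<in> H1 \<Omega>"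
  shows "H1_norm \<Omega> (\<lambda>x. u x - w x) \<le> H1_norm \<Omega> u + H1_norm \<Omega> w"
proof -
  interpret complete_measure "lebesgue_on \<Omega>" using \<Omega> by (intro complete_lebesgue_on) simp
  let ?M = "lebesgue_on \<Omega>" and ?g = "weak_gradient \<Omega>"
  note u' = H1_D[OF \<Omega> u] and w' = H1_D[OF \<Omega> w]
  have "AE x in ?M. ?g (\<lambda>x. u x - w x) x = ?g u x + (- 1) *\<^sub>R ?g w x"
    using H1_lincomb(2)[OF \<Omega> u w, of 1 "-1"] by simp
  then have "L2_norm ?M (?g (\<lambda>x. u x - w x)) = L2_norm ?M (\<lambda>x. ?g u x + (- 1) *\<^sub>R ?g w x)"
    by (rule L2_norm_AE_eq)
  also have "\<dots> \<le> L2_norm ?M (?g u) + L2_norm ?M (\<lambda>x. (-1) *\<^sub>R ?g w x)"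
    by (intro L2_norm_triangle L2_scaleR u' w')
  finally have g: "L2_norm ?M (?g (\<lambda>x. u x - w x)) \<le> L2_norm ?M (?g u) + L2_norm ?M (?g w)"
    by (simp add: L2_norm_minus)
  have "L2_norm ?M (\<lambda>x. u x + (-1) *\<^sub>R w x) \<le> L2_norm ?M u + L2_norm ?M (\<lambda>x. (-1) *\<^sub>R w x)"
    by (intro L2_norm_triangle L2_scaleR u' w')
  then have f: "L2_norm ?M (\<lambda>x. u x - w x) \<le> L2_norm ?M u + L2_norm ?M w"
    by (simp add: L2_norm_minus)
  have eq: "H1_norm \<Omega> v = norm (L2_norm ?M v, L2_norm ?M (?g v))" for v
    by (simp add: H1_norm_def norm_Pair)
  have "H1_norm \<Omega> (\<lambda>x. u x - w x)
      \<le> norm ((L2_norm ?M u, L2_norm ?M (?g u)) + (L2_norm ?M w, L2_norm ?M (?g w)))"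
    unfolding eq using f g by (auto simp: norm_Pair intro!: add_mono power_mono L2_norm_nonneg)
  also have "\<dots> \<le> H1_norm \<Omega> u + H1_norm \<Omega> w"
    unfolding eq by (rule norm_triangle_ineq)
  finally show ?thesis .
qed

lemma lebesgue_on_bounded_finite:
  "bounded \<Omega> \<Longrightarrow> open \<Omega> \<Longrightarrow> emeasure (lebesgue_on \<Omega>) (space (lebesgue_on \<Omega>)) < \<infinity>"
  using emeasure_bounded_finite[of \<Omega>] by (simp add: emeasure_restrict_space)

lemma continuous_L2:
  fixes f :: "'a::euclidean_space \<Rightarrow> 'b::euclidean_space"
  assumes "bounded \<Omega>" "open \<Omega>" "continuous_on UNIV f"
  shows "f \<in> L2 (lebesgue_on \<Omega>)"
proof -
  have "bounded (f ` closure \<Omega>)"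
    by (intro compact_imp_bounded compact_continuous_image continuous_on_subset[OF assms(3)])
       (use assms in \<open>auto simp: compact_closure\<close>)
  then obtain K where K: "\<And>x. x \<in> \<Omega> \<Longrightarrow> norm (f x) \<le> K"
    using closure_subset unfolding bounded_iff by (metis image_eqI subsetD)
  show ?thesis
  proof (rule L2_bound[OF L2_const[OF lebesgue_on_bounded_finite[OF assms(1,2)], of K]])
    show "f \<in> borel_measurable (lebesgue_on \<Omega>)"
      using assms(2) by (intro continuous_imp_measurable_on_sets_lebesgue continuous_on_subset[OF assms(3)]) auto
    show "AE x in lebesgue_on \<Omega>. norm (f x) \<le> norm K"
      using K by (intro AE_I2) force
  qed
qed

lemma smooth_H1:
  assumes "bounded \<Omega>" "open \<Omega>" "C_infinity f"
  shows "f \<in> H1 \<Omega>"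
  unfolding H1_def using has_weak_gradient_smooth[OF assms(2,3)] assms
  by (auto intro: continuous_L2 C_infinity_continuous continuous_gradient)

lemma L_infinity_L2:
  assumes "bounded \<Omega>" "open \<Omega>" "f \<in> L_infinity (lebesgue_on \<Omega>)"
  shows "f \<in> L2 (lebesgue_on \<Omega>)"
proof -
  have f: "f \<in> borel_measurable (lebesgue_on \<Omega>)" "\<exists>C. AE x in lebesgue_on \<Omega>. norm (f x) \<le> C"
    using assms(3) by (simp_all add: L_infinity_def)
  then obtain C where C: "AE x in lebesgue_on \<Omega>. norm (f x) \<le> C" by blast
  show ?thesis
    by (rule L2_bound[OF L2_const[OF lebesgue_on_bounded_finite[OF assms(1,2)], of C] f(1)])
       (use C in eventually_elim, auto)
qed

lemma W1_infinity_H1: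
  assumes "bounded \<Omega>" "open \<Omega>" "u \<in> W1_infinity \<Omega>"
  shows "u \<in> H1 \<Omega>"
proof -
  have *: "u \<in> L_infinity (lebesgue_on \<Omega>)" "\<exists>G \<in> L_infinity (lebesgue_on \<Omega>). has_weak_gradient \<Omega> u G"
    using assms(3) by (simp_all add: W1_infinity_def)
  from *(2) obtain G where G: "G \<in> L_infinity (lebesgue_on \<Omega>)" "has_weak_gradient \<Omega> u G" by (rule bexE)
  show ?thesis
    by (rule H1_I[OF L_infinity_L2[OF assms(1,2) *(1)] G(2) L_infinity_L2[OF assms(1,2) G(1)]])
qed

lemma H1_norm_zero: "open \<Omega> \<Longrightarrow> H1_norm \<Omega> (\<lambda>x. 0) = 0"
proof -
  assume \<Omega>: "open \<Omega>"
  interpret complete_measure "lebesgue_on \<Omega>" using \<Omega> by (intro complete_lebesgue_on) simp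
  have "gradient (\<lambda>x::pt. 0) = (\<lambda>x. 0)" by (simp add: gradient_def[abs_def])
  then have "AE x in lebesgue_on \<Omega>. weak_gradient \<Omega> (\<lambda>x. 0) x = 0"
    using weak_gradient_AE[OF \<Omega> has_weak_gradient_smooth[OF \<Omega> C_infinity_const[of 0]]] by simp
  then have "L2_norm (lebesgue_on \<Omega>) (weak_gradient \<Omega> (\<lambda>x. 0)) = L2_norm (lebesgue_on \<Omega>) (\<lambda>x. 0::pt)"
    by (rule L2_norm_AE_eq)
  then show ?thesis by (simp add: H1_norm_def L2_norm_def)
qed

text \<open>The constant sequence shows that zero is a trace.\<close>

lemma test_function_V_space:
  assumes \<Omega>: "bounded \<Omega>" "open \<Omega>" and \<Gamma>: "\<Gamma> \<subseteq> frontier \<Omega>" and v: "v \<in> test_functions \<Omega>"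
  shows "v \<in> V_space \<Omega> \<Gamma>"
proof -
  note v' = test_functionD[OF v]
  have out: "v x = 0" if "x \<in> frontier \<Omega>" for x
  proof -
    have "x \<notin> \<Omega>" using that \<Omega>(2) by (simp add: frontier_def interior_open)
    then show ?thesis using v'(3) closure_subset[of "{x. v x \<noteq> 0}"] by auto
  qed
  have "L2_norm (surface_on (frontier \<Omega>)) (v - (\<lambda>x. 0)) = L2_norm (surface_on (frontier \<Omega>)) (\<lambda>x. 0::real)"
    unfolding L2_norm_def using out
    by (intro arg_cong[where f = sqrt] Bochner_Integration.integral_cong) (auto simp: space_restrict_space)
  then have "has_trace \<Omega> v (\<lambda>x. 0)"
    unfolding has_trace_def using v'(1) smooth_H1[OF \<Omega> v'(1)] H1_norm_zero[OF \<Omega>(2)]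
    by (auto simp: L2_def L2_norm_def fun_diff_def intro!: exI[of _ "\<lambda>_. v"])
  then show ?thesis
    using smooth_H1[OF \<Omega> v'(1)] by (auto simp: V_space_def)
qed

section \<open>Surface measure\<close>

lemma sets_surface_measure_borel: "A \<in> sets borel \<Longrightarrow> A \<in> sets surface_measure"
  unfolding surface_measure_def
  by (rule sets_completionI_sets) (simp add: sets_measure_of_conv
      sets.sigma_sets_eq[of "borel :: pt measure", simplified])

lemma space_surface_measure: "space surface_measure = UNIV"
  by (simp add: surface_measure_def space_measure_of_conv)

text \<open>If the outer measure is countably additive on the Borel sets, both sides agree; otherwise
  \<open>measure_of\<close> produces the zero measure.\<close>

lemma emeasure_surface_measure_le:
  assumes "A \<in> sets borel"
  shows "emeasure surface_measure A \<le> hausdorff_outer A"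
proof -
  let ?M = "measure_of UNIV (sets borel) hausdorff_outer"
  have "A \<in> sets ?M"
    using assms by (simp add: sets_measure_of_conv sets.sigma_sets_eq[of "borel :: pt measure", simplified])
  then have "emeasure surface_measure A = emeasure ?M A"
    unfolding surface_measure_def by simp
  also have "\<dots> \<le> hausdorff_outer A"
    by (simp add: emeasure_measure_of_conv)
  finally show ?thesis .
qed

lemma complete_surface_on: "\<Gamma> \<in> sets borel \<Longrightarrow> complete_measure (surface_on \<Gamma>)"
  unfolding surface_measure_def
  by (rule completion.complete_restrict_space) (use sets_surface_measure_borel in \<open>simp add: surface_measure_def\<close>)

lemma hausdorff_outer_le:
  assumes "\<And>\<delta>. \<delta> > 0 \<Longrightarrow> \<exists>U :: nat \<Rightarrow> pt set. A \<subseteq> (\<Union>i. U i) \<and> (\<forall>i. bounded (U i) \<and> diameter (U i) \<le> \<delta>)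
      \<and> (\<Sum>i. ennreal (diameter (U i))) \<le> c"
  shows "hausdorff_outer A \<le> c"
  unfolding hausdorff_outer_def
proof (rule SUP_least)
  fix \<delta> :: real assume "\<delta> \<in> {0<..}"
  then have "\<delta> > 0" by simp
  from assms[OF this] obtain U :: "nat \<Rightarrow> pt set" where U: "A \<subseteq> (\<Union>i. U i) \<and> (\<forall>i. bounded (U i) \<and> diameter (U i) \<le> \<delta>)
      \<and> (\<Sum>i. ennreal (diameter (U i))) \<le> c" by (rule exE)
  show "(INF U\<in>{U :: nat \<Rightarrow> pt set. A \<subseteq> (\<Union>i. U i) \<and> (\<forall>i. bounded (U i) \<and> diameter (U i) \<le> \<delta>)}.
       (\<Sum>i. ennreal (diameter (U i)))) \<le> c"
    by (rule INF_lower2[of U]) (use U in auto)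
qed

lemma bounded_diameter_lipschitz_image:
  fixes F :: "real \<Rightarrow> pt"
  assumes F: "C-lipschitz_on UNIV F" and A: "\<And>x y. x \<in> A \<Longrightarrow> y \<in> A \<Longrightarrow> dist x y \<le> d" and d: "0 \<le> d"
  shows "bounded (F ` A)" "diameter (F ` A) \<le> C * d"
proof -
  have C: "0 \<le> C" using F by (rule lipschitz_on_nonneg)
  have *: "dist (F x) (F y) \<le> C * d" if "x \<in> A" "y \<in> A" for x y
    using lipschitz_onD[OF F, of x y] mult_left_mono[OF A[OF that] C] by simp
  show "bounded (F ` A)"
  proof (cases "A = {}")
    case False
    then obtain a where "a \<in> A" by auto
    then show ?thesis unfolding bounded_def using * by blast
  qed simp
  show "diameter (F ` A) \<le> C * d"
    by (rule diameter_le) (use * C d in \<open>auto simp: dist_norm\<close>)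
qed

text \<open>Cover by the images of short subintervals. The factor 4 instead of 2 leaves room for the piece
  that consists of the right end point alone.\<close>

lemma hausdorff_outer_lipschitz_interval:
  fixes F :: "real \<Rightarrow> pt"
  assumes F: "C-lipschitz_on UNIV F" and a: "a > 0" and B: "B \<subseteq> F ` {-a..a}"
  shows "hausdorff_outer B \<le> ennreal (C * (4 * a))"
proof (rule hausdorff_outer_le)
  fix \<delta> :: real assume \<delta>: "\<delta> > 0"
  have C: "0 \<le> C" using F by (rule lipschitz_on_nonneg)
  obtain n :: nat where n: "C * (2 * a) / \<delta> < real n"
    using reals_Archimedean2 by blast
  have "0 \<le> C * (2 * a) / \<delta>" using C a \<delta> by simp
  then have "0 < real n" using n by (rule order_le_less_trans)
  then have n: "C * (2 * a) / \<delta> < real n" "n > 0" using n by simp_all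
  define A where "A i = {x \<in> {-a..a}. i = nat \<lfloor>(x + a) * n / (2 * a)\<rfloor>}" for i
  have dA: "dist x y \<le> 2 * a / n" if "x \<in> A i" "y \<in> A i" for x y i
  proof -
    have *: "real i \<le> (x + a) * n / (2 * a) \<and> (x + a) * n / (2 * a) < real i + 1" if "x \<in> A i" for x
    proof -
      have "(x + a) * n / (2 * a) \<ge> 0" using that a by (auto simp: A_def)
      then have "real (nat \<lfloor>(x + a) * n / (2 * a)\<rfloor>) = of_int \<lfloor>(x + a) * n / (2 * a)\<rfloor>" by simp
      then show ?thesis using that by (simp add: A_def)
    qed
    have "\<bar>(x + a) * n / (2 * a) - (y + a) * n / (2 * a)\<bar> \<le> 1"
      using *[OF that(1)] *[OF that(2)] by linarith
    also have "(x + a) * n / (2 * a) - (y + a) * n / (2 * a) = (x - y) * (n / (2 * a))"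
      using a by (simp add: field_simps)
    finally have "\<bar>x - y\<bar> * (n / (2 * a)) \<le> 1" using a n by (simp add: abs_mult)
    then show ?thesis using a n by (simp add: dist_real_def field_simps)
  qed
  have out: "A i = {}" if "i > n" for i
  proof -
    have "nat \<lfloor>(x + a) * n / (2 * a)\<rfloor> \<le> n" if "x \<in> {-a..a}" for x
    proof -
      have "(x + a) * n / (2 * a) \<le> (2 * a) * n / (2 * a)"
        using that a by (intro divide_right_mono mult_right_mono) auto
      then show ?thesis using a by (simp add: nat_le_iff floor_le_iff)
    qed
    then show ?thesis using that by (force simp: A_def)
  qed
  have cover: "x \<in> A (nat \<lfloor>(x + a) * n / (2 * a)\<rfloor>)" if "x \<in> {-a..a}" for x
    using that by (simp add: A_def)
  have nn: "0 \<le> 2 * a / n" using a by simp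
  have im: "bounded (F ` A i)" "diameter (F ` A i) \<le> C * (2 * a / n)" for i
    by (rule bounded_diameter_lipschitz_image[OF F dA nn], assumption, assumption)+
  have "B \<subseteq> (\<Union>i. F ` A i)" using B cover by blast
  moreover have "bounded (F ` A i) \<and> diameter (F ` A i) \<le> \<delta>" for i
  proof -
    have "C * (2 * a / n) \<le> \<delta>" using n \<delta> by (simp add: field_simps)
    then show ?thesis using im[of i] by simp
  qed
  moreover have "(\<Sum>i. ennreal (diameter (F ` A i))) \<le> ennreal (C * (4 * a))"
  proof -
    have "(\<Sum>i. ennreal (diameter (F ` A i))) = (\<Sum>i\<in>{..n}. ennreal (diameter (F ` A i)))"
      by (rule suminf_finite) (use out in \<open>auto simp: diameter_def\<close>)
    also have "\<dots> \<le> (\<Sum>i\<in>{..n}. ennreal (C * (2 * a / n)))"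
      by (intro sum_mono ennreal_leI im(2))
    also have "\<dots> = ennreal (\<Sum>i\<in>{..n}. C * (2 * a / n))"
      using mult_nonneg_nonneg[OF C nn] by (intro sum_ennreal)
    also have "\<dots> \<le> ennreal (C * (4 * a))"
    proof (rule ennreal_leI)
      have "(\<Sum>i\<in>{..n}. C * (2 * a / n)) = (C * (2 * a)) * ((n + 1) / n)" by (simp add: field_simps)
      also have "\<dots> \<le> (C * (2 * a)) * 2"
        using C a n by (intro mult_left_mono) (auto simp: field_simps)
      finally show "(\<Sum>i\<in>{..n}. C * (2 * a / n)) \<le> C * (4 * a)" by simp
    qed
    finally show ?thesis .
  qed
  ultimately show "\<exists>U. B \<subseteq> (\<Union>i. U i) \<and> (\<forall>i. bounded (U i) \<and> diameter (U i) \<le> \<delta>)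
      \<and> (\<Sum>i. ennreal (diameter (U i))) \<le> ennreal (C * (4 * a))"
    by (intro exI[of _ "\<lambda>i. F ` A i"]) simp
qed

text \<open>A null set of reals lies in an open set of small measure. The components of the open set are
  intervals whose lengths add up to that measure, and their images cover the image of the null set.\<close>

lemma hausdorff_outer_lipschitz_null:
  fixes F :: "real \<Rightarrow> pt"
  assumes F: "C-lipschitz_on UNIV F" and Z: "Z \<in> null_sets lborel" and B: "B \<subseteq> F ` Z"
  shows "hausdorff_outer B = 0"
proof -
  have C: "0 \<le> C" using F by (rule lipschitz_on_nonneg)
  have "hausdorff_outer B \<le> ennreal e" if e: "e > 0" for e
  proof (rule hausdorff_outer_le)
    fix \<delta> :: real assume \<delta>: "\<delta> > 0"
    \<comment> \<open>Every single interval is at most as long as all together, so one bound \<open>r\<close> on the total length controls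
        the diameters (by \<open>\<delta>\<close>) and their sum (by \<open>e\<close>).\<close>
    define r where "r = min e \<delta> / (C + 1)"
    have r: "r > 0" "C * r \<le> e" "C * r \<le> \<delta>"
    proof -
      show "r > 0" using e \<delta> C by (simp add: r_def)
      have "C * r \<le> (C + 1) * r" using \<open>r > 0\<close> by simp
      also have "\<dots> = min e \<delta>" using C by (simp add: r_def)
      finally show "C * r \<le> e" "C * r \<le> \<delta>" by auto
    qed
    obtain U where U: "open U" "Z \<subseteq> U" "emeasure lborel (U - Z) < ennreal r"
      using outer_regular_lborel[OF _ r(1), of Z] Z by (metis null_setsD2 sets_lborel)
    have Ur: "emeasure lborel U < ennreal r"
      using U Z emeasure_Diff_null_set[of Z lborel U] by simp
    let ?c = "components U"
    have "countable ?c"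
      by (rule countable_disjoint_open_subsets)
         (use U(1) open_components pairwise_disjoint_components[of U] in \<open>auto simp: pairwise_def disjnt_def\<close>)
    then have inj: "inj_on (to_nat_on ?c) ?c" by (rule inj_on_to_nat_on)
    \<comment> \<open>An enumeration of the components that is padded with empty sets when there are only finitely many.\<close>
    define A where "A i = \<Union>{K \<in> ?c. to_nat_on ?c K = i}" for i
    have A_cases: "A i = {} \<or> A i \<in> ?c" for i
    proof (cases "\<exists>K\<in>?c. to_nat_on ?c K = i")
      case True
      then obtain K where K: "K \<in> ?c" "to_nat_on ?c K = i" by auto
      then have "{K \<in> ?c. to_nat_on ?c K = i} = {K}" using inj by (auto dest: inj_onD)
      then show ?thesis using K(1) by (simp add: A_def)
    qed (auto simp: A_def)
    have oA: "open (A i)" for i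
      unfolding A_def using U(1) open_components by auto
    have "disjoint_family A"
      unfolding disjoint_family_on_def
    proof (intro ballI impI)
      fix i j :: nat assume "i \<noteq> j"
      show "A i \<inter> A j = {}"
      proof (rule ccontr)
        assume "A i \<inter> A j \<noteq> {}"
        then obtain x K L where "x \<in> K" "x \<in> L" "K \<in> ?c" "L \<in> ?c" "to_nat_on ?c K = i" "to_nat_on ?c L = j"
          by (auto simp: A_def)
        moreover from this have "K = L" using components_eq[of K U L] by auto
        ultimately show False using \<open>i \<noteq> j\<close> by simp
      qed
    qed
    moreover have "(\<Union>i. A i) = \<Union>?c" by (auto simp: A_def simp del: Union_components)
    ultimately have sum: "(\<Sum>i. emeasure lborel (A i)) = emeasure lborel U"
      using oA by (subst suminf_emeasure) auto
    have Ale: "emeasure lborel (A i) \<le> emeasure lborel U" for i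
    proof (rule emeasure_mono)
      show "A i \<subseteq> U" using A_cases[of i] in_components_subset by blast
    qed (use U(1) in simp)
    then have fin: "emeasure lborel (A i) < top" for i
      using Ur by (metis ennreal_less_top order_le_less_trans order_less_trans)
    have dA: "dist x y \<le> measure lborel (A i)" if "x \<in> A i" "y \<in> A i" for x y i
    proof -
      have conn: "connected (A i)" using A_cases[of i] in_components_connected by auto
      have *: "y - x \<le> measure lborel (A i)" if "x \<in> A i" "y \<in> A i" "x \<le> y" for x y
      proof -
        have "{x..y} \<subseteq> A i" using connected_contains_Icc[OF conn that(1,2)] .
        then have "emeasure lborel {x..y} \<le> emeasure lborel (A i)"
          using oA by (intro emeasure_mono) auto
        also have "\<dots> = ennreal (measure lborel (A i))"
          using fin[of i] by (intro emeasure_eq_ennreal_measure) auto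
        finally show ?thesis using that(3) by (simp add: ennreal_le_iff)
      qed
      show ?thesis using *[of x y] *[of y x] that by (cases "x \<le> y") (auto simp: dist_real_def)
    qed
    have le_r: "measure lborel (A i) \<le> r" for i
      using Ale[of i] Ur fin[of i] r(1)
      by (metis emeasure_eq_ennreal_measure ennreal_le_iff less_imp_le order_le_less_trans less_le)
    have im: "bounded (F ` A i)" "diameter (F ` A i) \<le> C * measure lborel (A i)" for i
      by (rule bounded_diameter_lipschitz_image[OF F dA measure_nonneg], assumption, assumption)+
    have "B \<subseteq> (\<Union>i. F ` A i)"
      using B U(2) \<open>(\<Union>i. A i) = \<Union>?c\<close> by fastforce
    moreover have "bounded (F ` A i) \<and> diameter (F ` A i) \<le> \<delta>" for i
    proof -
      have "diameter (F ` A i) \<le> C * measure lborel (A i)" by (rule im(2))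
      also have "\<dots> \<le> C * r" using le_r C by (rule mult_left_mono)
      also have "\<dots> \<le> \<delta>" by (rule r(3))
      finally show ?thesis using im(1)[of i] by blast
    qed
    moreover have "(\<Sum>i. ennreal (diameter (F ` A i))) \<le> ennreal e"
    proof -
      have "(\<Sum>i. ennreal (diameter (F ` A i))) \<le> (\<Sum>i. ennreal C * emeasure lborel (A i))"
      proof (rule suminf_le)
        fix i
        have "ennreal (diameter (F ` A i)) \<le> ennreal (C * measure lborel (A i))"
          by (intro ennreal_leI im(2))
        also have "\<dots> = ennreal C * emeasure lborel (A i)"
          using C fin[of i] by (simp add: ennreal_mult emeasure_eq_ennreal_measure)
        finally show "ennreal (diameter (F ` A i)) \<le> ennreal C * emeasure lborel (A i)" .
      qed auto
      also have "\<dots> = ennreal C * emeasure lborel U" by (simp add: sum)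
      also have "\<dots> \<le> ennreal C * ennreal r" using Ur by (intro mult_left_mono) auto
      also have "\<dots> = ennreal (C * r)" using C r(1) by (simp add: ennreal_mult)
      also have "\<dots> \<le> ennreal e" using r(2) by (rule ennreal_leI)
      finally show ?thesis .
    qed
    ultimately show "\<exists>U. B \<subseteq> (\<Union>i. U i) \<and> (\<forall>i. bounded (U i) \<and> diameter (U i) \<le> \<delta>)
        \<and> (\<Sum>i. ennreal (diameter (U i))) \<le> ennreal e"
      by (intro exI[of _ "\<lambda>i. F ` A i"]) simp
  qed
  then have le: "hausdorff_outer B \<le> 0 + ennreal e" if "e > 0" for e using that by simp
  have "hausdorff_outer B \<le> 0" by (rule ennreal_le_epsilon) (rule le)
  then show ?thesis by simp
qed

section \<open>Orthonormal frames of the plane\<close>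

definition frame_map :: "pt \<Rightarrow> pt \<Rightarrow> pt \<Rightarrow> pt" where
  "frame_map e1 e2 v = (v $ 1) *\<^sub>R e1 + (v $ 2) *\<^sub>R e2"

lemma orthogonal_frame_map:
  assumes "norm e1 = 1" "norm e2 = 1" "e1 \<bullet> e2 = 0"
  shows "orthogonal_transformation (frame_map e1 e2)"
  unfolding orthogonal_transformation_def
proof (intro conjI allI)
  show "linear (frame_map e1 e2)"
    by (rule linearI) (simp_all add: frame_map_def scaleR_add_left scaleR_add_right)
  fix v w
  have "e1 \<bullet> e1 = 1" "e2 \<bullet> e2 = 1" "e2 \<bullet> e1 = 0"
    using assms by (simp_all add: norm_eq_1 inner_commute)
  then have "frame_map e1 e2 v \<bullet> frame_map e1 e2 w = v $ 1 * w $ 1 + v $ 2 * w $ 2"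
    using assms(3) by (simp add: frame_map_def inner_add_left inner_add_right)
  then show "frame_map e1 e2 v \<bullet> frame_map e1 e2 w = v \<bullet> w"
    by (simp add: inner_vec_def sum_2)
qed

lemma frame_representation:
  fixes e1 e2 :: pt
  assumes "norm e1 = 1" "norm e2 = 1" "e1 \<bullet> e2 = 0"
  shows "x = (x \<bullet> e1) *\<^sub>R e1 + (x \<bullet> e2) *\<^sub>R e2"
proof -
  obtain v where v: "x = frame_map e1 e2 v"
    using orthogonal_transformation_surj[OF orthogonal_frame_map[OF assms]] by (metis surjD)
  have "e1 \<bullet> e1 = 1" "e2 \<bullet> e2 = 1" "e2 \<bullet> e1 = 0"
    using assms by (simp_all add: norm_eq_1 inner_commute)
  then show ?thesis using assms(3) by (simp add: v frame_map_def inner_add_left)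
qed

lemma distr_lborel_orthogonal:
  fixes f :: "pt \<Rightarrow> pt"
  assumes f: "orthogonal_transformation f"
  shows "distr lborel borel f = lborel"
proof (rule lborel_eqI[symmetric])
  have [measurable]: "f \<in> borel_measurable borel"
    by (rule borel_measurable_continuous_onI[OF linear_continuous_on[OF
          linear_conv_bounded_linear[THEN iffD1, OF orthogonal_transformation_linear[OF f]]]])
  fix l u :: pt assume lu: "\<And>b. b \<in> Basis \<Longrightarrow> l \<bullet> b \<le> u \<bullet> b"
  let ?g = "inv f"
  have g: "orthogonal_transformation ?g" by (rule orthogonal_transformation_inv[OF f])
  have vim: "f -` box l u = ?g ` box l u"
    by (rule bij_vimage_eq_inv_image[OF orthogonal_transformation_bij[OF f]])
  have lm: "?g ` box l u \<in> lmeasurable" "measure lebesgue (?g ` box l u) = measure lebesgue (box l u)"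
    by (rule measurable_orthogonal_image[OF g] measure_orthogonal_image[OF g], rule lmeasurable_box)+
  have b: "f -` box l u \<in> sets borel" using measurable_sets[of f borel borel "box l u"] by simp
  have "emeasure (distr lborel borel f) (box l u) = emeasure lborel (f -` box l u)"
    by (simp add: emeasure_distr)
  also have "\<dots> = emeasure lebesgue (?g ` box l u)"
    using b by (simp add: vim)
  also have "\<dots> = ennreal (measure lebesgue (box l u))"
    unfolding emeasure_eq_measure2[OF lm(1)] lm(2) ..
  also have "\<dots> = emeasure lborel (box l u)"
    unfolding emeasure_eq_measure2[OF lmeasurable_box, symmetric] by simp
  also have "\<dots> = (\<Prod>b\<in>Basis. (u - l) \<bullet> b)" using lu by simp
  finally show "emeasure (distr lborel borel f) (box l u) = (\<Prod>b\<in>Basis. (u - l) \<bullet> b)" .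
qed simp

definition plane_of_pair :: "real \<times> real \<Rightarrow> pt" where
  "plane_of_pair z = fst z *\<^sub>R axis 1 1 + snd z *\<^sub>R axis 2 1"

lemma plane_of_pair_nth: "plane_of_pair z $ 1 = fst z" "plane_of_pair z $ 2 = snd z"
  by (simp_all add: plane_of_pair_def axis_def)

text \<open>Fubini's theorem is about \<open>real \<times> real\<close>, the invariance under rotations about \<open>real^2\<close>.\<close>

lemma distr_plane_of_pair: "distr lborel borel plane_of_pair = lborel"
proof (rule lborel_eqI[symmetric])
  have [measurable]: "plane_of_pair \<in> borel_measurable borel"
    unfolding plane_of_pair_def[abs_def] by (intro borel_measurable_continuous_onI continuous_on_add
        continuous_on_scaleR continuous_on_fst continuous_on_snd continuous_on_id continuous_on_const)
  fix l u :: pt assume lu: "\<And>b. b \<in> Basis \<Longrightarrow> l \<bullet> b \<le> u \<bullet> b"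
  then have lu': "l $ i \<le> u $ i" for i
  proof -
    have "axis i 1 \<in> (Basis :: pt set)" by (auto simp: Basis_vec_def)
    from lu[OF this] show ?thesis by (simp add: inner_axis)
  qed
  have B: "(Basis :: pt set) = {axis 1 1, axis 2 1}"
    by (auto simp: Basis_vec_def UNIV_2)
  have "plane_of_pair -` box l u = box (l $ 1, l $ 2) (u $ 1, u $ 2)"
    by (auto simp: mem_box B inner_axis plane_of_pair_nth Basis_prod_def)
  then have "emeasure (distr lborel borel plane_of_pair) (box l u)
      = emeasure lborel (box (l $ 1, l $ 2) (u $ 1, u $ 2))"
    by (simp add: emeasure_distr)
  also have "\<dots> = (\<Prod>b\<in>Basis. ((u $ 1, u $ 2) - (l $ 1, l $ 2)) \<bullet> b)"
    using lu' by (subst emeasure_lborel_box) (auto simp: Basis_prod_def)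
  also have "\<dots> = ennreal ((u $ 1 - l $ 1) * (u $ 2 - l $ 2))"
    by (simp add: Basis_prod_def mult.commute[of "u $ 2 - l $ 2"])
  also have "\<dots> = (\<Prod>b\<in>Basis. (u - l) \<bullet> b)"
    by (simp add: B inner_axis axis_eq_axis)
  finally show "emeasure (distr lborel borel plane_of_pair) (box l u) = (\<Prod>b\<in>Basis. (u - l) \<bullet> b)" .
qed simp

lemma nn_integral_frame:
  fixes f :: "pt \<Rightarrow> ennreal"
  assumes e: "norm e1 = 1" "norm e2 = 1" "e1 \<bullet> e2 = 0" and f[measurable]: "f \<in> borel_measurable borel"
  shows "(\<integral>\<^sup>+s. \<integral>\<^sup>+y. f (p + s *\<^sub>R e1 + y *\<^sub>R e2) \<partial>lborel \<partial>lborel) = (\<integral>\<^sup>+x. f x \<partial>lborel)"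
proof -
  have [measurable]: "frame_map e1 e2 \<in> borel_measurable borel" "plane_of_pair \<in> borel_measurable borel"
    unfolding plane_of_pair_def[abs_def] frame_map_def[abs_def]
    by (intro borel_measurable_continuous_onI continuous_on_add continuous_on_component
        continuous_on_scaleR continuous_on_fst continuous_on_snd continuous_on_id continuous_on_const)+
  have "(\<integral>\<^sup>+x. f x \<partial>distr lborel borel ((+) p)) = (\<integral>\<^sup>+x. f (p + x) \<partial>lborel)"
    by (rule nn_integral_distr) measurable
  then have 1: "(\<integral>\<^sup>+x. f x \<partial>lborel) = (\<integral>\<^sup>+x. f (p + x) \<partial>lborel)"
    unfolding lborel_distr_plus .
  have "(\<integral>\<^sup>+x. f (p + x) \<partial>distr lborel borel (frame_map e1 e2)) = (\<integral>\<^sup>+v. f (p + frame_map e1 e2 v) \<partial>lborel)"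
    by (rule nn_integral_distr) measurable
  then have 2: "(\<integral>\<^sup>+x. f (p + x) \<partial>lborel) = (\<integral>\<^sup>+v. f (p + frame_map e1 e2 v) \<partial>lborel)"
    unfolding distr_lborel_orthogonal[OF orthogonal_frame_map[OF e]] .
  have "(\<integral>\<^sup>+v. f (p + frame_map e1 e2 v) \<partial>distr lborel borel plane_of_pair)
      = (\<integral>\<^sup>+z. f (p + frame_map e1 e2 (plane_of_pair z)) \<partial>lborel)"
    by (rule nn_integral_distr) measurable
  then have 3: "(\<integral>\<^sup>+v. f (p + frame_map e1 e2 v) \<partial>lborel)
      = (\<integral>\<^sup>+z. f (p + frame_map e1 e2 (plane_of_pair z)) \<partial>(lborel \<Otimes>\<^sub>M lborel))"
    unfolding distr_plane_of_pair lborel_prod .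
  have "(\<integral>\<^sup>+s. \<integral>\<^sup>+y. f (p + frame_map e1 e2 (plane_of_pair (s, y))) \<partial>lborel \<partial>lborel)
      = (\<integral>\<^sup>+z. f (p + frame_map e1 e2 (plane_of_pair z)) \<partial>(lborel \<Otimes>\<^sub>M lborel))"
    by (rule lborel.nn_integral_fst) (unfold lborel_prod, measurable)
  then have "(\<integral>\<^sup>+s. \<integral>\<^sup>+y. f (p + frame_map e1 e2 (plane_of_pair (s, y))) \<partial>lborel \<partial>lborel) = (\<integral>\<^sup>+x. f x \<partial>lborel)"
    unfolding 1 2 3 .
  then show ?thesis
    unfolding frame_map_def plane_of_pair_nth fst_conv snd_conv add.assoc .
qed

section \<open>Traces of functions with values in a closed set\<close>

text \<open>The radius is shrunk so that the region of height \<open>a\<close> above the graph stays in the ball where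
  the domain is the epigraph of \<open>\<gamma>\<close>. Boundary points in that ball lie on the graph, because both sides
  of the graph are open and one of them is in \<open>\<Omega>\<close>, the other in its complement.\<close>

lemma lipschitz_chart:
  assumes \<Omega>: "lipschitz_domain \<Omega>" and p: "p \<in> frontier \<Omega>"
  obtains e1 e2 :: pt and \<gamma> a L where
    "norm e1 = 1" "norm e2 = 1" "e1 \<bullet> e2 = 0" "L-lipschitz_on UNIV \<gamma>" "a > 0"
    "\<And>s y. \<bar>s\<bar> < a \<Longrightarrow> 0 < y \<Longrightarrow> y < a \<Longrightarrow> p + s *\<^sub>R e1 + (\<gamma> s + y) *\<^sub>R e2 \<in> \<Omega>"
    "\<And>x. x \<in> frontier \<Omega> \<Longrightarrow> x \<in> ball p a \<Longrightarrow>
       \<bar>(x - p) \<bullet> e1\<bar> < a \<and> x = p + ((x - p) \<bullet> e1) *\<^sub>R e1 + \<gamma> ((x - p) \<bullet> e1) *\<^sub>R e2"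
proof -
  from \<Omega> p obtain e1 e2 :: pt and r L \<gamma> where
    e: "norm e1 = 1" "norm e2 = 1" "e1 \<bullet> e2 = 0" and r: "r > 0" and \<gamma>: "L-lipschitz_on UNIV \<gamma>"
    and iff: "\<And>x. x \<in> ball p r \<Longrightarrow> x \<in> \<Omega> \<longleftrightarrow> \<gamma> ((x - p) \<bullet> e1) < (x - p) \<bullet> e2"
    unfolding lipschitz_domain_def by metis
  have op: "open \<Omega>" using \<Omega> by (simp add: lipschitz_domain_def)
  have ee: "e1 \<bullet> e1 = 1" "e2 \<bullet> e2 = 1" "e2 \<bullet> e1 = 0"
    using e by (simp_all add: norm_eq_1 inner_commute)
  have L: "0 \<le> L" using \<gamma> by (rule lipschitz_on_nonneg)
  have cont: "continuous_on UNIV \<gamma>" using \<gamma> by (rule lipschitz_on_continuous_on)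
  have graph: "(x - p) \<bullet> e2 = \<gamma> ((x - p) \<bullet> e1)" if x: "x \<in> frontier \<Omega>" "x \<in> ball p r" for x
  proof (rule antisym)
    have "x \<notin> \<Omega>" using x(1) op by (simp add: frontier_def interior_open)
    then show "(x - p) \<bullet> e2 \<le> \<gamma> ((x - p) \<bullet> e1)" using iff[OF x(2)] by simp
    show "\<gamma> ((x - p) \<bullet> e1) \<le> (x - p) \<bullet> e2"
    proof (rule ccontr)
      assume "\<not> \<gamma> ((x - p) \<bullet> e1) \<le> (x - p) \<bullet> e2"
      define W where "W = ball p r \<inter> {z. (z - p) \<bullet> e2 < \<gamma> ((z - p) \<bullet> e1)}"
      have "open W" unfolding W_def
        by (intro open_Int open_ball open_Collect_less continuous_intros continuous_on_compose2[OF cont]) auto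
      moreover have "x \<in> W" using x \<open>\<not> _ \<le> _\<close> by (simp add: W_def)
      moreover have "x \<in> closure \<Omega>" using x(1) by (simp add: frontier_def)
      ultimately obtain z where "z \<in> \<Omega>" "z \<in> W" using closure_iff_nhds_not_empty[of x \<Omega>] by blast
      then show False using iff[of z] by (simp add: W_def)
    qed
  qed
  have \<gamma>0: "\<gamma> 0 = 0" using graph[OF p] r by simp
  \<comment> \<open>The points of height \<open>y < a\<close> over \<open>|s| < a\<close> have distance less than \<open>a + (L a + a) = r\<close> from \<open>p\<close>.\<close>
  define a where "a = r / (2 + L)"
  have a: "a > 0" "a * (2 + L) = r" using r L by (simp_all add: a_def)
  have "a * 1 \<le> a * (2 + L)" using a L by (intro mult_left_mono) auto
  then have ar: "a \<le> r" using a by simp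
  show ?thesis
  proof (rule that[OF e \<gamma> a(1)])
    fix s y :: real assume s: "\<bar>s\<bar> < a" and y: "0 < y" "y < a"
    let ?x = "p + s *\<^sub>R e1 + (\<gamma> s + y) *\<^sub>R e2"
    have "\<bar>\<gamma> s\<bar> \<le> L * \<bar>s\<bar>"
      using lipschitz_onD[OF \<gamma>, of s 0] by (simp add: \<gamma>0 dist_real_def)
    also have "\<dots> \<le> L * a" using s L by (intro mult_left_mono) auto
    finally have g: "\<bar>\<gamma> s\<bar> \<le> L * a" .
    have "dist p ?x = norm (s *\<^sub>R e1 + (\<gamma> s + y) *\<^sub>R e2)"
      by (subst dist_commute) (simp add: dist_norm add.assoc)
    also have "\<dots> \<le> \<bar>s\<bar> + \<bar>\<gamma> s + y\<bar>"
      by (rule order_trans[OF norm_triangle_ineq]) (simp add: e)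
    also have "\<dots> < a * (2 + L)" using s y g by (simp add: algebra_simps)
    finally have "?x \<in> ball p r" by (simp add: a)
    moreover have "(?x - p) \<bullet> e1 = s" "(?x - p) \<bullet> e2 = \<gamma> s + y"
      using ee e(3) by (simp_all add: inner_add_left)
    ultimately show "?x \<in> \<Omega>" using iff[of ?x] y by simp
  next
    fix x assume x: "x \<in> frontier \<Omega>" "x \<in> ball p a"
    then have "x \<in> ball p r" using ar by auto
    note g = graph[OF x(1) this]
    have "\<bar>(x - p) \<bullet> e1\<bar> \<le> norm (x - p) * norm e1" by (rule Cauchy_Schwarz_ineq2)
    also have "\<dots> < a" using x(2) e by (simp add: dist_norm norm_minus_commute)
    finally show "\<bar>(x - p) \<bullet> e1\<bar> < a \<and> x = p + ((x - p) \<bullet> e1) *\<^sub>R e1 + \<gamma> ((x - p) \<bullet> e1) *\<^sub>R e2"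
      using frame_representation[OF e, of "x - p"] g by (simp add: algebra_simps)
  qed
qed

lemma graph_map_lipschitz:
  fixes e1 e2 p :: pt
  assumes "norm e1 = 1" "norm e2 = 1" and \<gamma>: "L-lipschitz_on UNIV \<gamma>"
  shows "(1 + L)-lipschitz_on UNIV (\<lambda>s. p + s *\<^sub>R e1 + \<gamma> s *\<^sub>R e2)"
proof (rule lipschitz_onI)
  fix s t :: real
  have "dist (p + s *\<^sub>R e1 + \<gamma> s *\<^sub>R e2) (p + t *\<^sub>R e1 + \<gamma> t *\<^sub>R e2)
      = norm ((s - t) *\<^sub>R e1 + (\<gamma> s - \<gamma> t) *\<^sub>R e2)"
    by (simp add: dist_norm algebra_simps)
  also have "\<dots> \<le> dist s t + dist (\<gamma> s) (\<gamma> t)"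
    by (rule order_trans[OF norm_triangle_ineq]) (simp add: assms dist_real_def)
  also have "\<dots> \<le> (1 + L) * dist s t"
    using lipschitz_onD[OF \<gamma>, of s t] by (simp add: algebra_simps)
  finally show "dist (p + s *\<^sub>R e1 + \<gamma> s *\<^sub>R e2) (p + t *\<^sub>R e1 + \<gamma> t *\<^sub>R e2) \<le> (1 + L) * dist s t" .
qed (use lipschitz_on_nonneg[OF \<gamma>] in simp)

text \<open>Finiteness makes the restrictions of smooth functions to the boundary square integrable. This
  gives the second limit in the definition of a trace its meaning, since the integral of a
  non-integrable function is zero by convention.\<close>

lemma emeasure_frontier_finite:
  assumes "bounded \<Omega>" and \<Omega>: "lipschitz_domain \<Omega>"
  shows "emeasure surface_measure (frontier \<Omega>) < \<infinity>"
proof -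
  have "\<exists>a>0. emeasure surface_measure (frontier \<Omega> \<inter> ball p a) < \<infinity>" if p: "p \<in> frontier \<Omega>" for p
  proof -
    obtain e1 e2 :: pt and \<gamma> a L where chart:
      "norm e1 = 1" "norm e2 = 1" "L-lipschitz_on UNIV \<gamma>" "a > 0"
      "\<And>x. x \<in> frontier \<Omega> \<Longrightarrow> x \<in> ball p a \<Longrightarrow>
         \<bar>(x - p) \<bullet> e1\<bar> < a \<and> x = p + ((x - p) \<bullet> e1) *\<^sub>R e1 + \<gamma> ((x - p) \<bullet> e1) *\<^sub>R e2"
      by (rule lipschitz_chart[OF \<Omega> p]) blast
    have "emeasure surface_measure (frontier \<Omega> \<inter> ball p a) \<le> hausdorff_outer (frontier \<Omega> \<inter> ball p a)"
      by (rule emeasure_surface_measure_le) (auto intro: borel_closed)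
    also have "\<dots> \<le> ennreal ((1 + L) * (4 * a))"
    proof (rule hausdorff_outer_lipschitz_interval[OF graph_map_lipschitz[OF chart(1-3)] chart(4)])
      show "frontier \<Omega> \<inter> ball p a \<subseteq> (\<lambda>s. p + s *\<^sub>R e1 + \<gamma> s *\<^sub>R e2) ` {-a..a}"
      proof
        fix x assume "x \<in> frontier \<Omega> \<inter> ball p a"
        with chart(5)[of x] show "x \<in> (\<lambda>s. p + s *\<^sub>R e1 + \<gamma> s *\<^sub>R e2) ` {-a..a}"
          by (intro image_eqI[of _ _ "(x - p) \<bullet> e1"]) auto
      qed
    qed
    finally show ?thesis using chart(4) by (metis ennreal_less_top infinity_ennreal_def order_le_less_trans)
  qed
  then obtain a where a: "\<And>p. p \<in> frontier \<Omega> \<Longrightarrow> a p > 0"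
    "\<And>p. p \<in> frontier \<Omega> \<Longrightarrow> emeasure surface_measure (frontier \<Omega> \<inter> ball p (a p)) < \<infinity>"
    by metis
  have "compact (frontier \<Omega>)" using assms(1) by (rule compact_frontier_bounded)
  then obtain D where D: "D \<subseteq> frontier \<Omega>" "finite D" "frontier \<Omega> \<subseteq> (\<Union>p\<in>D. ball p (a p))"
    by (rule compactE_image[of _ "frontier \<Omega>" "\<lambda>p. ball p (a p)"]) (use a(1) in \<open>auto intro!: bexI\<close>)
  have s: "frontier \<Omega> \<inter> ball p (a p) \<in> sets surface_measure" for p
    by (rule sets_surface_measure_borel) (auto intro: borel_closed)
  have "emeasure surface_measure (frontier \<Omega>) \<le> emeasure surface_measure (\<Union>p\<in>D. frontier \<Omega> \<inter> ball p (a p))"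
    by (intro emeasure_mono sets.finite_UN D(2) s) (use D(3) in blast)
  also have "\<dots> \<le> (\<Sum>p\<in>D. emeasure surface_measure (frontier \<Omega> \<inter> ball p (a p)))"
    using D(2) s by (intro emeasure_subadditive_finite) auto
  also have "\<dots> < \<infinity>" using D a(2) by (auto simp: subset_iff)
  finally show ?thesis .
qed

lemma smooth_segment_bound:
  fixes f :: "pt \<Rightarrow> real"
  assumes f: "C_infinity f" and e: "norm e = 1" and y: "0 < y" "y < b"
  shows "ennreal \<bar>f (x + y *\<^sub>R e) - f x\<bar>
    \<le> (\<integral>\<^sup>+t. ennreal (norm (gradient f (x + t *\<^sub>R e))) * indicator {0<..<b} t \<partial>lborel)"
proof -
  let ?g = "\<lambda>t. norm (gradient f (x + t *\<^sub>R e))"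
  have der: "((\<lambda>t. f (x + t *\<^sub>R e)) has_real_derivative gradient f (x + t *\<^sub>R e) \<bullet> e) (at t within S)" for t S
  proof -
    have "((\<lambda>t. f (x + t *\<^sub>R e)) has_derivative (\<lambda>h. frechet_derivative f (at (x + t *\<^sub>R e)) (h *\<^sub>R e))) (at t)"
    proof (rule has_derivative_compose[of "\<lambda>t. x + t *\<^sub>R e" "\<lambda>h. h *\<^sub>R e", where g = f])
      show "((\<lambda>t. x + t *\<^sub>R e) has_derivative (\<lambda>h. h *\<^sub>R e)) (at t)"
        by (auto intro!: derivative_eq_intros)
    qed (rule C_infinity_has_derivative[OF f])
    then have "((\<lambda>t. f (x + t *\<^sub>R e)) has_derivative (\<lambda>h. h * (gradient f (x + t *\<^sub>R e) \<bullet> e))) (at t)"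
      unfolding gradient_inner[OF f, symmetric] inner_scaleR_right .
    then have "((\<lambda>t. f (x + t *\<^sub>R e)) has_real_derivative gradient f (x + t *\<^sub>R e) \<bullet> e) (at t)"
      unfolding has_field_derivative_def mult_commute_abs .
    then show ?thesis by (rule has_field_derivative_at_within)
  qed
  have contg: "continuous_on S (\<lambda>t. gradient f (x + t *\<^sub>R e))" for S
    by (rule continuous_on_compose2[OF continuous_gradient[OF f, of UNIV]]) (auto intro!: continuous_intros)
  have "((\<lambda>t. gradient f (x + t *\<^sub>R e) \<bullet> e) has_integral (f (x + y *\<^sub>R e) - f (x + 0 *\<^sub>R e))) {0..y}"
    using y der by (intro fundamental_theorem_of_calculus)
      (auto simp: has_real_derivative_iff_has_vector_derivative[symmetric])
  then have I: "f (x + y *\<^sub>R e) - f x = integral {0..y} (\<lambda>t. gradient f (x + t *\<^sub>R e) \<bullet> e)"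
    by (simp add: integral_unique)
  have int_g: "?g integrable_on {0..y}"
    by (intro integrable_continuous_interval continuous_on_norm contg)
  have "\<bar>f (x + y *\<^sub>R e) - f x\<bar> \<le> integral {0..y} ?g"
    unfolding I real_norm_def[symmetric]
  proof (rule integral_norm_bound_integral[OF _ int_g])
    show "(\<lambda>t. gradient f (x + t *\<^sub>R e) \<bullet> e) integrable_on {0..y}"
      by (intro integrable_continuous_interval continuous_on_inner contg continuous_on_const)
    show "norm (gradient f (x + t *\<^sub>R e) \<bullet> e) \<le> ?g t" for t
      using Cauchy_Schwarz_ineq2[of "gradient f (x + t *\<^sub>R e)" e] e by simp
  qed
  then have "ennreal \<bar>f (x + y *\<^sub>R e) - f x\<bar> \<le> ennreal (integral {0..y} ?g)"
    by (rule ennreal_leI)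
  also have "\<dots> = (\<integral>\<^sup>+t. ennreal (?g t * indicator {0<..<y} t) \<partial>lborel)"
  proof (rule nn_integral_has_integral_lborel[symmetric])
    have "?g \<in> borel_measurable borel"
      by (intro borel_measurable_continuous_onI continuous_on_norm contg)
    then show "(\<lambda>t. ?g t * indicator {0<..<y} t) \<in> borel_measurable borel" by measurable
    have "(?g has_integral integral {0..y} ?g) {0<..<y}"
      using int_g by (simp add: has_integral_Icc_iff_Ioo[symmetric] has_integral_integral)
    then have "((\<lambda>t. if t \<in> {0<..<y} then ?g t else 0) has_integral integral {0..y} ?g) UNIV"
      by (simp only: has_integral_restrict_UNIV)
    also have "(\<lambda>t. if t \<in> {0<..<y} then ?g t else 0) = (\<lambda>t. ?g t * indicator {0<..<y} t)"
      by (auto simp: fun_eq_iff indicator_def)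
    finally show "((\<lambda>t. ?g t * indicator {0<..<y} t) has_integral integral {0..y} ?g) UNIV" .
  qed simp
  also have "\<dots> \<le> (\<integral>\<^sup>+t. ennreal (?g t) * indicator {0<..<b} t \<partial>lborel)"
    using y by (intro nn_integral_mono) (auto simp: indicator_def)
  finally show ?thesis .
qed

text \<open>The part of a chart at height less than \<open>b\<close> above the boundary.\<close>

definition graph_strip :: "pt \<Rightarrow> pt \<Rightarrow> pt \<Rightarrow> (real \<Rightarrow> real) \<Rightarrow> real \<Rightarrow> real \<Rightarrow> pt set" where
  "graph_strip p e1 e2 \<gamma> a b =
     {x. \<bar>(x - p) \<bullet> e1\<bar> < a \<and> 0 < (x - p) \<bullet> e2 - \<gamma> ((x - p) \<bullet> e1) \<and> (x - p) \<bullet> e2 - \<gamma> ((x - p) \<bullet> e1) < b}"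

lemma open_graph_strip:
  assumes "continuous_on UNIV \<gamma>"
  shows "open (graph_strip p e1 e2 \<gamma> a b)"
  unfolding graph_strip_def
  by (intro open_Collect_conj open_Collect_less continuous_intros continuous_on_compose2[OF assms]) auto

text \<open>Fubini's theorem in the frame, with a shift of the second variable by \<open>\<gamma>\<close> on each line.\<close>

lemma nn_integral_graph_strip:
  fixes h :: "pt \<Rightarrow> ennreal"
  assumes e: "norm e1 = 1" "norm e2 = 1" "e1 \<bullet> e2 = 0" and \<gamma>: "continuous_on UNIV \<gamma>"
    and h[measurable]: "h \<in> borel_measurable borel"
  shows "(\<integral>\<^sup>+s. (\<integral>\<^sup>+y. h (p + s *\<^sub>R e1 + \<gamma> s *\<^sub>R e2 + y *\<^sub>R e2) * indicator {0<..<b} y \<partial>lborel)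
      * indicator {-a<..<a} s \<partial>lborel)
    = (\<integral>\<^sup>+x. h x * indicator (graph_strip p e1 e2 \<gamma> a b) x \<partial>lborel)"
proof -
  have [measurable]: "graph_strip p e1 e2 \<gamma> a b \<in> sets borel"
    using open_graph_strip[OF \<gamma>] by simp
  have ee: "e1 \<bullet> e1 = 1" "e2 \<bullet> e2 = 1" "e2 \<bullet> e1 = 0"
    using e by (simp_all add: norm_eq_1 inner_commute)
  let ?S = "graph_strip p e1 e2 \<gamma> a b"
  have "(\<integral>\<^sup>+y. h (p + s *\<^sub>R e1 + \<gamma> s *\<^sub>R e2 + y *\<^sub>R e2) * indicator {0<..<b} y \<partial>lborel) * indicator {-a<..<a} s
      = (\<integral>\<^sup>+y. h (p + s *\<^sub>R e1 + y *\<^sub>R e2) * indicator ?S (p + s *\<^sub>R e1 + y *\<^sub>R e2) \<partial>lborel)" for s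
  proof -
    have [measurable]: "(\<lambda>y. p + s *\<^sub>R e1 + y *\<^sub>R e2) \<in> borel_measurable borel"
      by (intro borel_measurable_continuous_onI continuous_intros)
    have "(\<integral>\<^sup>+y. h (p + s *\<^sub>R e1 + y *\<^sub>R e2) * indicator ?S (p + s *\<^sub>R e1 + y *\<^sub>R e2) \<partial>lborel)
        = (\<integral>\<^sup>+y. h (p + s *\<^sub>R e1 + (\<gamma> s + 1 * y) *\<^sub>R e2) * indicator ?S (p + s *\<^sub>R e1 + (\<gamma> s + 1 * y) *\<^sub>R e2)
            \<partial>lborel)"
      by (subst nn_integral_real_affine[where c = 1 and t = "\<gamma> s"]) simp_all
    also have "\<dots> = (\<integral>\<^sup>+y. (h (p + s *\<^sub>R e1 + \<gamma> s *\<^sub>R e2 + y *\<^sub>R e2) * indicator {0<..<b} y)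
        * indicator {-a<..<a} s \<partial>lborel)"
    proof (rule nn_integral_cong)
      fix y
      have "p + s *\<^sub>R e1 + (\<gamma> s + 1 * y) *\<^sub>R e2 \<in> ?S \<longleftrightarrow> s \<in> {-a<..<a} \<and> y \<in> {0<..<b}"
        using ee e(3) by (auto simp: graph_strip_def inner_add_left)
      then show "h (p + s *\<^sub>R e1 + (\<gamma> s + 1 * y) *\<^sub>R e2) * indicator ?S (p + s *\<^sub>R e1 + (\<gamma> s + 1 * y) *\<^sub>R e2)
          = (h (p + s *\<^sub>R e1 + \<gamma> s *\<^sub>R e2 + y *\<^sub>R e2) * indicator {0<..<b} y) * indicator {-a<..<a} s"
        by (auto simp: indicator_def scaleR_add_left add.assoc)
    qed
    also have "\<dots> = (\<integral>\<^sup>+y. h (p + s *\<^sub>R e1 + \<gamma> s *\<^sub>R e2 + y *\<^sub>R e2) * indicator {0<..<b} y \<partial>lborel)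
        * indicator {-a<..<a} s"
    proof (rule nn_integral_multc)
      have [measurable]: "(\<lambda>y. p + s *\<^sub>R e1 + \<gamma> s *\<^sub>R e2 + y *\<^sub>R e2) \<in> borel_measurable borel"
        by (intro borel_measurable_continuous_onI continuous_intros)
      show "(\<lambda>y. h (p + s *\<^sub>R e1 + \<gamma> s *\<^sub>R e2 + y *\<^sub>R e2) * indicator {0<..<b} y) \<in> borel_measurable lborel"
        by measurable
    qed
    finally show ?thesis by simp
  qed
  then have "(\<integral>\<^sup>+s. (\<integral>\<^sup>+y. h (p + s *\<^sub>R e1 + \<gamma> s *\<^sub>R e2 + y *\<^sub>R e2) * indicator {0<..<b} y \<partial>lborel)
      * indicator {-a<..<a} s \<partial>lborel)
      = (\<integral>\<^sup>+s. \<integral>\<^sup>+y. h (p + s *\<^sub>R e1 + y *\<^sub>R e2) * indicator ?S (p + s *\<^sub>R e1 + y *\<^sub>R e2) \<partial>lborel \<partial>lborel)"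
    by simp
  also have "\<dots> = (\<integral>\<^sup>+x. h x * indicator ?S x \<partial>lborel)"
    by (rule nn_integral_frame[OF e]) measurable
  finally show ?thesis .
qed

text \<open>Moving from a boundary point into the domain along \<open>e2\<close> changes the distance of \<open>f\<close> from \<open>A\<close> by at
  most the integral of the gradient along the segment. Average this over segments of length less than
  \<open>b\<close> and integrate over the boundary.\<close>

lemma graph_fiber_bound:
  fixes f :: "pt \<Rightarrow> real" and A :: "real set"
  assumes f: "C_infinity f" and e: "norm e1 = 1" "norm e2 = 1" "e1 \<bullet> e2 = 0"
    and \<gamma>: "continuous_on UNIV \<gamma>" and b: "b > 0"
  shows "ennreal b * (\<integral>\<^sup>+s\<in>{-a<..<a}. ennreal (infdist (f (p + s *\<^sub>R e1 + \<gamma> s *\<^sub>R e2)) A) \<partial>lborel)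
    \<le> (\<integral>\<^sup>+x\<in>graph_strip p e1 e2 \<gamma> a b. ennreal (infdist (f x) A) \<partial>lborel)
      + ennreal b * (\<integral>\<^sup>+x\<in>graph_strip p e1 e2 \<gamma> a b. ennreal (norm (gradient f x)) \<partial>lborel)"
proof -
  define F where "F s = p + s *\<^sub>R e1 + \<gamma> s *\<^sub>R e2" for s
  define h1 where "h1 x = ennreal (infdist (f x) A)" for x
  define h2 where "h2 x = ennreal (norm (gradient f x))" for x
  have h1_meas[measurable]: "h1 \<in> borel_measurable borel"
  proof -
    have "(\<lambda>x. infdist (f x) A) \<in> borel_measurable borel"
      by (intro borel_measurable_continuous_onI continuous_on_infdist C_infinity_continuous f)
    then show ?thesis unfolding h1_def[abs_def] by measurable
  qed
  have h2_meas[measurable]: "h2 \<in> borel_measurable borel"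
  proof -
    have "(\<lambda>x. norm (gradient f x)) \<in> borel_measurable borel"
      by (intro borel_measurable_continuous_onI continuous_on_norm continuous_gradient f)
    then show ?thesis unfolding h2_def[abs_def] by measurable
  qed
  have F_meas[measurable]: "F \<in> borel_measurable borel"
    unfolding F_def[abs_def]
    by (intro borel_measurable_continuous_onI continuous_on_add continuous_on_scaleR continuous_on_const
        continuous_on_id \<gamma>)
  define I1 where "I1 s = (\<integral>\<^sup>+y\<in>{0<..<b}. h1 (F s + y *\<^sub>R e2) \<partial>lborel)" for s
  define I2 where "I2 s = (\<integral>\<^sup>+y\<in>{0<..<b}. h2 (F s + y *\<^sub>R e2) \<partial>lborel)" for s
  have I_meas[measurable]: "I1 \<in> borel_measurable borel" "I2 \<in> borel_measurable borel"
    unfolding I1_def[abs_def] I2_def[abs_def] by measurable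
  have fiber: "ennreal b * h1 (F s) \<le> I1 s + ennreal b * I2 s" for s
  proof -
    have [measurable]: "(\<lambda>y. F s + y *\<^sub>R e2) \<in> borel_measurable borel" by measurable
    have pt: "h1 (F s) * indicator {0<..<b} y \<le> h1 (F s + y *\<^sub>R e2) * indicator {0<..<b} y
        + I2 s * indicator {0<..<b} y" for y
    proof (cases "y \<in> {0<..<b}")
      case True
      have "infdist (f (F s)) A \<le> infdist (f (F s + y *\<^sub>R e2)) A + \<bar>f (F s + y *\<^sub>R e2) - f (F s)\<bar>"
        using infdist_triangle[of "f (F s)" A "f (F s + y *\<^sub>R e2)"] by (simp add: dist_real_def abs_minus_commute)
      then have "h1 (F s) \<le> ennreal (infdist (f (F s + y *\<^sub>R e2)) A + \<bar>f (F s + y *\<^sub>R e2) - f (F s)\<bar>)"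
        unfolding h1_def by (rule ennreal_leI)
      also have "\<dots> = h1 (F s + y *\<^sub>R e2) + ennreal \<bar>f (F s + y *\<^sub>R e2) - f (F s)\<bar>"
        unfolding h1_def by (rule ennreal_plus) (auto simp: infdist_nonneg)
      also have "\<dots> \<le> h1 (F s + y *\<^sub>R e2) + I2 s"
        unfolding I2_def h2_def using True by (intro add_left_mono smooth_segment_bound f e(2)) auto
      finally show ?thesis using True by simp
    qed simp
    have "ennreal b * h1 (F s) = (\<integral>\<^sup>+y. h1 (F s) * indicator {0<..<b} y \<partial>lborel)"
      using b by (subst nn_integral_cmult_indicator) (simp_all add: mult.commute)
    also have "\<dots> \<le> (\<integral>\<^sup>+y. h1 (F s + y *\<^sub>R e2) * indicator {0<..<b} y + I2 s * indicator {0<..<b} y \<partial>lborel)"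
      by (rule nn_integral_mono) (rule pt)
    also have "\<dots> = I1 s + (\<integral>\<^sup>+y. I2 s * indicator {0<..<b} y \<partial>lborel)"
      unfolding I1_def by (rule nn_integral_add) measurable
    also have "(\<integral>\<^sup>+y. I2 s * indicator {0<..<b} y \<partial>lborel) = ennreal b * I2 s"
      using b by (subst nn_integral_cmult_indicator) (simp_all add: mult.commute)
    finally show ?thesis .
  qed
  have "ennreal b * (\<integral>\<^sup>+s. h1 (F s) * indicator {-a<..<a} s \<partial>lborel)
      = (\<integral>\<^sup>+s. ennreal b * (h1 (F s) * indicator {-a<..<a} s) \<partial>lborel)"
    by (rule nn_integral_cmult[symmetric]) measurable
  also have "\<dots> \<le> (\<integral>\<^sup>+s. I1 s * indicator {-a<..<a} s + ennreal b * (I2 s * indicator {-a<..<a} s) \<partial>lborel)"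
  proof (rule nn_integral_mono)
    fix s
    show "ennreal b * (h1 (F s) * indicator {-a<..<a} s) \<le> I1 s * indicator {-a<..<a} s
        + ennreal b * (I2 s * indicator {-a<..<a} s)"
      using fiber[of s] by (cases "s \<in> {-a<..<a}") simp_all
  qed
  also have "\<dots> = (\<integral>\<^sup>+s. I1 s * indicator {-a<..<a} s \<partial>lborel)
      + (\<integral>\<^sup>+s. ennreal b * (I2 s * indicator {-a<..<a} s) \<partial>lborel)"
    by (rule nn_integral_add) measurable
  also have "(\<integral>\<^sup>+s. ennreal b * (I2 s * indicator {-a<..<a} s) \<partial>lborel)
      = ennreal b * (\<integral>\<^sup>+s. I2 s * indicator {-a<..<a} s \<partial>lborel)"
    by (rule nn_integral_cmult) measurable
  also have "(\<integral>\<^sup>+s. I1 s * indicator {-a<..<a} s \<partial>lborel) = (\<integral>\<^sup>+x\<in>graph_strip p e1 e2 \<gamma> a b. h1 x \<partial>lborel)"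
    unfolding I1_def F_def by (rule nn_integral_graph_strip[OF e \<gamma> h1_meas])
  also have "(\<integral>\<^sup>+s. I2 s * indicator {-a<..<a} s \<partial>lborel) = (\<integral>\<^sup>+x\<in>graph_strip p e1 e2 \<gamma> a b. h2 x \<partial>lborel)"
    unfolding I2_def F_def by (rule nn_integral_graph_strip[OF e \<gamma> h2_meas])
  finally show ?thesis unfolding h1_def h2_def F_def .
qed

lemma measure_graph_strip:
  assumes e: "norm e1 = 1" "norm e2 = 1" "e1 \<bullet> e2 = 0" and \<gamma>: "continuous_on UNIV \<gamma>" and ab: "a > 0" "b > 0"
  shows "emeasure lborel (graph_strip p e1 e2 \<gamma> a b) = ennreal (2 * a * b)"
proof -
  have S: "graph_strip p e1 e2 \<gamma> a b \<in> sets lborel" using open_graph_strip[OF \<gamma>] by simp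
  have "emeasure lborel (graph_strip p e1 e2 \<gamma> a b) = (\<integral>\<^sup>+x\<in>graph_strip p e1 e2 \<gamma> a b. 1 \<partial>lborel)"
    using S by simp
  also have "\<dots> = (\<integral>\<^sup>+s. (\<integral>\<^sup>+y. 1 * indicator {0<..<b} y \<partial>lborel) * indicator {-a<..<a} s \<partial>lborel)"
    by (rule nn_integral_graph_strip[OF e \<gamma>, symmetric]) simp
  also have "\<dots> = ennreal b * ennreal (a - (- a))"
    using ab by (simp add: nn_integral_cmult_indicator)
  also have "\<dots> = ennreal (2 * a * b)"
    using ab by (simp add: ennreal_mult[symmetric] mult.commute)
  finally show ?thesis .
qed

lemma set_nn_integral_le_lebesgue_on:
  fixes k :: "pt \<Rightarrow> real"
  assumes S: "S \<subseteq> \<Omega>" and \<Omega>: "open \<Omega>" and k: "integrable (lebesgue_on \<Omega>) k" "\<And>x. 0 \<le> k x"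
    and h: "AE x in lebesgue_on \<Omega>. h x * indicator S x \<le> ennreal (k x)"
  shows "(\<integral>\<^sup>+x\<in>S. h x \<partial>lborel) \<le> ennreal (\<integral>x. k x \<partial>lebesgue_on \<Omega>)"
proof -
  have "(\<integral>\<^sup>+x\<in>S. h x \<partial>lborel) = (\<integral>\<^sup>+x. h x * indicator S x * indicator \<Omega> x \<partial>lebesgue)"
    unfolding nn_integral_completion
    by (rule nn_integral_cong) (use S in \<open>auto simp: indicator_def\<close>)
  also have "\<dots> = (\<integral>\<^sup>+x. h x * indicator S x \<partial>lebesgue_on \<Omega>)"
    using \<Omega> by (subst nn_integral_restrict_space) auto
  also have "\<dots> \<le> (\<integral>\<^sup>+x. ennreal (k x) \<partial>lebesgue_on \<Omega>)"
    using h by (rule nn_integral_mono_AE)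
  also have "\<dots> = ennreal (\<integral>x. k x \<partial>lebesgue_on \<Omega>)"
    by (rule nn_integral_eq_integral[OF k(1)]) (simp add: k(2))
  finally show ?thesis .
qed

text \<open>Smooth approximations of \<open>u\<close> have bounded gradients in \<open>L2\<close>.\<close>

lemma H1_norm_gradient_bound:
  assumes \<Omega>: "bounded \<Omega>" "open \<Omega>" and f: "C_infinity f" and u: "u \<in> H1 \<Omega>"
  shows "L2_norm (lebesgue_on \<Omega>) (gradient f) \<le> H1_norm \<Omega> (\<lambda>x. f x - u x) + H1_norm \<Omega> (\<lambda>x. -1 * u x)"
proof -
  interpret complete_measure "lebesgue_on \<Omega>" using \<Omega> by (intro complete_lebesgue_on) simp
  have fH: "f \<in> H1 \<Omega>" by (rule smooth_H1[OF \<Omega> f])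
  have "AE x in lebesgue_on \<Omega>. gradient f x = weak_gradient \<Omega> f x"
    using weak_gradient_AE[OF \<Omega>(2) has_weak_gradient_smooth[OF \<Omega>(2) f]] by eventually_elim simp
  then have "L2_norm (lebesgue_on \<Omega>) (gradient f) = L2_norm (lebesgue_on \<Omega>) (weak_gradient \<Omega> f)"
    by (rule L2_norm_AE_eq)
  also have "\<dots> \<le> H1_norm \<Omega> f" by (rule L2_norm_le_H1_norm)
  also have "H1_norm \<Omega> f = H1_norm \<Omega> (\<lambda>x. (f x - u x) - (-1 * u x))" by simp
  also have "\<dots> \<le> H1_norm \<Omega> (\<lambda>x. f x - u x) + H1_norm \<Omega> (\<lambda>x. -1 * u x)"
    by (intro H1_norm_triangle_diff H1_diff H1_cmult \<Omega>(2) fH u)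
  finally show ?thesis .
qed

text \<open>The two terms of \<open>graph_fiber_bound\<close>: inside the domain the distance of \<open>f\<close> from \<open>A\<close> is at most
  \<open>|f - u|\<close>, since \<open>u\<close> takes its values in \<open>A\<close>; the gradient is integrated over a strip of area
  \<open>2 a b\<close> only, which the Cauchy-Schwarz inequality turns into a factor \<open>sqrt (2 a b)\<close>.\<close>

lemma graph_infdist_bound:
  fixes f :: "pt \<Rightarrow> real" and A :: "real set"
  assumes \<Omega>: "bounded \<Omega>" "open \<Omega>" and f: "C_infinity f" and u: "u \<in> L2 (lebesgue_on \<Omega>)"
    and uA: "AE x in lebesgue_on \<Omega>. u x \<in> A"
    and e: "norm e1 = 1" "norm e2 = 1" "e1 \<bullet> e2 = 0"
    and \<gamma>: "continuous_on UNIV \<gamma>" and ab: "a > 0" "b > 0"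
    and sub: "graph_strip p e1 e2 \<gamma> a b \<subseteq> \<Omega>"
  shows "(\<integral>\<^sup>+s\<in>{-a<..<a}. ennreal (infdist (f (p + s *\<^sub>R e1 + \<gamma> s *\<^sub>R e2)) A) \<partial>lborel)
    \<le> ennreal (L2_norm (lebesgue_on \<Omega>) (\<lambda>x. f x - u x) * L2_norm (lebesgue_on \<Omega>) (\<lambda>x. 1::real) / b
        + sqrt (2 * a * b) * L2_norm (lebesgue_on \<Omega>) (gradient f))"
    (is "?J \<le> ennreal (?X / b + ?Y)")
proof -
  let ?M = "lebesgue_on \<Omega>" and ?S = "graph_strip p e1 e2 \<gamma> a b"
  have one: "(\<lambda>x. 1::real) \<in> L2 ?M" by (rule L2_const[OF lebesgue_on_bounded_finite[OF \<Omega>]])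
  have fu: "(\<lambda>x. f x - u x) \<in> L2 ?M"
    by (intro L2_diff u continuous_L2[OF \<Omega>] C_infinity_continuous f)
  have gr: "gradient f \<in> L2 ?M"
    by (intro continuous_L2[OF \<Omega>] continuous_gradient f)
  have S_op: "open ?S" by (rule open_graph_strip[OF \<gamma>])
  have ind_meas: "(indicator ?S :: pt \<Rightarrow> real) \<in> borel_measurable ?M"
    using S_op by (intro measurable_restrict_space1 borel_measurable_indicator) simp
  have ind: "(indicator ?S :: pt \<Rightarrow> real) \<in> L2 ?M"
    by (rule L2_bound[OF one ind_meas]) (auto simp: indicator_def)
  have "(\<integral>\<^sup>+x\<in>?S. ennreal (infdist (f x) A) \<partial>lborel) \<le> ennreal (\<integral>x. norm (f x - u x) * norm (1::real) \<partial>?M)"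
  proof (rule set_nn_integral_le_lebesgue_on[OF sub \<Omega>(2) L2_product_integrable[OF fu one]])
    show "AE x in ?M. ennreal (infdist (f x) A) * indicator ?S x \<le> ennreal (norm (f x - u x) * norm (1::real))"
      using uA
    proof eventually_elim
      case (elim x)
      have "infdist (f x) A \<le> norm (f x - u x)"
        using infdist_le[OF elim, of "f x"] by (simp add: dist_real_def)
      then show ?case by (auto simp: indicator_def intro: ennreal_leI)
    qed
  qed simp
  also have "\<dots> \<le> ennreal ?X" by (rule ennreal_leI[OF L2_Cauchy_Schwarz[OF fu one]])
  finally have T1: "(\<integral>\<^sup>+x\<in>?S. ennreal (infdist (f x) A) \<partial>lborel) \<le> ennreal ?X" .
  have "(\<integral>\<^sup>+x\<in>?S. ennreal (norm (gradient f x)) \<partial>lborel)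
      \<le> ennreal (\<integral>x. norm (indicator ?S x :: real) * norm (gradient f x) \<partial>?M)"
    by (rule set_nn_integral_le_lebesgue_on[OF sub \<Omega>(2) L2_product_integrable[OF ind gr]])
       (auto simp: indicator_def)
  also have "\<dots> \<le> ennreal (L2_norm ?M (indicator ?S :: pt \<Rightarrow> real) * L2_norm ?M (gradient f))"
    by (rule ennreal_leI[OF L2_Cauchy_Schwarz[OF ind gr]])
  also have "L2_norm ?M (indicator ?S :: pt \<Rightarrow> real) = sqrt (2 * a * b)"
  proof -
    have "(\<integral>x. (norm (indicator ?S x :: real))\<^sup>2 \<partial>?M) = (\<integral>x. indicator ?S x \<partial>?M)"
      by (rule Bochner_Integration.integral_cong) (auto simp: indicator_def)
    also have "\<dots> = (\<integral>x. indicator ?S x \<partial>lebesgue)"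
      using sub \<Omega>(2) by (intro integral_lebesgue_on_supported) (auto simp: indicator_def)
    also have "\<dots> = measure lebesgue ?S" using S_op by simp
    also have "\<dots> = 2 * a * b"
      using measure_graph_strip[OF e \<gamma> ab] S_op ab by (simp add: measure_def)
    finally show ?thesis by (simp add: L2_norm_def)
  qed
  finally have T2: "(\<integral>\<^sup>+x\<in>?S. ennreal (norm (gradient f x)) \<partial>lborel) \<le> ennreal ?Y" .
  have XY: "0 \<le> ?X" "0 \<le> ?Y" using L2_norm_nonneg[of ?M] ab by (auto intro!: mult_nonneg_nonneg)
  have "ennreal b * ?J \<le> ennreal ?X + ennreal b * ennreal ?Y"
    by (rule order_trans[OF graph_fiber_bound[OF f e \<gamma> ab(2)] add_mono[OF T1 mult_left_mono[OF T2]]]) simp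
  also have "\<dots> = ennreal b * ennreal (?X / b + ?Y)"
    using XY ab by (simp add: ennreal_mult[symmetric] ennreal_plus[symmetric] distrib_left del: ennreal_plus)
  finally show ?thesis
    using ab(2) by (subst (asm) ennreal_mult_le_mult_iff) auto
qed

text \<open>First make the strip so thin that the gradient term is small for all \<open>n\<close> at once, then let \<open>n\<close>
  tend to infinity.\<close>

lemma graph_infdist_tendsto:
  fixes \<phi> :: "nat \<Rightarrow> pt \<Rightarrow> real" and A :: "real set"
  assumes \<Omega>: "bounded \<Omega>" "open \<Omega>" and \<phi>: "\<And>n. C_infinity (\<phi> n)" and u: "u \<in> H1 \<Omega>"
    and uA: "AE x in lebesgue_on \<Omega>. u x \<in> A"
    and lim: "(\<lambda>n. H1_norm \<Omega> (\<lambda>x. \<phi> n x - u x)) \<longlonglongrightarrow> 0"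
    and e: "norm e1 = 1" "norm e2 = 1" "e1 \<bullet> e2 = 0"
    and \<gamma>: "continuous_on UNIV \<gamma>" and a: "a > 0"
    and sub: "graph_strip p e1 e2 \<gamma> a a \<subseteq> \<Omega>"
  defines "F \<equiv> \<lambda>s. p + s *\<^sub>R e1 + \<gamma> s *\<^sub>R e2"
  shows "integrable lborel (\<lambda>s. infdist (\<phi> n (F s)) A * indicator {-a<..<a} s)"
    and "(\<lambda>n. \<integral>s. infdist (\<phi> n (F s)) A * indicator {-a<..<a} s \<partial>lborel) \<longlonglongrightarrow> 0"
proof -
  let ?M = "lebesgue_on \<Omega>"
  define j where "j n s = infdist (\<phi> n (F s)) A * indicator {-a<..<a} s" for n s
  have contF: "continuous_on UNIV F"
    unfolding F_def by (intro continuous_intros \<gamma>)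
  have cont: "continuous_on UNIV (\<lambda>s. infdist (\<phi> n (F s)) A)" for n
    by (intro continuous_on_infdist continuous_on_compose2[OF C_infinity_continuous[OF \<phi>, of UNIV] contF]) simp
  have meas: "j n \<in> borel_measurable borel" for n
    unfolding j_def[abs_def] using borel_measurable_continuous_onI[OF cont[of n]] by measurable
  have nonneg: "0 \<le> j n s" for n s
    by (simp add: j_def infdist_nonneg)
  let ?X = "\<lambda>n. L2_norm ?M (\<lambda>x. \<phi> n x - u x) * L2_norm ?M (\<lambda>x. 1::real)"
  obtain K where K: "\<And>n. \<bar>H1_norm \<Omega> (\<lambda>x. \<phi> n x - u x)\<bar> \<le> K"
    using convergent_imp_Bseq[OF convergentI[OF lim]] unfolding Bseq_def by auto
  define C where "C = K + H1_norm \<Omega> (\<lambda>x. -1 * u x) + 1"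
  have grad: "L2_norm ?M (gradient (\<phi> n)) \<le> C" for n
    using H1_norm_gradient_bound[OF \<Omega> \<phi>[of n] u] K[of n] by (simp add: C_def)
  have C: "C > 0"
    using K[of 0] H1_norm_nonneg[of \<Omega>] unfolding C_def by (smt (verit))
  have bound: "(\<integral>\<^sup>+s. ennreal (j n s) \<partial>lborel) \<le> ennreal (?X n / b + sqrt (2 * a * b) * C)"
    if b: "0 < b" "b \<le> a" for n b
  proof -
    have sub_b: "graph_strip p e1 e2 \<gamma> a b \<subseteq> \<Omega>"
      using sub b by (auto simp: graph_strip_def subset_iff)
    have "(\<integral>\<^sup>+s. ennreal (j n s) \<partial>lborel) = (\<integral>\<^sup>+s\<in>{-a<..<a}. ennreal (infdist (\<phi> n (F s)) A) \<partial>lborel)"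
      by (rule nn_integral_cong) (auto simp: j_def indicator_def)
    also have "\<dots> \<le> ennreal (?X n / b + sqrt (2 * a * b) * L2_norm ?M (gradient (\<phi> n)))"
      unfolding F_def by (rule graph_infdist_bound[OF \<Omega> \<phi> H1_D(1)[OF \<Omega>(2) u] uA e \<gamma> a b(1) sub_b])
    also have "\<dots> \<le> ennreal (?X n / b + sqrt (2 * a * b) * C)"
      using grad a b by (intro ennreal_leI add_left_mono mult_left_mono) auto
    finally show ?thesis .
  qed
  have int: "integrable lborel (j n)" for n
    using bound[OF a order_refl, of n] meas nonneg
    by (intro integrableI_nonneg) (auto intro: order_le_less_trans)
  then show "integrable lborel (\<lambda>s. infdist (\<phi> n (F s)) A * indicator {-a<..<a} s)"
    by (simp add: j_def[abs_def])
  have real_bound: "(\<integral>s. j n s \<partial>lborel) \<le> ?X n / b + sqrt (2 * a * b) * C" if b: "0 < b" "b \<le> a" for n b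
  proof -
    have "ennreal (\<integral>s. j n s \<partial>lborel) \<le> ennreal (?X n / b + sqrt (2 * a * b) * C)"
      using bound[OF b, of n] nn_integral_eq_integral[OF int[of n]] nonneg by simp
    moreover have "0 \<le> ?X n / b + sqrt (2 * a * b) * C"
      using L2_norm_nonneg[of ?M] C a b by (intro add_nonneg_nonneg divide_nonneg_pos mult_nonneg_nonneg) auto
    ultimately show ?thesis by (simp add: ennreal_le_iff)
  qed
  have X0: "?X \<longlonglongrightarrow> 0"
  proof -
    have "(\<lambda>n. L2_norm ?M (\<lambda>x. \<phi> n x - u x)) \<longlonglongrightarrow> 0"
      by (rule tendsto_sandwich[OF _ _ tendsto_const lim])
         (auto intro!: always_eventually simp: L2_norm_nonneg L2_norm_le_H1_norm(1))
    from tendsto_mult_right[OF this, of "L2_norm ?M (\<lambda>x. 1::real)"] show ?thesis by simp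
  qed
  have "(\<lambda>n. \<integral>s. j n s \<partial>lborel) \<longlonglongrightarrow> 0"
  proof (rule LIMSEQ_I)
    fix r :: real assume r: "0 < r"
    \<comment> \<open>Chosen to make the gradient term \<open>sqrt (2 a b) C\<close> at most \<open>r / 2\<close>.\<close>
    define b where "b = min a ((r / (2 * C))\<^sup>2 / (2 * a))"
    have b: "0 < b" "b \<le> a" using a C r by (auto simp: b_def)
    have "2 * a * b \<le> 2 * a * ((r / (2 * C))\<^sup>2 / (2 * a))"
      using a by (intro mult_left_mono) (auto simp: b_def)
    also have "\<dots> = (r / (2 * C))\<^sup>2" using a by simp
    finally have "sqrt (2 * a * b) \<le> sqrt ((r / (2 * C))\<^sup>2)" by (rule real_sqrt_le_mono)
    then have "sqrt (2 * a * b) \<le> r / (2 * C)" using r C by simp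
    then have sq: "sqrt (2 * a * b) * C \<le> r / 2" using C by (simp add: field_simps)
    have "\<forall>\<^sub>F n in sequentially. ?X n < r / 2 * b"
      using X0 r b by (intro order_tendstoD(2)) auto
    then obtain N where N: "\<And>n. n \<ge> N \<Longrightarrow> ?X n < r / 2 * b"
      unfolding eventually_sequentially by blast
    show "\<exists>N. \<forall>n\<ge>N. norm ((\<integral>s. j n s \<partial>lborel) - 0) < r"
    proof (intro exI allI impI)
      fix n assume "n \<ge> N"
      then have "?X n / b < r / 2" using N b by (simp add: divide_less_eq)
      then have "(\<integral>s. j n s \<partial>lborel) < r" using real_bound[OF b, of n] sq by linarith
      moreover have "0 \<le> (\<integral>s. j n s \<partial>lborel)" by (rule Bochner_Integration.integral_nonneg) (rule nonneg)
      ultimately show "norm ((\<integral>s. j n s \<partial>lborel) - 0) < r" by simp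
    qed
  qed
  then show "(\<lambda>n. \<integral>s. infdist (\<phi> n (F s)) A * indicator {-a<..<a} s \<partial>lborel) \<longlonglongrightarrow> 0"
    by (simp add: j_def[abs_def])
qed

text \<open>Smooth approximations \<open>\<phi>\<^sub>n\<close> of \<open>u\<close> converge to \<open>\<tau>\<close> on the boundary, and by \<open>graph_infdist_tendsto\<close>
  their distance from \<open>A\<close> on a boundary chart tends to zero in the mean with respect to the chart
  parameter. Along a subsequence both hold pointwise outside null sets. The two notions of null set
  are compatible: the chart is Lipschitz, so it maps null sets of parameters to null sets of the
  surface measure.\<close>

lemma trace_AE_mem:
  fixes A :: "real set"
  assumes \<Omega>: "bounded \<Omega>" "lipschitz_domain \<Omega>" and tr: "has_trace \<Omega> u \<tau>"
    and A: "closed A" "A \<noteq> {}" and uA: "AE x in lebesgue_on \<Omega>. u x \<in> A"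
  shows "AE x in surface_on (frontier \<Omega>). \<tau> x \<in> A"
proof -
  let ?\<sigma> = "surface_on (frontier \<Omega>)"
  have op: "open \<Omega>" using \<Omega>(2) by (simp add: lipschitz_domain_def)
  note tr' = tr[unfolded has_trace_def fun_diff_def]
  have u: "u \<in> H1 \<Omega>" and \<tau>: "\<tau> \<in> L2 ?\<sigma>" using tr' by simp_all
  from conjunct2[OF conjunct2[OF tr']] obtain \<phi> :: "nat \<Rightarrow> pt \<Rightarrow> real" where
    "(\<forall>n. C_infinity (\<phi> n)) \<and> (\<lambda>n. H1_norm \<Omega> (\<lambda>x. \<phi> n x - u x)) \<longlonglongrightarrow> 0 \<and>
      (\<lambda>n. L2_norm ?\<sigma> (\<lambda>x. \<phi> n x - \<tau> x)) \<longlonglongrightarrow> 0" by (rule exE)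
  then have \<phi>: "\<And>n. C_infinity (\<phi> n)"
    and limH: "(\<lambda>n. H1_norm \<Omega> (\<lambda>x. \<phi> n x - u x)) \<longlonglongrightarrow> 0"
    and limS: "(\<lambda>n. L2_norm ?\<sigma> (\<lambda>x. \<phi> n x - \<tau> x)) \<longlonglongrightarrow> 0"
    by simp_all
  have front: "frontier \<Omega> \<in> sets surface_measure" "compact (frontier \<Omega>)"
    using \<Omega>(1) by (auto intro!: sets_surface_measure_borel borel_closed compact_frontier_bounded)
  interpret complete_measure ?\<sigma>
    by (rule complete_surface_on) (auto intro: borel_closed)
  have fin: "emeasure ?\<sigma> (space ?\<sigma>) < \<infinity>"
    using emeasure_frontier_finite[OF \<Omega>] front by (simp add: emeasure_restrict_space space_restrict_space)
  have \<phi>L2: "\<phi> n \<in> L2 ?\<sigma>" for n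
  proof -
    have "bounded (\<phi> n ` frontier \<Omega>)"
      by (intro compact_imp_bounded compact_continuous_image C_infinity_continuous \<phi> front)
    then obtain K where K: "\<And>x. x \<in> frontier \<Omega> \<Longrightarrow> norm (\<phi> n x) \<le> K" unfolding bounded_iff by auto
    show ?thesis
    proof (rule L2_bound[OF L2_const[OF fin, of K]])
      have "\<phi> n \<in> borel_measurable borel"
        by (intro borel_measurable_continuous_onI C_infinity_continuous \<phi>)
      then have "\<phi> n \<in> borel_measurable surface_measure"
        using sets_surface_measure_borel by (auto simp: measurable_def space_surface_measure)
      then show "\<phi> n \<in> borel_measurable ?\<sigma>" by (rule measurable_restrict_space1)
      show "AE x in ?\<sigma>. norm (\<phi> n x) \<le> norm K"
        using K by (intro AE_I2) (force simp: space_restrict_space)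
    qed
  qed
  have "(\<lambda>n. (L2_norm ?\<sigma> (\<lambda>x. \<phi> n x - \<tau> x))\<^sup>2) \<longlonglongrightarrow> 0\<^sup>2"
    by (intro tendsto_power limS)
  then have "(\<lambda>n. \<integral>x. norm ((norm (\<phi> n x - \<tau> x))\<^sup>2) \<partial>?\<sigma>) \<longlonglongrightarrow> 0"
    by (simp add: L2_norm_power2)
  from tendsto_L1_AE_subseq[OF L2_D(2)[OF L2_diff[OF \<phi>L2 \<tau>]] this]
  obtain r1 where r1: "strict_mono r1" "AE x in ?\<sigma>. (\<lambda>n. (norm (\<phi> (r1 n) x - \<tau> x))\<^sup>2) \<longlonglongrightarrow> 0"
    by (elim exE conjE)
  have conv: "AE x in ?\<sigma>. (\<lambda>n. \<phi> (r1 n) x) \<longlonglongrightarrow> \<tau> x"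
    using r1(2)
  proof eventually_elim
    case (elim x)
    from tendsto_real_sqrt[OF elim] have "(\<lambda>n. \<bar>\<phi> (r1 n) x - \<tau> x\<bar>) \<longlonglongrightarrow> 0" by simp
    then show ?case by (simp add: LIM_zero_iff tendsto_rabs_zero_iff)
  qed
  have limH1: "(\<lambda>n. H1_norm \<Omega> (\<lambda>x. \<phi> (r1 n) x - u x)) \<longlonglongrightarrow> 0"
    using LIMSEQ_subseq_LIMSEQ[OF limH r1(1)] by (simp add: o_def)
  have local: "\<exists>a>0. AE x in ?\<sigma>. x \<in> ball p a \<longrightarrow> \<tau> x \<in> A" if p: "p \<in> frontier \<Omega>" for p
  proof -
    obtain e1 e2 :: pt and \<gamma> a L where e: "norm e1 = 1" "norm e2 = 1" "e1 \<bullet> e2 = 0"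
      and lip: "L-lipschitz_on UNIV \<gamma>" and a: "a > 0"
      and ins: "\<And>s y. \<bar>s\<bar> < a \<Longrightarrow> 0 < y \<Longrightarrow> y < a \<Longrightarrow> p + s *\<^sub>R e1 + (\<gamma> s + y) *\<^sub>R e2 \<in> \<Omega>"
      and fr: "\<And>x. x \<in> frontier \<Omega> \<Longrightarrow> x \<in> ball p a \<Longrightarrow>
         \<bar>(x - p) \<bullet> e1\<bar> < a \<and> x = p + ((x - p) \<bullet> e1) *\<^sub>R e1 + \<gamma> ((x - p) \<bullet> e1) *\<^sub>R e2"
      by (rule lipschitz_chart[OF \<Omega>(2) p]) blast
    have \<gamma>: "continuous_on UNIV \<gamma>" using lip by (rule lipschitz_on_continuous_on)
    have sub: "graph_strip p e1 e2 \<gamma> a a \<subseteq> \<Omega>"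
    proof
      fix x assume x: "x \<in> graph_strip p e1 e2 \<gamma> a a"
      let ?s = "(x - p) \<bullet> e1"
      have "p + ?s *\<^sub>R e1 + (\<gamma> ?s + ((x - p) \<bullet> e2 - \<gamma> ?s)) *\<^sub>R e2 \<in> \<Omega>"
        by (rule ins) (use x in \<open>auto simp: graph_strip_def\<close>)
      moreover have "p + ?s *\<^sub>R e1 + (\<gamma> ?s + ((x - p) \<bullet> e2 - \<gamma> ?s)) *\<^sub>R e2 = x"
        using frame_representation[OF e, of "x - p"] by (simp add: algebra_simps)
      ultimately show "x \<in> \<Omega>" by simp
    qed
    define F where "F s = p + s *\<^sub>R e1 + \<gamma> s *\<^sub>R e2" for s
    note lim = graph_infdist_tendsto[OF \<Omega>(1) op \<phi> u uA limH1 e \<gamma> a sub, folded F_def]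
    have "(\<lambda>n. \<integral>s. norm (infdist (\<phi> (r1 n) (F s)) A * indicator {-a<..<a} s) \<partial>lborel) \<longlonglongrightarrow> 0"
      using lim(2) by (simp add: infdist_nonneg)
    from tendsto_L1_AE_subseq[OF lim(1) this] obtain r2 where r2: "strict_mono r2"
      "AE s in lborel. (\<lambda>n. infdist (\<phi> (r1 (r2 n)) (F s)) A * indicator {-a<..<a} s) \<longlonglongrightarrow> 0"
      by (elim exE conjE)
    from r2(2) obtain Z where Z: "Z \<in> null_sets lborel"
      "{s \<in> space lborel. \<not> (\<lambda>n. infdist (\<phi> (r1 (r2 n)) (F s)) A * indicator {-a<..<a} s) \<longlonglongrightarrow> 0} \<subseteq> Z"
      unfolding eventually_ae_filter by (elim bexE)
    \<comment> \<open>The boundary points whose parameter belongs to the exceptional null set.\<close>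
    define B where "B = {x. x = p + ((x - p) \<bullet> e1) *\<^sub>R e1 + \<gamma> ((x - p) \<bullet> e1) *\<^sub>R e2 \<and> (x - p) \<bullet> e1 \<in> Z}"
    have "hausdorff_outer B = 0"
      by (rule hausdorff_outer_lipschitz_null[OF graph_map_lipschitz[OF e(1,2) lip] Z(1)])
         (unfold B_def, blast)
    moreover have B_borel: "B \<in> sets borel"
    proof -
      have "closed {x. x = p + ((x - p) \<bullet> e1) *\<^sub>R e1 + \<gamma> ((x - p) \<bullet> e1) *\<^sub>R e2}"
        by (intro closed_Collect_eq continuous_intros continuous_on_compose2[OF \<gamma>]) auto
      moreover have "{x. (x - p) \<bullet> e1 \<in> Z} \<in> sets borel"
      proof -
        have "(\<lambda>x. (x - p) \<bullet> e1) \<in> borel_measurable borel"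
          by (intro borel_measurable_continuous_onI continuous_intros)
        moreover have "Z \<in> sets borel" using Z(1) by (simp add: null_sets_def)
        ultimately show ?thesis using measurable_sets[of "\<lambda>x. (x - p) \<bullet> e1" borel borel Z] by (simp add: vimage_def)
      qed
      ultimately show ?thesis unfolding B_def Collect_conj_eq by (rule sets.Int[OF borel_closed])
    qed
    ultimately have "emeasure surface_measure B = 0"
      using emeasure_surface_measure_le[OF B_borel] by simp
    then have "B \<in> null_sets surface_measure"
      using sets_surface_measure_borel[OF B_borel] by (simp add: null_sets_def)
    then have "AE x in surface_measure. x \<notin> B" by (rule AE_not_in)
    then have "AE x in surface_measure. x \<in> frontier \<Omega> \<longrightarrow> x \<notin> B" by eventually_elim simp
    then have "AE x in ?\<sigma>. x \<notin> B"
      using front(1) by (simp add: AE_restrict_space_iff space_surface_measure)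
    moreover have "AE x in ?\<sigma>. x \<in> frontier \<Omega>"
      by (intro AE_I2) (simp add: space_restrict_space)
    ultimately have "AE x in ?\<sigma>. x \<in> ball p a \<longrightarrow> \<tau> x \<in> A"
      using conv
    proof eventually_elim
      case (elim x)
      show ?case
      proof
        assume xa: "x \<in> ball p a"
        let ?s = "(x - p) \<bullet> e1"
        have x: "\<bar>?s\<bar> < a" "x = F ?s" using fr[OF elim(2) xa] unfolding F_def by blast+
        then have "?s \<notin> Z" using elim(1) unfolding B_def F_def by blast
        then have "(\<lambda>n. infdist (\<phi> (r1 (r2 n)) (F ?s)) A * indicator {-a<..<a} ?s) \<longlonglongrightarrow> 0"
          using Z(2) by (simp add: subset_iff) blast
        moreover have "?s \<in> {-a<..<a}" using x(1) by auto
        ultimately have "(\<lambda>n. infdist (\<phi> (r1 (r2 n)) x) A) \<longlonglongrightarrow> 0"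
          unfolding x(2)[symmetric] by simp
        moreover have "(\<lambda>n. infdist (\<phi> (r1 (r2 n)) x) A) \<longlonglongrightarrow> infdist (\<tau> x) A"
          using LIMSEQ_subseq_LIMSEQ[OF elim(3) r2(1)] by (intro tendsto_infdist) (simp add: o_def)
        ultimately have "infdist (\<tau> x) A = 0" using LIMSEQ_unique by blast
        then show "\<tau> x \<in> A" using in_closed_iff_infdist_zero[OF A] by simp
      qed
    qed
    then show ?thesis using a by blast
  qed
  then have "\<forall>p\<in>frontier \<Omega>. \<exists>a. a > 0 \<and> (AE x in ?\<sigma>. x \<in> ball p a \<longrightarrow> \<tau> x \<in> A)"
    by (rule ballI)
  from bchoice[OF this] obtain a where
    a: "\<forall>p\<in>frontier \<Omega>. a p > 0 \<and> (AE x in ?\<sigma>. x \<in> ball p (a p) \<longrightarrow> \<tau> x \<in> A)" by (rule exE)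
  obtain D where D: "D \<subseteq> frontier \<Omega>" "finite D" "frontier \<Omega> \<subseteq> (\<Union>p\<in>D. ball p (a p))"
    using front(2) by (rule compactE_image[of _ "frontier \<Omega>" "\<lambda>p. ball p (a p)"]) (use a in \<open>auto intro!: bexI\<close>)
  have "AE x in ?\<sigma>. \<forall>p\<in>D. x \<in> ball p (a p) \<longrightarrow> \<tau> x \<in> A"
    by (rule AE_finite_allI[OF D(2)]) (rule conjunct2[OF bspec[OF a subsetD[OF D(1)]]])
  moreover have "AE x in ?\<sigma>. x \<in> frontier \<Omega>"
    by (intro AE_I2) (simp add: space_restrict_space)
  ultimately show ?thesis
    by eventually_elim (use D(3) in blast)
qed

section \<open>Almost everywhere limits and slices\<close>

lemma (in complete_measure) borel_measurable_AE_LIMSEQ: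
  fixes f :: "nat \<Rightarrow> 'a \<Rightarrow> real"
  assumes "\<And>n. f n \<in> borel_measurable M" "AE x in M. (\<lambda>n. f n x) \<longlonglongrightarrow> g x"
  shows "g \<in> borel_measurable M"
proof (rule borel_measurable_AE_eq)
  show "(\<lambda>x. lim (\<lambda>n. f n x)) \<in> borel_measurable M"
    by (rule borel_measurable_lim_metric[OF assms(1)])
  show "AE x in M. lim (\<lambda>n. f n x) = g x"
    using assms(2) by eventually_elim (rule limI)
qed

text \<open>Round \<open>g\<close> down to multiples of \<open>1 / (n + 1)\<close>. Functions with countably many values can be inserted
  into \<open>f\<close> without harming measurability; continuity of \<open>f\<close> in \<open>r\<close> gives the limit.\<close>

lemma (in complete_measure) caratheodory_measurable:
  fixes f :: "'a \<Rightarrow> real \<Rightarrow> real"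
  assumes f: "\<And>r. (\<lambda>x. f x r) \<in> borel_measurable M" and cont: "AE x in M. continuous_on UNIV (f x)"
    and g: "g \<in> borel_measurable M"
  shows "(\<lambda>x. f x (g x)) \<in> borel_measurable M"
proof (rule borel_measurable_AE_LIMSEQ)
  define d where "d n x = real_of_int \<lfloor>real (Suc n) * g x\<rfloor> / real (Suc n)" for n x
  show "(\<lambda>x. f x (d n x)) \<in> borel_measurable M" for n
  proof -
    have "(\<lambda>x. \<lfloor>real (Suc n) * g x\<rfloor>) \<in> measurable M (count_space UNIV)"
      using g by measurable
    from measurable_compose_countable[of "\<lambda>i x. f x (real_of_int i / real (Suc n))", OF f this]
    show ?thesis by (simp add: d_def)
  qed
  have d_lim: "(\<lambda>n. d n x) \<longlonglongrightarrow> g x" for x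
  proof (rule real_tendsto_sandwich)
    show "\<forall>\<^sub>F n in sequentially. g x - inverse (real (Suc n)) \<le> d n x"
    proof (intro always_eventually allI)
      fix n
      have "real (Suc n) * g x - 1 \<le> real_of_int \<lfloor>real (Suc n) * g x\<rfloor>" by linarith
      then have "(real (Suc n) * g x - 1) / real (Suc n) \<le> d n x"
        unfolding d_def by (rule divide_right_mono) simp
      then show "g x - inverse (real (Suc n)) \<le> d n x"
        by (simp add: diff_divide_distrib inverse_eq_divide del: of_nat_Suc)
    qed
    show "\<forall>\<^sub>F n in sequentially. d n x \<le> g x"
    proof (intro always_eventually allI)
      fix n
      have "d n x \<le> (real (Suc n) * g x) / real (Suc n)"
        unfolding d_def by (rule divide_right_mono) simp_all
      then show "d n x \<le> g x" by (simp del: of_nat_Suc)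
    qed
    have "(\<lambda>n. g x - inverse (real (Suc n))) \<longlonglongrightarrow> g x - 0"
      by (intro tendsto_intros LIMSEQ_inverse_real_of_nat)
    then show "(\<lambda>n. g x - inverse (real (Suc n))) \<longlonglongrightarrow> g x" by simp
  qed simp
  show "AE x in M. (\<lambda>n. f x (d n x)) \<longlonglongrightarrow> f x (g x)"
    using cont
  proof eventually_elim
    case (elim x)
    show ?case by (rule continuous_on_tendsto_compose[OF elim d_lim]) auto
  qed
qed

lemma AE_time_slices:
  fixes \<Omega> :: "pt set"
  assumes \<Omega>: "open \<Omega>" and P: "AE (x, t) in lebesgue_on (\<Omega> \<times> {0<..<T}). P x t"
  shows "AE t in time T. AE x in lebesgue_on \<Omega>. P x t"
proof -
  have "open (\<Omega> \<times> {0<..<T})" by (intro open_Times \<Omega>) simp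
  then have m: "\<Omega> \<times> {0<..<T} \<in> sets lebesgue" by simp
  from P have "AE z in lebesgue. z \<in> \<Omega> \<times> {0<..<T} \<longrightarrow> P (fst z) (snd z)"
    using m by (simp add: AE_restrict_space_iff case_prod_beta)
  then have "AE z in (lborel :: pt measure) \<Otimes>\<^sub>M (lborel :: real measure). z \<in> \<Omega> \<times> {0<..<T} \<longrightarrow> P (fst z) (snd z)"
    by (simp only: AE_completion_iff lborel_prod)
  then obtain N where N: "N \<in> null_sets ((lborel :: pt measure) \<Otimes>\<^sub>M (lborel :: real measure))"
    "{z \<in> space ((lborel :: pt measure) \<Otimes>\<^sub>M (lborel :: real measure)). \<not> (z \<in> \<Omega> \<times> {0<..<T} \<longrightarrow> P (fst z) (snd z))}
        \<subseteq> N"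
    unfolding eventually_ae_filter by blast
  have "AE x in lborel. AE t in lborel. (x, t) \<notin> N"
    by (rule lborel_pair.AE_pair[OF AE_not_in[OF N(1)]])
  moreover have "{z \<in> space (lborel \<Otimes>\<^sub>M lborel). (fst z, snd z) \<notin> N} \<in> sets (lborel \<Otimes>\<^sub>M lborel)"
  proof -
    have "{z \<in> space ((lborel :: pt measure) \<Otimes>\<^sub>M (lborel :: real measure)). (fst z, snd z) \<notin> N}
        = space (lborel \<Otimes>\<^sub>M lborel) - N" by auto
    then show ?thesis using N(1) by (simp only: null_sets_def sets.compl_sets mem_Collect_eq)
  qed
  ultimately have "AE t in lborel. AE x in lborel. (x, t) \<notin> N"
    using lborel_pair.AE_commute[of "\<lambda>x t. (x, t) \<notin> N"] by blast
  then have "AE t in lebesgue. AE x in lborel. (x, t) \<notin> N"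
    by (rule AE_completion)
  then have "AE t in lebesgue. t \<in> {0<..<T} \<longrightarrow> (AE x in lebesgue_on \<Omega>. P x t)"
  proof eventually_elim
    case (elim t)
    show ?case
    proof
      assume t: "t \<in> {0<..<T}"
      have "AE x in lebesgue. (x, t) \<notin> N" using elim by (rule AE_completion)
      then have "AE x in lebesgue. x \<in> \<Omega> \<longrightarrow> P x t"
      proof eventually_elim
        case (elim x)
        show ?case
        proof (rule impI, rule ccontr)
          assume "x \<in> \<Omega>" "\<not> P x t"
          then have "(x, t) \<in> N" using t by (intro subsetD[OF N(2)]) (simp add: space_pair_measure)
          with elim show False by simp
        qed
      qed
      then show "AE x in lebesgue_on \<Omega>. P x t" using \<Omega> by (simp add: AE_restrict_space_iff)
    qed
  qed
  then show ?thesis by (simp add: AE_restrict_space_iff)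
qed

lemma complete_time: "complete_measure (time T)"
  by (rule complete_lebesgue_on) simp

lemma iterated_integrable_AE_eq:
  assumes M: "complete_measure M" and N: "complete_measure N"
    and eq: "AE t in M. AE x in N. f t x = k t x" and f: "iterated_integrable M N f"
  shows "iterated_integrable M N k"
proof -
  interpret M: complete_measure M by fact
  interpret N: complete_measure N by fact
  have f1: "AE t in M. integrable N (f t)" and f2: "integrable M (\<lambda>t. \<integral>x. f t x \<partial>N)"
    and f3: "integrable M (\<lambda>t. \<integral>x. \<bar>f t x\<bar> \<partial>N)"
    using f by (simp_all add: iterated_integrable_def)
  have "AE t in M. integrable N (k t)"
    using eq f1 by eventually_elim (simp add: N.integrable_AE_eq_iff)
  moreover have "AE t in M. (\<integral>x. f t x \<partial>N) = (\<integral>x. k t x \<partial>N)"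
    using eq by eventually_elim (rule N.integral_AE_eq)
  from M.integrable_AE_eq_iff[OF this, THEN iffD1, OF f2]
  have "integrable M (\<lambda>t. \<integral>x. k t x \<partial>N)" .
  moreover have "AE t in M. (\<integral>x. \<bar>f t x\<bar> \<partial>N) = (\<integral>x. \<bar>k t x\<bar> \<partial>N)"
    using eq
  proof eventually_elim
    case (elim t)
    have "AE x in N. \<bar>f t x\<bar> = \<bar>k t x\<bar>" using elim by eventually_elim simp
    then show ?case by (rule N.integral_AE_eq)
  qed
  from M.integrable_AE_eq_iff[OF this, THEN iffD1, OF f3]
  have "integrable M (\<lambda>t. \<integral>x. \<bar>k t x\<bar> \<partial>N)" .
  ultimately show ?thesis by (simp add: iterated_integrable_def)
qed

lemma iterated_integral_AE_eq:
  fixes f k :: "'a \<Rightarrow> 'b \<Rightarrow> real"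
  assumes M: "complete_measure M" and N: "complete_measure N"
    and eq: "AE t in M. AE x in N. f t x = k t x"
  shows "(\<integral>t. (\<integral>x. f t x * \<psi> t \<partial>N) \<partial>M) = (\<integral>t. (\<integral>x. k t x * \<psi> t \<partial>N) \<partial>M)"
proof -
  interpret M: complete_measure M by fact
  interpret N: complete_measure N by fact
  have "AE t in M. (\<integral>x. f t x * \<psi> t \<partial>N) = (\<integral>x. k t x * \<psi> t \<partial>N)"
    using eq
  proof eventually_elim
    case (elim t)
    have "AE x in N. f t x * \<psi> t = k t x * \<psi> t" using elim by eventually_elim simp
    then show ?case by (rule N.integral_AE_eq)
  qed
  then show ?thesis by (rule M.integral_AE_eq)
qed

section \<open>Square-integrable curves of Sobolev functions\<close>

lemma H1_norm_minus:
  assumes \<Omega>: "open \<Omega>" and u: "u \<in> H1 \<Omega>"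
  shows "H1_norm \<Omega> (\<lambda>x. - u x) = H1_norm \<Omega> u"
proof -
  interpret complete_measure "lebesgue_on \<Omega>" using \<Omega> by (intro complete_lebesgue_on) simp
  have "AE x in lebesgue_on \<Omega>. weak_gradient \<Omega> (\<lambda>x. - u x) x = - weak_gradient \<Omega> u x"
    using H1_lincomb(2)[OF \<Omega> u u, of "-1" 0] by simp
  from L2_norm_AE_eq[OF this] show ?thesis
    by (simp add: H1_norm_def L2_norm_minus)
qed

lemma H1_norm_diff_le:
  assumes \<Omega>: "open \<Omega>" and u: "u \<in> H1 \<Omega>" and w: "w \<in> H1 \<Omega>"
  shows "\<bar>H1_norm \<Omega> u - H1_norm \<Omega> w\<bar> \<le> H1_norm \<Omega> (\<lambda>x. u x - w x)"
proof -
  have uw: "(\<lambda>x. u x - w x) \<in> H1 \<Omega>" "(\<lambda>x. w x - u x) \<in> H1 \<Omega>"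
    by (rule H1_diff[OF \<Omega> u w] H1_diff[OF \<Omega> w u])+
  have mw: "(\<lambda>x. - w x) \<in> H1 \<Omega>" "(\<lambda>x. - u x) \<in> H1 \<Omega>"
    using H1_cmult[OF \<Omega> w, of "-1"] H1_cmult[OF \<Omega> u, of "-1"] by simp_all
  have 1: "H1_norm \<Omega> u \<le> H1_norm \<Omega> (\<lambda>x. u x - w x) + H1_norm \<Omega> w"
    using H1_norm_triangle_diff[OF \<Omega> uw(1) mw(1)] by (simp add: H1_norm_minus[OF \<Omega> w])
  have 2: "H1_norm \<Omega> w \<le> H1_norm \<Omega> (\<lambda>x. w x - u x) + H1_norm \<Omega> u"
    using H1_norm_triangle_diff[OF \<Omega> uw(2) mw(2)] by (simp add: H1_norm_minus[OF \<Omega> u])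
  have "H1_norm \<Omega> (\<lambda>x. w x - u x) = H1_norm \<Omega> (\<lambda>x. u x - w x)"
    using H1_norm_minus[OF \<Omega> uw(1)] by simp
  with 1 2 show ?thesis by linarith
qed

lemma H1_norm_measurable:
  assumes \<Omega>: "open \<Omega>" and f: "strongly_measurable T (H1 \<Omega>) (H1_norm \<Omega>) f"
  shows "(\<lambda>t. H1_norm \<Omega> (f t)) \<in> borel_measurable (time T)"
proof -
  interpret complete_measure "time T" by (rule complete_time)
  note sm' = f[unfolded strongly_measurable_def]
  have s1: "AE t in time T. f t \<in> H1 \<Omega>" by (rule conjunct1[OF sm'])
  from conjunct2[OF sm'] obtain s where
    s: "(\<forall>n::nat. simple_function (time T) (s n) \<and> (\<forall>t\<in>{0<..<T}. s n t \<in> H1 \<Omega>)) \<and>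
          (AE t in time T. (\<lambda>n. H1_norm \<Omega> (s n t - f t)) \<longlonglongrightarrow> 0)" by (rule exE)
  have s2: "simple_function (time T) (s n)" for n
    by (rule conjunct1[OF spec[OF conjunct1[OF s], of n]])
  have s3: "s n t \<in> H1 \<Omega>" if "t \<in> {0<..<T}" for n t
    by (rule bspec[OF conjunct2[OF spec[OF conjunct1[OF s], of n]] that])
  note s4 = conjunct2[OF s]
  show ?thesis
  proof (rule borel_measurable_AE_LIMSEQ)
    show "(\<lambda>t. H1_norm \<Omega> (s n t)) \<in> borel_measurable (time T)" for n
      by (rule borel_measurable_simple_function[OF simple_function_compose1[OF s2]])
    have "AE t in time T. t \<in> {0<..<T}" by (intro AE_I2) simp
    then show "AE t in time T. (\<lambda>n. H1_norm \<Omega> (s n t)) \<longlonglongrightarrow> H1_norm \<Omega> (f t)"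
      using s1 s4
    proof eventually_elim
      case (elim t)
      have "\<bar>H1_norm \<Omega> (s n t) - H1_norm \<Omega> (f t)\<bar> \<le> H1_norm \<Omega> (s n t - f t)" for n
        unfolding fun_diff_def by (rule H1_norm_diff_le[OF \<Omega> s3[OF elim(1)] elim(2)])
      then have "(\<lambda>n. H1_norm \<Omega> (s n t) - H1_norm \<Omega> (f t)) \<longlonglongrightarrow> 0"
        by (intro Lim_null_comparison[OF _ elim(3)] always_eventually) simp
      then show ?case by (simp add: LIM_zero_iff)
    qed
  qed
qed

lemma L2_inner_bound:
  assumes "u \<in> L2 (lebesgue_on \<Omega>)" "v \<in> L2 (lebesgue_on \<Omega>)"
  shows "\<bar>L2_inner \<Omega> u v\<bar> \<le> L2_norm (lebesgue_on \<Omega>) u * L2_norm (lebesgue_on \<Omega>) v"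
proof -
  have "\<bar>L2_inner \<Omega> u v\<bar> \<le> (\<integral>x. norm (u x * v x) \<partial>lebesgue_on \<Omega>)"
    unfolding L2_inner_def real_norm_def[symmetric] by (rule Bochner_Integration.integral_norm_bound)
  also have "\<dots> \<le> L2_norm (lebesgue_on \<Omega>) u * L2_norm (lebesgue_on \<Omega>) v"
    using L2_Cauchy_Schwarz[OF assms] by (simp add: abs_mult)
  finally show ?thesis .
qed

lemma L2_inner_diff:
  assumes "u \<in> L2 (lebesgue_on \<Omega>)" "w \<in> L2 (lebesgue_on \<Omega>)" "v \<in> L2 (lebesgue_on \<Omega>)"
  shows "L2_inner \<Omega> (\<lambda>x. u x - w x) v = L2_inner \<Omega> u v - L2_inner \<Omega> w v"
  unfolding L2_inner_def using L2_mult_integrable[OF assms(1,3)] L2_mult_integrable[OF assms(2,3)]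
  by (simp add: left_diff_distrib)

lemma L2_inner_AE_eq:
  assumes "open \<Omega>" "AE x in lebesgue_on \<Omega>. u x = w x"
  shows "L2_inner \<Omega> u v = L2_inner \<Omega> w v"
proof -
  interpret complete_measure "lebesgue_on \<Omega>" using assms(1) by (intro complete_lebesgue_on) simp
  have "AE x in lebesgue_on \<Omega>. u x * v x = w x * v x" using assms(2) by eventually_elim simp
  then show ?thesis unfolding L2_inner_def by (rule integral_AE_eq)
qed

lemma time_finite: "emeasure (time T) (space (time T)) < \<infinity>"
  using emeasure_bounded_finite[OF bounded_box[of 0 T]] by (simp add: emeasure_restrict_space box_real)

lemma finite_measure_time: "finite_measure (time T)"
  by (rule finite_measureI) (use time_finite[of T] in simp)

text \<open>Measurability is inherited from the approximating simple functions, because \<open>u \<mapsto> (u, v)\<close> is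
  Lipschitz in the norm of \<open>H1\<close>.\<close>

lemma L2_inner_integrable:
  assumes \<Omega>: "open \<Omega>" and f: "f \<in> bochner_L2 T (H1 \<Omega>) (H1_norm \<Omega>)" and v: "v \<in> L2 (lebesgue_on \<Omega>)"
  shows "integrable (time T) (\<lambda>t. L2_inner \<Omega> (f t) v)"
proof -
  interpret complete_measure "time T" by (rule complete_time)
  let ?V = "L2_norm (lebesgue_on \<Omega>) v"
  have sm: "strongly_measurable T (H1 \<Omega>) (H1_norm \<Omega>) f" and int: "integrable (time T) (\<lambda>t. (H1_norm \<Omega> (f t))\<^sup>2)"
    using f by (simp_all add: bochner_L2_def)
  note sm' = sm[unfolded strongly_measurable_def]
  have s1: "AE t in time T. f t \<in> H1 \<Omega>" by (rule conjunct1[OF sm'])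
  from conjunct2[OF sm'] obtain s where
    s: "(\<forall>n::nat. simple_function (time T) (s n) \<and> (\<forall>t\<in>{0<..<T}. s n t \<in> H1 \<Omega>)) \<and>
          (AE t in time T. (\<lambda>n. H1_norm \<Omega> (s n t - f t)) \<longlonglongrightarrow> 0)" by (rule exE)
  have s2: "simple_function (time T) (s n)" for n
    by (rule conjunct1[OF spec[OF conjunct1[OF s], of n]])
  have s3: "s n t \<in> H1 \<Omega>" if "t \<in> {0<..<T}" for n t
    by (rule bspec[OF conjunct2[OF spec[OF conjunct1[OF s], of n]] that])
  note s4 = conjunct2[OF s]
  have le: "\<bar>L2_inner \<Omega> u v\<bar> \<le> H1_norm \<Omega> u * ?V" if "u \<in> H1 \<Omega>" for u
    by (rule order_trans[OF L2_inner_bound[OF H1_D(1)[OF \<Omega> that] v]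
        mult_right_mono[OF L2_norm_le_H1_norm(1) L2_norm_nonneg]])
  have meas: "(\<lambda>t. L2_inner \<Omega> (f t) v) \<in> borel_measurable (time T)"
  proof (rule borel_measurable_AE_LIMSEQ)
    show "(\<lambda>t. L2_inner \<Omega> (s n t) v) \<in> borel_measurable (time T)" for n
      by (rule borel_measurable_simple_function[OF simple_function_compose1[OF s2]])
    have "AE t in time T. t \<in> {0<..<T}" by (intro AE_I2) simp
    then show "AE t in time T. (\<lambda>n. L2_inner \<Omega> (s n t) v) \<longlonglongrightarrow> L2_inner \<Omega> (f t) v"
      using s1 s4
    proof eventually_elim
      case (elim t)
      have "\<bar>L2_inner \<Omega> (s n t) v - L2_inner \<Omega> (f t) v\<bar> \<le> H1_norm \<Omega> (s n t - f t) * ?V" for n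
        unfolding fun_diff_def
        using le[OF H1_diff[OF \<Omega> s3[OF elim(1)] elim(2)]]
          L2_inner_diff[OF H1_D(1)[OF \<Omega> s3[OF elim(1)]] H1_D(1)[OF \<Omega> elim(2)] v] by simp
      moreover have "(\<lambda>n. H1_norm \<Omega> (s n t - f t) * ?V) \<longlonglongrightarrow> 0"
        using tendsto_mult_right[OF elim(3), of ?V] by simp
      ultimately have "(\<lambda>n. L2_inner \<Omega> (s n t) v - L2_inner \<Omega> (f t) v) \<longlonglongrightarrow> 0"
        unfolding real_norm_def[symmetric] by (rule Lim_null_comparison[OF always_eventually[OF allI]])
      then show ?case by (simp add: LIM_zero_iff)
    qed
  qed
  show ?thesis
  proof (rule Bochner_Integration.integrable_bound[OF _ meas])
    interpret finite_measure "time T" by (rule finite_measure_time)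
    show "integrable (time T) (\<lambda>t. (1 + (H1_norm \<Omega> (f t))\<^sup>2) * ?V)"
      using int by (intro integrable_mult_left Bochner_Integration.integrable_add) auto
    show "AE t in time T. norm (L2_inner \<Omega> (f t) v) \<le> norm ((1 + (H1_norm \<Omega> (f t))\<^sup>2) * ?V)"
      using s1
    proof eventually_elim
      case (elim t)
      have "2 * 1 * H1_norm \<Omega> (f t) \<le> 1\<^sup>2 + (H1_norm \<Omega> (f t))\<^sup>2" by (rule sum_squares_bound)
      then have "H1_norm \<Omega> (f t) \<le> 1 + (H1_norm \<Omega> (f t))\<^sup>2" using H1_norm_nonneg[of \<Omega> "f t"] by simp
      then have "H1_norm \<Omega> (f t) * ?V \<le> (1 + (H1_norm \<Omega> (f t))\<^sup>2) * ?V"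
        by (intro mult_right_mono L2_norm_nonneg)
      then show ?case using le[OF elim] by simp
    qed
  qed
qed

text \<open>Subtracting \<open>c\<close> from simple functions gives simple functions with the same error, and the norm
  of \<open>H1\<close> does not see the null sets on which \<open>k t\<close> and \<open>f t - c\<close> differ.\<close>

lemma bochner_L2_H1_diff:
  assumes \<Omega>: "open \<Omega>" and f: "f \<in> bochner_L2 T (H1 \<Omega>) (H1_norm \<Omega>)" and c: "c \<in> H1 \<Omega>"
    and k: "AE t in time T. AE x in lebesgue_on \<Omega>. k t x = f t x - c x"
  shows "k \<in> bochner_L2 T (H1 \<Omega>) (H1_norm \<Omega>)"
proof -
  interpret finite_measure "time T" by (rule finite_measure_time)
  have sm: "strongly_measurable T (H1 \<Omega>) (H1_norm \<Omega>) f" and int: "integrable (time T) (\<lambda>t. (H1_norm \<Omega> (f t))\<^sup>2)"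
    using f by (simp_all add: bochner_L2_def)
  note sm' = sm[unfolded strongly_measurable_def]
  have s1: "AE t in time T. f t \<in> H1 \<Omega>" by (rule conjunct1[OF sm'])
  from conjunct2[OF sm'] obtain s where
    s: "(\<forall>n::nat. simple_function (time T) (s n) \<and> (\<forall>t\<in>{0<..<T}. s n t \<in> H1 \<Omega>)) \<and>
          (AE t in time T. (\<lambda>n. H1_norm \<Omega> (s n t - f t)) \<longlonglongrightarrow> 0)" by (rule exE)
  have s2: "simple_function (time T) (s n)" for n
    by (rule conjunct1[OF spec[OF conjunct1[OF s], of n]])
  have s3: "s n t \<in> H1 \<Omega>" if "t \<in> {0<..<T}" for n t
    by (rule bspec[OF conjunct2[OF spec[OF conjunct1[OF s], of n]] that])
  note s4 = conjunct2[OF s]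
  have kH: "AE t in time T. k t \<in> H1 \<Omega>"
    using k s1
  proof eventually_elim
    case (elim t)
    have "AE x in lebesgue_on \<Omega>. f t x - c x = k t x" using elim(1) by eventually_elim simp
    then show ?case by (rule H1_AE_eq[OF \<Omega> _ H1_diff[OF \<Omega> elim(2) c]])
  qed
  have kN: "AE t in time T. H1_norm \<Omega> (k t) \<le> H1_norm \<Omega> (f t) + H1_norm \<Omega> c"
    using k s1
  proof eventually_elim
    case (elim t)
    have "H1_norm \<Omega> (k t) = H1_norm \<Omega> (\<lambda>x. f t x - c x)" by (rule H1_norm_AE_eq[OF \<Omega> elim(1)])
    also have "\<dots> \<le> H1_norm \<Omega> (f t) + H1_norm \<Omega> c" by (rule H1_norm_triangle_diff[OF \<Omega> elim(2) c])
    finally show ?case .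
  qed
  define s' where "s' n t = (\<lambda>x. s n t x - c x)" for n t
  have sf: "simple_function (time T) (s' n)" for n
    unfolding s'_def[abs_def] by (rule simple_function_compose1[OF s2, of "\<lambda>u x. u x - c x"])
  have lim: "AE t in time T. (\<lambda>n. H1_norm \<Omega> (s' n t - k t)) \<longlonglongrightarrow> 0"
    using k s4
  proof eventually_elim
    case (elim t)
    have "H1_norm \<Omega> (s' n t - k t) = H1_norm \<Omega> (s n t - f t)" for n
    proof (rule H1_norm_AE_eq[OF \<Omega>])
      show "AE x in lebesgue_on \<Omega>. (s' n t - k t) x = (s n t - f t) x"
        using elim(1) by eventually_elim (simp add: s'_def)
    qed
    then show ?case using elim(2) by simp
  qed
  have sm_k: "strongly_measurable T (H1 \<Omega>) (H1_norm \<Omega>) k"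
    unfolding strongly_measurable_def
  proof (intro conjI exI[of _ s'] allI ballI)
    show "s' n t \<in> H1 \<Omega>" if "t \<in> {0<..<T}" for n t
      unfolding s'_def by (rule H1_diff[OF \<Omega> s3[OF that] c])
  qed (fact kH sf lim)+
  have "integrable (time T) (\<lambda>t. (H1_norm \<Omega> (k t))\<^sup>2)"
  proof (rule Bochner_Integration.integrable_bound)
    show "integrable (time T) (\<lambda>t. 2 * (H1_norm \<Omega> (f t))\<^sup>2 + 2 * (H1_norm \<Omega> c)\<^sup>2)"
      using int by simp
    show "(\<lambda>t. (H1_norm \<Omega> (k t))\<^sup>2) \<in> borel_measurable (time T)"
      using H1_norm_measurable[OF \<Omega> sm_k] by measurable
    show "AE t in time T. norm ((H1_norm \<Omega> (k t))\<^sup>2) \<le> norm (2 * (H1_norm \<Omega> (f t))\<^sup>2 + 2 * (H1_norm \<Omega> c)\<^sup>2)"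
      using kN
    proof eventually_elim
      case (elim t)
      have "(H1_norm \<Omega> (k t))\<^sup>2 \<le> (H1_norm \<Omega> (f t) + H1_norm \<Omega> c)\<^sup>2"
        using elim by (intro power_mono H1_norm_nonneg)
      also have "\<dots> \<le> 2 * (H1_norm \<Omega> (f t))\<^sup>2 + 2 * (H1_norm \<Omega> c)\<^sup>2"
        using sum_squares_bound[of "H1_norm \<Omega> (f t)" "H1_norm \<Omega> c"] by (simp add: power2_sum)
      finally show ?case by simp
    qed
  qed
  with sm_k show ?thesis by (simp add: bochner_L2_def)
qed

section \<open>Integrals over the time interval\<close>

lemma continuous_time_bounded:
  fixes \<psi> :: "real \<Rightarrow> real"
  assumes "continuous_on {0..T} \<psi>"
  shows "\<psi> \<in> borel_measurable (time T)" "\<exists>K. \<forall>t\<in>{0<..<T}. \<bar>\<psi> t\<bar> \<le> K"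
proof -
  show "\<psi> \<in> borel_measurable (time T)"
    by (intro continuous_imp_measurable_on_sets_lebesgue continuous_on_subset[OF assms]) auto
  have "bounded (\<psi> ` {0..T})"
    by (intro compact_imp_bounded compact_continuous_image assms compact_Icc)
  then obtain K where "\<forall>t\<in>{0..T}. \<bar>\<psi> t\<bar> \<le> K" unfolding bounded_iff by auto
  then show "\<exists>K. \<forall>t\<in>{0<..<T}. \<bar>\<psi> t\<bar> \<le> K" by (intro exI[of _ K]) auto
qed

lemma integrable_mult_continuous_time:
  fixes f \<psi> :: "real \<Rightarrow> real"
  assumes f: "integrable (time T) f" and \<psi>: "continuous_on {0..T} \<psi>"
  shows "integrable (time T) (\<lambda>t. f t * \<psi> t)"
proof -
  obtain K where K: "\<forall>t\<in>{0<..<T}. \<bar>\<psi> t\<bar> \<le> K" using continuous_time_bounded(2)[OF \<psi>] by blast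
  show ?thesis
  proof (rule Bochner_Integration.integrable_bound)
    show "integrable (time T) (\<lambda>t. K * f t)" using f by simp
    show "(\<lambda>t. f t * \<psi> t) \<in> borel_measurable (time T)"
      using borel_measurable_integrable[OF f] continuous_time_bounded(1)[OF \<psi>] by (rule borel_measurable_times)
    show "AE t in time T. norm (f t * \<psi> t) \<le> norm (K * f t)"
    proof (rule AE_I2)
      fix t assume "t \<in> space (time T)"
      then have "\<bar>\<psi> t\<bar> \<le> \<bar>K\<bar>" using K by force
      then show "norm (f t * \<psi> t) \<le> norm (K * f t)"
        by (simp add: abs_mult mult.commute[of "\<bar>K\<bar>"] mult_left_mono)
    qed
  qed
qed

lemma integral_time_derivative:
  fixes \<psi> \<psi>' :: "real \<Rightarrow> real"
  assumes T: "0 < T" and der: "\<And>t. t \<in> {0..T} \<Longrightarrow> (\<psi> has_real_derivative \<psi>' t) (at t within {0..T})"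
    and cont: "continuous_on {0..T} \<psi>'"
  shows "integrable (time T) \<psi>'" "(\<integral>t. \<psi>' t \<partial>time T) = \<psi> T - \<psi> 0"
proof -
  interpret finite_measure "time T" by (rule finite_measure_time)
  show int: "integrable (time T) \<psi>'"
    using integrable_mult_continuous_time[of T "\<lambda>_. 1", OF _ cont] by simp
  have "(\<integral>t. \<psi>' t \<partial>time T) = integral {0<..<T} \<psi>'"
    by (rule lebesgue_integral_eq_integral[OF int]) simp
  also have "\<dots> = integral {0..T} \<psi>'" by (rule integral_open_interval_real[symmetric])
  also have "\<dots> = \<psi> T - \<psi> 0"
    using T der by (intro integral_unique fundamental_theorem_of_calculus)
      (auto simp: has_real_derivative_iff_has_vector_derivative[symmetric])
  finally show "(\<integral>t. \<psi>' t \<partial>time T) = \<psi> T - \<psi> 0" .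
qed

text \<open>If \<open>k (1 - t/T)\<^sup>N\<close> is integrable for some \<open>N\<close>, it dominates all later functions of the sequence, which
  tend to zero pointwise. If there is no such \<open>N\<close>, all integrals are zero by convention. This serves
  to remove the diffusion, exchange and source terms of the weak formulation in one stroke.\<close>

lemma integral_mult_time_power_tendsto_0:
  fixes k :: "real \<Rightarrow> real"
  assumes T: "0 < T"
  shows "(\<lambda>n. \<integral>t. k t * (1 - t / T) ^ n \<partial>time T) \<longlonglongrightarrow> 0"
proof (cases "\<exists>n. integrable (time T) (\<lambda>t. k t * (1 - t / T) ^ n)")
  case False
  then have "(\<integral>t. k t * (1 - t / T) ^ n \<partial>time T) = 0" for n
    by (intro not_integrable_integral_eq) blast
  then show ?thesis by simp
next
  case True
  then obtain N where N: "integrable (time T) (\<lambda>t. k t * (1 - t / T) ^ N)" by blast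
  have "(\<lambda>n. \<integral>t. k t * (1 - t / T) ^ (n + N) \<partial>time T) \<longlonglongrightarrow> (\<integral>t. 0 \<partial>time T)"
  proof (rule integral_dominated_convergence[where w = "\<lambda>t. \<bar>k t * (1 - t / T) ^ N\<bar>"])
    have c: "continuous_on {0..T} (\<lambda>t. (1 - t / T) ^ n)" for n
      using T by (intro continuous_intros) auto
    show "(\<lambda>t. k t * (1 - t / T) ^ (n + N)) \<in> borel_measurable (time T)" for n
      using borel_measurable_integrable[OF integrable_mult_continuous_time[OF N c[of n]]]
      by (simp add: power_add ac_simps)
    have q: "0 \<le> 1 - t / T" "1 - t / T < 1" if "t \<in> space (time T)" for t
      using that T by (simp_all add: field_simps)
    show "AE t in time T. (\<lambda>n. k t * (1 - t / T) ^ (n + N)) \<longlonglongrightarrow> 0"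
    proof (rule AE_I2)
      fix t assume t: "t \<in> space (time T)"
      have "(\<lambda>n. (k t * (1 - t / T) ^ N) * (1 - t / T) ^ n) \<longlonglongrightarrow> (k t * (1 - t / T) ^ N) * 0"
        using q[OF t] by (intro tendsto_intros LIMSEQ_power_zero) auto
      then show "(\<lambda>n. k t * (1 - t / T) ^ (n + N)) \<longlonglongrightarrow> 0" by (simp add: power_add ac_simps)
    qed
    show "AE t in time T. norm (k t * (1 - t / T) ^ (n + N)) \<le> \<bar>k t * (1 - t / T) ^ N\<bar>" for n
    proof (rule AE_I2)
      fix t assume t: "t \<in> space (time T)"
      have "\<bar>(1 - t / T) ^ n\<bar> \<le> 1" using q[OF t] by (simp add: power_abs power_le_one)
      then have "\<bar>k t * (1 - t / T) ^ N\<bar> * \<bar>(1 - t / T) ^ n\<bar> \<le> \<bar>k t * (1 - t / T) ^ N\<bar>"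
        by (intro mult_left_le) auto
      then show "norm (k t * (1 - t / T) ^ (n + N)) \<le> \<bar>k t * (1 - t / T) ^ N\<bar>"
        by (simp add: power_add abs_mult ac_simps)
    qed
  qed (use N in auto)
  then have "(\<lambda>n. \<integral>t. k t * (1 - t / T) ^ (n + N) \<partial>time T) \<longlonglongrightarrow> 0" by simp
  then show ?thesis by (rule LIMSEQ_offset)
qed

section \<open>Primitives of the storage coefficient\<close>

lemma primitive_deriv:
  assumes "continuous_on UNIV (S x)"
  shows "(primitive S x has_real_derivative S x r) (at r)"
proof -
  define b where "b = \<bar>r\<bar> + 1"
  have "((\<lambda>u. LBINT y=ereal 0..ereal u. S x y) has_vector_derivative S x r) (at r within {-b..b})"
    by (rule interval_integral_FTC2, unfold b_def)
       (linarith | rule continuous_on_subset[OF assms subset_UNIV])+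
  moreover have "at r within {-b..b} = at r"
    by (rule at_within_interior) (simp add: b_def, linarith)
  ultimately have "((\<lambda>u. LBINT y=ereal 0..ereal u. S x y) has_vector_derivative S x r) (at r)"
    by simp
  moreover have "primitive S x = (\<lambda>u. LBINT y=ereal 0..ereal u. S x y)"
    by (rule ext) (rule primitive_def)
  ultimately show ?thesis
    by (simp only: has_real_derivative_iff_has_vector_derivative)
qed

lemma primitive_0: "primitive S x 0 = 0"
  by (simp add: primitive_def)

lemma primitive_strict_mono:
  assumes "continuous_on UNIV (S x)" "\<And>r. 0 < S x r" "r < r'"
  shows "primitive S x r < primitive S x r'"
proof (rule DERIV_pos_imp_increasing[OF assms(3)])
  fix z
  show "\<exists>y. (primitive S x has_real_derivative y) (at z) \<and> 0 < y"
    by (rule exI[of _ "S x z"], rule conjI[OF primitive_deriv[where S = S and x = x, OF assms(1)] assms(2)])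
qed

lemma primitive_abs_le:
  assumes "continuous_on UNIV (S x)" "\<And>r. 0 < S x r" "\<And>r. S x r \<le> S1"
  shows "\<bar>primitive S x r\<bar> \<le> S1 * \<bar>r\<bar>"
proof -
  have "norm (primitive S x r - primitive S x 0) \<le> S1 * norm (r - 0)"
  proof (rule field_differentiable_bound[of UNIV])
    show "(primitive S x has_real_derivative S x z) (at z within UNIV)" for z
      using primitive_deriv[where S = S and x = x, OF assms(1)] by simp
    show "norm (S x z) \<le> S1" for z using assms(2,3)[of z] by simp
  qed auto
  then show ?thesis by (simp add: primitive_0)
qed

text \<open>On \<open>{m..M}\<close> the two primitives have the same derivative; since both start at 0, which may lie
  outside of this interval, they differ there by a constant.\<close>

lemma primitive_diff_cong:
  assumes S: "continuous_on UNIV (S x)" and S': "continuous_on UNIV (S' x)"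
    and eq: "\<And>r. r \<in> {m..M} \<Longrightarrow> S x r = S' x r" and r: "r \<in> {m..M}"
  shows "primitive S x r - primitive S' x r = primitive S x m - primitive S' x m"
proof (cases "r = m")
  case False
  have d: "((\<lambda>u. primitive S x u - primitive S' x u) has_real_derivative (S x u - S' x u)) (at u)" for u
    by (rule DERIV_diff[OF primitive_deriv[where S = S and x = x, OF S]
        primitive_deriv[where S = S' and x = x, OF S']])
  have "m < r" using r False by simp
  then obtain z where "m < z" "z < r"
    "(primitive S x r - primitive S' x r) - (primitive S x m - primitive S' x m) = (r - m) * (S x z - S' x z)"
    using MVT2[of m r "\<lambda>u. primitive S x u - primitive S' x u" "\<lambda>u. S x u - S' x u"] d by blast
  then show ?thesis using eq[of z] r by simp
qed simp

section \<open>Consequences of the structural hypotheses\<close>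

lemma hyp_H1_continuous: "hyp_H1 \<Omega> S \<T> \<Longrightarrow> AE x in lebesgue_on \<Omega>. continuous_on UNIV (S x)"
  by (simp add: hyp_H1_def caratheodory_def)

lemma hyp_H1_bounds:
  assumes "hyp_H1 \<Omega> S \<T>"
  shows "\<exists>S1. AE x in lebesgue_on \<Omega>. \<forall>r. 0 < S x r \<and> S x r \<le> S1"
proof -
  note * = assms[unfolded hyp_H1_def, THEN conjunct2, THEN conjunct2, THEN conjunct1]
  then obtain S0 S1 T0 T1 where b: "S0 > 0" "AE x in lebesgue_on \<Omega>. \<forall>r.
        S0 \<le> S x r \<and> S x r \<le> S1 \<and> T0 \<le> \<T> x r \<and> \<T> x r \<le> T1" by blast
  from b(2) have "AE x in lebesgue_on \<Omega>. \<forall>r. 0 < S x r \<and> S x r \<le> S1"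
    by eventually_elim (use b(1) in \<open>meson less_le_trans\<close>)
  then show ?thesis by (rule exI)
qed

lemma hyp_H1_primitive:
  assumes "hyp_H1 \<Omega> S \<T>" "u \<in> H1 \<Omega>"
  shows "(\<lambda>x. primitive S x (u x)) \<in> H1 \<Omega>"
proof -
  note * = assms(1)[unfolded hyp_H1_def, THEN conjunct2, THEN conjunct2, THEN conjunct2]
  from * obtain D :: "pt \<Rightarrow> real \<Rightarrow> pt" where
    "(\<forall>r. has_weak_gradient \<Omega> (\<lambda>x. primitive S x r) (\<lambda>x. D x r)) \<and>
        (\<exists>C\<^sub>B>0. AE x in lebesgue_on \<Omega>. \<forall>r. norm (D x r) \<le> C\<^sub>B * (1 + \<bar>r\<bar>)) \<and>
        (\<forall>u\<in>H1 \<Omega>. (\<lambda>x. primitive S x (u x)) \<in> H1 \<Omega> \<and>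
           (AE x in lebesgue_on \<Omega>. weak_gradient \<Omega> (\<lambda>y. primitive S y (u y)) x
              = S x (u x) *\<^sub>R weak_gradient \<Omega> u x + D x (u x)))" by (rule exE)
  note D = this[THEN conjunct2, THEN conjunct2]
  show ?thesis by (rule conjunct1[OF bspec[OF D assms(2)]])
qed

lemma hyp_H1_primitive_L2:
  assumes \<Omega>: "bounded \<Omega>" "open \<Omega>" and H1: "hyp_H1 \<Omega> S \<T>" and u: "u \<in> L2 (lebesgue_on \<Omega>)"
  shows "(\<lambda>x. primitive S x (u x)) \<in> L2 (lebesgue_on \<Omega>)"
proof -
  interpret complete_measure "lebesgue_on \<Omega>" using \<Omega> by (intro complete_lebesgue_on) simp
  obtain S1 where S1: "AE x in lebesgue_on \<Omega>. \<forall>r. 0 < S x r \<and> S x r \<le> S1"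
    using hyp_H1_bounds[OF H1] by blast
  note cont = hyp_H1_continuous[OF H1]
  have meas: "(\<lambda>x. primitive S x (u x)) \<in> borel_measurable (lebesgue_on \<Omega>)"
  proof (rule caratheodory_measurable[where f = "primitive S" and g = u])
    show "(\<lambda>x. primitive S x r) \<in> borel_measurable (lebesgue_on \<Omega>)" for r
      by (rule L2_D(1)[OF H1_D(1)[OF \<Omega>(2) hyp_H1_primitive[OF H1 smooth_H1[OF \<Omega> C_infinity_const]]]])
    show "AE x in lebesgue_on \<Omega>. continuous_on UNIV (primitive S x)"
      using cont
    proof eventually_elim
      case (elim x)
      show ?case
        by (rule continuous_at_imp_continuous_on)
            (rule ballI, rule DERIV_isCont[OF primitive_deriv[where S = S and x = x, OF elim]])
    qed
  qed (rule L2_D(1)[OF u])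
  show ?thesis
  proof (rule L2_bound[OF L2_cmult[OF u, of S1] meas])
    show "AE x in lebesgue_on \<Omega>. norm (primitive S x (u x)) \<le> norm (S1 * u x)"
      using cont S1
    proof eventually_elim
      case (elim x)
      have "\<bar>primitive S x (u x)\<bar> \<le> S1 * \<bar>u x\<bar>"
        by (rule primitive_abs_le[where S = S and x = x, OF elim(1)]) (use elim(2) in auto)
      also have "\<dots> \<le> \<bar>S1\<bar> * \<bar>u x\<bar>" by (intro mult_right_mono) auto
      finally show ?case by (simp add: abs_mult)
    qed
  qed
qed

lemma L2_absolutely_integrable:
  assumes \<Omega>: "bounded \<Omega>" "open \<Omega>" and f: "f \<in> L2 (lebesgue_on \<Omega>)" and C: "compact C" "C \<subseteq> \<Omega>"
  shows "(f :: pt \<Rightarrow> real) absolutely_integrable_on C"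
proof -
  have "integrable (lebesgue_on \<Omega>) (\<lambda>x. f x * 1)"
    by (rule L2_mult_integrable[OF f L2_const[OF lebesgue_on_bounded_finite[OF \<Omega>]]])
  then have "f absolutely_integrable_on \<Omega>"
    using \<Omega>(2) by (simp add: set_integrable_def integrable_restrict_space)
  then show ?thesis
    by (rule set_integrable_subset) (use C in \<open>auto simp: compact_imp_closed\<close>)
qed

text \<open>A member of \<open>V\<close> has some trace, so the chosen one is a trace.\<close>

lemma boundary_trace_AE_mem:
  assumes \<Omega>: "bounded \<Omega>" "lipschitz_domain \<Omega>" and \<Gamma>: "\<Gamma> \<in> sets borel" "\<Gamma> \<subseteq> frontier \<Omega>"
    and u: "u \<in> V_space \<Omega> \<Gamma>'" and A: "closed A" "A \<noteq> {}" and uA: "AE x in lebesgue_on \<Omega>. u x \<in> A"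
  shows "AE x in surface_on \<Gamma>. boundary_trace \<Omega> u x \<in> A"
proof -
  have "\<exists>\<tau>. has_trace \<Omega> u \<tau> \<and> (AE x in surface_on \<Gamma>'. \<tau> x = 0)"
    using u by (simp add: V_space_def)
  then obtain \<tau> where "has_trace \<Omega> u \<tau> \<and> (AE x in surface_on \<Gamma>'. \<tau> x = 0)" by (rule exE)
  then have "has_trace \<Omega> u (boundary_trace \<Omega> u)"
    unfolding boundary_trace_def by (intro someI[where P = "has_trace \<Omega> u"]) (rule conjunct1)
  from trace_AE_mem[OF \<Omega> this A uA]
  have "AE x in surface_on (frontier \<Omega>). boundary_trace \<Omega> u x \<in> A" .
  then have "AE x in surface_measure. x \<in> frontier \<Omega> \<longrightarrow> boundary_trace \<Omega> u x \<in> A"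
    by (subst (asm) AE_restrict_space_iff) (auto simp: space_surface_measure intro!: sets_surface_measure_borel
        borel_closed)
  then have "AE x in surface_measure. x \<in> \<Gamma> \<longrightarrow> boundary_trace \<Omega> u x \<in> A"
    by eventually_elim (use \<Gamma>(2) in blast)
  then show ?thesis
    using sets_surface_measure_borel[OF \<Gamma>(1)] by (subst AE_restrict_space_iff) (simp_all add: space_surface_measure)
qed

section \<open>The initial datum\<close>

text \<open>The conjuncts of the definition, with its local abbreviations expanded and its premises in rule
  form.\<close>

lemma weak_solutionD:
  assumes "weak_solution \<Omega> \<Gamma>\<^sub>D \<Gamma>\<^sub>R T S \<T> \<beta> h0 q g h"
  defines "diffusion \<equiv> \<lambda>v t x. \<T> x (h t x) * (weak_gradient \<Omega> (h t) x \<bullet> weak_gradient \<Omega> v x)"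
    and "exchange \<equiv> \<lambda>v t x. \<beta> x t (boundary_trace \<Omega> (h t) x) * boundary_trace \<Omega> v x"
  shows "(\<lambda>(x, t). h t x) \<in> borel_measurable (lebesgue_on (\<Omega> \<times> {0<..<T}))"
    and "h \<in> bochner_L_infinity T (L2 (lebesgue_on \<Omega>)) (L2_norm (lebesgue_on \<Omega>))"
    and "h \<in> bochner_L2 T (V_space \<Omega> \<Gamma>\<^sub>D) (V_norm \<Omega>)"
    and "(\<lambda>t x. primitive S x (h t x)) \<in> bochner_L2 T (H1 \<Omega>) (H1_norm \<Omega>)"
    and "\<exists>w \<in> bochner_L2 T (V_dual \<Omega> \<Gamma>\<^sub>D) (V_dual_norm \<Omega> \<Gamma>\<^sub>D).
      has_time_derivative \<Omega> \<Gamma>\<^sub>D T (\<lambda>t x. primitive S x (h t x)) w"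
    and "\<And>v. v \<in> V_space \<Omega> \<Gamma>\<^sub>D \<Longrightarrow> iterated_integrable (time T) (lebesgue_on \<Omega>) (diffusion v)"
    and "\<And>v. v \<in> V_space \<Omega> \<Gamma>\<^sub>D \<Longrightarrow> iterated_integrable (time T) (surface_on \<Gamma>\<^sub>R) (exchange v)"
    and "\<And>v \<psi> \<psi>'. v \<in> V_space \<Omega> \<Gamma>\<^sub>D \<Longrightarrow>
        (\<And>t. t \<in> {0..T} \<Longrightarrow> (\<psi> has_real_derivative \<psi>' t) (at t within {0..T})) \<Longrightarrow>
        continuous_on {0..T} \<psi>' \<Longrightarrow> \<psi> T = 0 \<Longrightarrow>
        - (\<integral>t. L2_inner \<Omega> (\<lambda>x. primitive S x (h t x)) v * \<psi>' t \<partial>time T)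
          + (\<integral>t. (\<integral>x. diffusion v t x * \<psi> t \<partial>lebesgue_on \<Omega>) \<partial>time T)
          + (\<integral>t. (\<integral>x. exchange v t x * \<psi> t \<partial>surface_on \<Gamma>\<^sub>R) \<partial>time T)
        = (\<integral>t. (q t v - g t (boundary_trace \<Omega> v)) * \<psi> t \<partial>time T)
          + L2_inner \<Omega> (\<lambda>x. primitive S x (h0 x)) v * \<psi> 0"
proof -
  note 1 = assms(1)[unfolded weak_solution_def Let_def]
  note 2 = conjunct2[OF 1]
  note 3 = conjunct2[OF 2]
  note 4 = conjunct2[OF 3]
  note 5 = conjunct2[OF 4]
  note 6 = conjunct2[OF 5]
  show "(\<lambda>(x, t). h t x) \<in> borel_measurable (lebesgue_on (\<Omega> \<times> {0<..<T}))" by (rule conjunct1[OF 1])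
  show "h \<in> bochner_L_infinity T (L2 (lebesgue_on \<Omega>)) (L2_norm (lebesgue_on \<Omega>))" by (rule conjunct1[OF 2])
  show "h \<in> bochner_L2 T (V_space \<Omega> \<Gamma>\<^sub>D) (V_norm \<Omega>)" by (rule conjunct1[OF 3])
  show "(\<lambda>t x. primitive S x (h t x)) \<in> bochner_L2 T (H1 \<Omega>) (H1_norm \<Omega>)" by (rule conjunct1[OF 4])
  show "\<exists>w \<in> bochner_L2 T (V_dual \<Omega> \<Gamma>\<^sub>D) (V_dual_norm \<Omega> \<Gamma>\<^sub>D).
      has_time_derivative \<Omega> \<Gamma>\<^sub>D T (\<lambda>t x. primitive S x (h t x)) w" by (rule conjunct1[OF 5])
  show "iterated_integrable (time T) (lebesgue_on \<Omega>) (diffusion v)" if "v \<in> V_space \<Omega> \<Gamma>\<^sub>D" for v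
    unfolding diffusion_def by (rule conjunct1[OF bspec[OF conjunct1[OF 6] that]])
  show "iterated_integrable (time T) (surface_on \<Gamma>\<^sub>R) (exchange v)" if "v \<in> V_space \<Omega> \<Gamma>\<^sub>D" for v
    unfolding exchange_def by (rule conjunct2[OF bspec[OF conjunct1[OF 6] that]])
  fix v \<psi> \<psi>' assume v: "v \<in> V_space \<Omega> \<Gamma>\<^sub>D"
    and "\<And>t. t \<in> {0..T} \<Longrightarrow> (\<psi> has_real_derivative \<psi>' t) (at t within {0..T})"
    "continuous_on {0..T} \<psi>'" "\<psi> T = (0::real)"
  then have "(\<forall>t\<in>{0..T}. (\<psi> has_real_derivative \<psi>' t) (at t within {0..T})) \<and>
           continuous_on {0..T} \<psi>' \<and> \<psi> T = 0" by blast
  then show "- (\<integral>t. L2_inner \<Omega> (\<lambda>x. primitive S x (h t x)) v * \<psi>' t \<partial>time T)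
          + (\<integral>t. (\<integral>x. diffusion v t x * \<psi> t \<partial>lebesgue_on \<Omega>) \<partial>time T)
          + (\<integral>t. (\<integral>x. exchange v t x * \<psi> t \<partial>surface_on \<Gamma>\<^sub>R) \<partial>time T)
        = (\<integral>t. (q t v - g t (boundary_trace \<Omega> v)) * \<psi> t \<partial>time T)
          + L2_inner \<Omega> (\<lambda>x. primitive S x (h0 x)) v * \<psi> 0"
    unfolding diffusion_def exchange_def
    by (rule mp[OF spec[OF spec[OF bspec[OF conjunct2[OF 6] v], of \<psi>], of \<psi>']])
qed

lemma time_power_deriv:
  "((\<lambda>t. (1 - t / T) ^ Suc n) has_real_derivative - (real (Suc n) / T * (1 - t / T) ^ n)) (at t within X)"
proof -
  have "((\<lambda>t. 1 - t / T) has_real_derivative - (1 / T)) (at t within X)"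
    by (auto intro!: derivative_eq_intros simp: divide_inverse)
  from DERIV_power_Suc[OF this, of n] show ?thesis by simp
qed

text \<open>Test with \<open>\<psi>(t) = (1 - t/T)\<^sup>n\<^sup>+\<^sup>1\<close>. Then \<open>\<psi>\<close> tends to zero on \<open>(0,T)\<close> while \<open>\<psi>(0) = 1\<close>, so in the limit the
  storage term, an average of \<open>(B(h(t)), v)\<close> with the weight \<open>-\<psi>'\<close> that concentrates at \<open>t = 0\<close>, balances
  the initial term alone.\<close>

lemma initial_time_average:
  assumes T: "0 < T" and sol: "weak_solution \<Omega> \<Gamma>\<^sub>D \<Gamma>\<^sub>R T S \<T> \<beta> h0 q g h" and v: "v \<in> V_space \<Omega> \<Gamma>\<^sub>D"
  shows "(\<lambda>n. \<integral>t. L2_inner \<Omega> (\<lambda>x. primitive S x (h t x)) v * (real (Suc n) / T * (1 - t / T) ^ n) \<partial>time T)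
    \<longlonglongrightarrow> L2_inner \<Omega> (\<lambda>x. primitive S x (h0 x)) v"
proof -
  define G where "G t = L2_inner \<Omega> (\<lambda>x. primitive S x (h t x)) v" for t
  define D where "D t = (\<integral>x. \<T> x (h t x) * (weak_gradient \<Omega> (h t) x \<bullet> weak_gradient \<Omega> v x) \<partial>lebesgue_on \<Omega>)" for t
  define E where "E t = (\<integral>x. \<beta> x t (boundary_trace \<Omega> (h t) x) * boundary_trace \<Omega> v x \<partial>surface_on \<Gamma>\<^sub>R)" for t
  define Q where "Q t = q t v - g t (boundary_trace \<Omega> v)" for t
  let ?b0 = "L2_inner \<Omega> (\<lambda>x. primitive S x (h0 x)) v"
  let ?I = "\<lambda>k n. \<integral>t. k t * (1 - t / T) ^ n \<partial>time T"
  have eq: "(\<integral>t. G t * (real (Suc n) / T * (1 - t / T) ^ n) \<partial>time T)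
      = ?b0 + ?I Q (Suc n) - ?I D (Suc n) - ?I E (Suc n)" for n
  proof -
    let ?\<psi> = "\<lambda>t. (1 - t / T) ^ Suc n" and ?\<psi>' = "\<lambda>t. - (real (Suc n) / T * (1 - t / T) ^ n)"
    have "- (\<integral>t. G t * ?\<psi>' t \<partial>time T) + (\<integral>t. (\<integral>x.
        (\<T> x (h t x) * (weak_gradient \<Omega> (h t) x \<bullet> weak_gradient \<Omega> v x)) * ?\<psi> t \<partial>lebesgue_on \<Omega>) \<partial>time T)
          + (\<integral>t. (\<integral>x. (\<beta> x t (boundary_trace \<Omega> (h t) x) * boundary_trace \<Omega> v x) * ?\<psi> t \<partial>surface_on \<Gamma>\<^sub>R) \<partial>time T)
        = (\<integral>t. (q t v - g t (boundary_trace \<Omega> v)) * ?\<psi> t \<partial>time T) + ?b0 * ?\<psi> 0"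
      unfolding G_def
    proof (rule weak_solutionD(8)[OF sol v])
      show "(?\<psi> has_real_derivative ?\<psi>' t) (at t within {0..T})" for t
        by (rule time_power_deriv)
      show "continuous_on {0..T} ?\<psi>'" using T by (intro continuous_intros) auto
      show "?\<psi> T = 0" using T by simp
    qed
    then have "- (\<integral>t. G t * ?\<psi>' t \<partial>time T) + ?I D (Suc n) + ?I E (Suc n) = ?I Q (Suc n) + ?b0"
      unfolding D_def E_def Q_def integral_mult_left_zero by simp
    moreover have "(\<integral>t. G t * ?\<psi>' t \<partial>time T) = - (\<integral>t. G t * (real (Suc n) / T * (1 - t / T) ^ n) \<partial>time T)"
      by (simp only: mult_minus_right Bochner_Integration.integral_minus)
    ultimately show ?thesis by linarith
  qed
  have "(\<lambda>n. ?b0 + ?I Q (Suc n) - ?I D (Suc n) - ?I E (Suc n)) \<longlonglongrightarrow> ?b0 + 0 - 0 - 0"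
    by (intro tendsto_diff tendsto_add tendsto_const LIMSEQ_Suc[OF integral_mult_time_power_tendsto_0[OF T]])
  then show ?thesis unfolding G_def[symmetric] eq by simp
qed

text \<open>For \<open>v \<ge> 0\<close> the averages of \<open>(B(h(t)), v)\<close> lie between \<open>(B(m), v)\<close> and \<open>(B(M), v)\<close>, and so does their limit
  \<open>(B(h\<^sub>0), v)\<close>. Hence \<open>B(m) \<le> B(h\<^sub>0) \<le> B(M)\<close> almost everywhere, and \<open>B\<close> is strictly increasing in its
  last argument.\<close>

lemma initial_datum_mem:
  assumes \<Omega>: "bounded \<Omega>" "open \<Omega>" and \<Gamma>: "\<Gamma>\<^sub>D \<subseteq> frontier \<Omega>" and T: "0 < T"
    and H1: "hyp_H1 \<Omega> S \<T>" and h0: "h0 \<in> L2 (lebesgue_on \<Omega>)"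
    and sol: "weak_solution \<Omega> \<Gamma>\<^sub>D \<Gamma>\<^sub>R T S \<T> \<beta> h0 q g h"
    and range: "AE t in time T. AE x in lebesgue_on \<Omega>. h t x \<in> {m..M}"
  shows "AE x in lebesgue_on \<Omega>. h0 x \<in> {m..M}"
proof -
  let ?B = "\<lambda>u x. primitive S x (u x)"
  have mono: "AE x in lebesgue_on \<Omega>. \<forall>r r'. r < r' \<longrightarrow> primitive S x r < primitive S x r'"
  proof -
    obtain S1 where S1: "AE x in lebesgue_on \<Omega>. \<forall>r. 0 < S x r \<and> S x r \<le> S1"
      using hyp_H1_bounds[OF H1] by blast
    show ?thesis
      using hyp_H1_continuous[OF H1] S1
    proof eventually_elim
      case (elim x)
      show ?case
      proof (intro allI impI)
        fix r r' :: real assume "r < r'"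
        show "primitive S x r < primitive S x r'"
          by (rule primitive_strict_mono[where S = S and x = x, OF elim(1) _ \<open>r < r'\<close>]) (use elim(2) in auto)
      qed
    qed
  qed
  have BL2: "?B u \<in> L2 (lebesgue_on \<Omega>)" if "u \<in> L2 (lebesgue_on \<Omega>)" for u
    by (rule hyp_H1_primitive_L2[OF \<Omega> H1 that])
  have cL2: "(\<lambda>x. c::real) \<in> L2 (lebesgue_on \<Omega>)" for c
    by (rule L2_const[OF lebesgue_on_bounded_finite[OF \<Omega>]])
  note B0 = BL2[OF h0] and Bc = BL2[OF cL2]
  have test: "L2_inner \<Omega> (?B (\<lambda>x. m)) v \<le> L2_inner \<Omega> (?B h0) v \<and> L2_inner \<Omega> (?B h0) v \<le> L2_inner \<Omega> (?B (\<lambda>x. M)) v"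
    if v: "v \<in> test_functions \<Omega>" and pos: "\<And>x. 0 \<le> v x" for v
  proof -
    have vL2: "v \<in> L2 (lebesgue_on \<Omega>)"
      by (rule H1_D(1)[OF \<Omega>(2) smooth_H1[OF \<Omega> test_functionD(1)[OF v]]])
    define G where "G t = L2_inner \<Omega> (?B (h t)) v" for t
    define w where "w n t = real (Suc n) / T * (1 - t / T) ^ n" for n t
    let ?gm = "L2_inner \<Omega> (?B (\<lambda>x. m)) v" and ?gM = "L2_inner \<Omega> (?B (\<lambda>x. M)) v"
    have lim: "(\<lambda>n. \<integral>t. G t * w n t \<partial>time T) \<longlonglongrightarrow> L2_inner \<Omega> (?B h0) v"
      unfolding G_def w_def by (rule initial_time_average[OF T sol test_function_V_space[OF \<Omega> \<Gamma> v]])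
    note BhL = weak_solutionD(4)[OF sol]
    have int_G: "integrable (time T) G"
      unfolding G_def[abs_def] by (rule L2_inner_integrable[OF \<Omega>(2) BhL vL2])
    have w_cont: "continuous_on {0..T} (w n)" for n
      unfolding w_def[abs_def] using T by (intro continuous_intros) auto
    have w_int: "integrable (time T) (w n)" "(\<integral>t. w n t \<partial>time T) = 1" for n
    proof -
      have d: "((\<lambda>t. - ((1 - t / T) ^ Suc n)) has_real_derivative w n t) (at t within {0..T})" for t
        using DERIV_minus[OF time_power_deriv[of T n t "{0..T}"]] by (simp only: w_def minus_minus)
      show "integrable (time T) (w n)" by (rule integral_time_derivative(1)[OF T d w_cont])
      show "(\<integral>t. w n t \<partial>time T) = 1"
        using integral_time_derivative(2)[OF T d w_cont] T by simp
    qed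
    have w_pos: "0 \<le> w n t" if "t \<in> {0<..<T}" for n t
      using that T by (simp add: w_def)
    have "AE t in time T. h t \<in> V_space \<Omega> \<Gamma>\<^sub>D"
      using weak_solutionD(3)[OF sol] by (simp add: bochner_L2_def strongly_measurable_def)
    moreover have "AE t in time T. ?B (h t) \<in> H1 \<Omega>"
      using BhL by (simp add: bochner_L2_def strongly_measurable_def)
    ultimately have G_bounds: "AE t in time T. ?gm \<le> G t \<and> G t \<le> ?gM"
      using range
    proof eventually_elim
      case (elim t)
      have Bh: "?B (h t) \<in> L2 (lebesgue_on \<Omega>)" by (rule H1_D(1)[OF \<Omega>(2) elim(2)])
      have le: "AE x in lebesgue_on \<Omega>. primitive S x m \<le> primitive S x (h t x) \<and> primitive S x (h t x)
          \<le> primitive S x M"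
        using elim(3) mono
      proof eventually_elim
        case (elim x)
        have "primitive S x r \<le> primitive S x r'" if "r \<le> r'" for r r'
          using elim(2) that by (cases "r = r'") (auto intro: less_imp_le)
        then show ?case using elim(1) by simp
      qed
      have "?gm \<le> G t" unfolding G_def L2_inner_def
      proof (rule integral_mono_AE[OF L2_mult_integrable[OF Bc vL2] L2_mult_integrable[OF Bh vL2]])
        show "AE x in lebesgue_on \<Omega>. primitive S x m * v x \<le> primitive S x (h t x) * v x"
          using le by eventually_elim (intro mult_right_mono pos, simp)
      qed
      moreover have "G t \<le> ?gM" unfolding G_def L2_inner_def
      proof (rule integral_mono_AE[OF L2_mult_integrable[OF Bh vL2] L2_mult_integrable[OF Bc vL2]])
        show "AE x in lebesgue_on \<Omega>. primitive S x (h t x) * v x \<le> primitive S x M * v x"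
          using le by eventually_elim (intro mult_right_mono pos, simp)
      qed
      ultimately show ?case by blast
    qed
    have avg: "?gm \<le> (\<integral>t. G t * w n t \<partial>time T) \<and> (\<integral>t. G t * w n t \<partial>time T) \<le> ?gM" for n
    proof -
      have G': "AE t in time T. ?gm * w n t \<le> G t * w n t \<and> G t * w n t \<le> ?gM * w n t"
      proof -
        have "AE t in time T. t \<in> {0<..<T}" by (intro AE_I2) simp
        with G_bounds show ?thesis
          by eventually_elim (use w_pos in \<open>auto intro!: mult_right_mono\<close>)
      qed
      have iG: "integrable (time T) (\<lambda>t. G t * w n t)" by (rule integrable_mult_continuous_time[OF int_G w_cont])
      have ic: "integrable (time T) (\<lambda>t. c * w n t)" "(\<integral>t. c * w n t \<partial>time T) = c" for c
        using w_int[of n] by simp_all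
      have "(\<integral>t. ?gm * w n t \<partial>time T) \<le> (\<integral>t. G t * w n t \<partial>time T)"
        by (rule integral_mono_AE[OF ic(1) iG]) (use G' in eventually_elim, simp)
      moreover have "(\<integral>t. G t * w n t \<partial>time T) \<le> (\<integral>t. ?gM * w n t \<partial>time T)"
        by (rule integral_mono_AE[OF iG ic(1)]) (use G' in eventually_elim, simp)
      ultimately show ?thesis unfolding ic(2) ..
    qed
    have "?gm \<le> L2_inner \<Omega> (?B h0) v"
      by (rule LIMSEQ_le_const[OF lim]) (use avg in auto)
    moreover have "L2_inner \<Omega> (?B h0) v \<le> ?gM"
      by (rule LIMSEQ_le_const2[OF lim]) (use avg in auto)
    ultimately show ?thesis ..
  qed
  have ineq: "AE x in lebesgue_on \<Omega>. 0 \<le> f x - k x"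
    if f: "f \<in> L2 (lebesgue_on \<Omega>)" and k: "k \<in> L2 (lebesgue_on \<Omega>)"
      and le: "\<And>v. v \<in> test_functions \<Omega> \<Longrightarrow> (\<And>x. 0 \<le> v x) \<Longrightarrow> L2_inner \<Omega> k v \<le> L2_inner \<Omega> f v" for f k
  proof (rule AE_nonneg_if_test_nonneg[OF \<Omega>(2)])
    show "(\<lambda>x. f x - k x) absolutely_integrable_on C" if "compact C" "C \<subseteq> \<Omega>" for C
      by (rule L2_absolutely_integrable[OF \<Omega> L2_diff[OF f k] that])
    fix v assume v: "v \<in> test_functions \<Omega>" "\<And>x. 0 \<le> v x"
    have vL2: "v \<in> L2 (lebesgue_on \<Omega>)"
      by (rule H1_D(1)[OF \<Omega>(2) smooth_H1[OF \<Omega> test_functionD(1)[OF v(1)]]])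
    show "0 \<le> (\<integral>x. (f x - k x) * v x \<partial>lebesgue_on \<Omega>)"
      using le[OF v] L2_inner_diff[OF f k vL2] unfolding L2_inner_def by linarith
  qed
  have "AE x in lebesgue_on \<Omega>. 0 \<le> primitive S x (h0 x) - primitive S x m"
    by (rule ineq[OF B0 Bc]) (use test in blast)
  moreover have "AE x in lebesgue_on \<Omega>. 0 \<le> primitive S x M - primitive S x (h0 x)"
    by (rule ineq[OF Bc B0]) (use test in blast)
  ultimately show ?thesis
    using mono
  proof eventually_elim
    case (elim x)
    show ?case
    proof (rule ccontr)
      assume "h0 x \<notin> {m..M}"
      then have "h0 x < m \<or> M < h0 x" by auto
      then show False using elim by force
    qed
  qed
qed

section \<open>The physical model\<close>

lemma test_function_time_derivative:
  assumes "\<phi> \<in> test_functions {0<..<T}"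
  shows "(\<phi> has_real_derivative deriv \<phi> t) (at t within X)" "continuous_on X (deriv \<phi>)"
    "\<phi> 0 = 0" "\<phi> T = 0"
proof -
  note \<phi> = test_functionD[OF assms]
  have d: "(\<phi> has_real_derivative frechet_derivative \<phi> (at t) 1) (at t)" for t
  proof -
    have der: "(\<phi> has_derivative frechet_derivative \<phi> (at t)) (at t)"
      by (rule C_infinity_has_derivative[OF \<phi>(1)])
    have "frechet_derivative \<phi> (at t) = (\<lambda>h. h * frechet_derivative \<phi> (at t) 1)"
    proof
      fix h
      show "frechet_derivative \<phi> (at t) h = h * frechet_derivative \<phi> (at t) 1"
        using linear_cmul[OF has_derivative_linear[OF der], of h 1] by simp
    qed
    with der show ?thesis by (simp add: has_field_derivative_def mult_commute_abs)
  qed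
  have eq: "deriv \<phi> = (\<lambda>t. frechet_derivative \<phi> (at t) 1)"
    by (rule ext) (rule DERIV_imp_deriv[OF d])
  show "(\<phi> has_real_derivative deriv \<phi> t) (at t within X)"
    unfolding eq by (rule has_field_derivative_at_within[OF d])
  show "continuous_on X (deriv \<phi>)"
    unfolding eq by (rule C_infinity_continuous[OF C_infinity_partial[OF \<phi>(1)]]) simp
  have "\<phi> t = 0" if "t \<notin> {0<..<T}" for t
  proof -
    have "t \<notin> {x. \<phi> x \<noteq> 0}" using that \<phi>(3) closure_subset[of "{x. \<phi> x \<noteq> 0}"] by blast
    then show ?thesis by simp
  qed
  then show "\<phi> 0 = 0" "\<phi> T = 0" by simp_all
qed

text \<open>As \<open>c\<close> does not depend on time, its share in the storage term is the integral of \<open>\<psi>'\<close>.\<close>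

lemma integral_L2_inner_diff:
  assumes \<Omega>: "open \<Omega>" and T: "0 < T" and f: "f \<in> bochner_L2 T (H1 \<Omega>) (H1_norm \<Omega>)" and c: "c \<in> H1 \<Omega>"
    and k: "AE t in time T. AE x in lebesgue_on \<Omega>. k t x = f t x - c x" and v: "v \<in> L2 (lebesgue_on \<Omega>)"
    and der: "\<And>t. t \<in> {0..T} \<Longrightarrow> (\<psi> has_real_derivative \<psi>' t) (at t within {0..T})"
    and cont: "continuous_on {0..T} \<psi>'"
  shows "(\<integral>t. L2_inner \<Omega> (k t) v * \<psi>' t \<partial>time T)
    = (\<integral>t. L2_inner \<Omega> (f t) v * \<psi>' t \<partial>time T) - L2_inner \<Omega> c v * (\<psi> T - \<psi> 0)"
proof -
  interpret complete_measure "time T" by (rule complete_time)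
  have "AE t in time T. f t \<in> H1 \<Omega>"
    using f by (simp add: bochner_L2_def strongly_measurable_def)
  then have "AE t in time T. L2_inner \<Omega> (k t) v * \<psi>' t = L2_inner \<Omega> (f t) v * \<psi>' t - L2_inner \<Omega> c v * \<psi>' t"
    using k
  proof eventually_elim
    case (elim t)
    have "L2_inner \<Omega> (k t) v = L2_inner \<Omega> (f t) v - L2_inner \<Omega> c v"
      unfolding L2_inner_AE_eq[OF \<Omega> elim(2)]
      by (rule L2_inner_diff[OF H1_D(1)[OF \<Omega> elim(1)] H1_D(1)[OF \<Omega> c] v])
    then show ?case by (simp add: left_diff_distrib)
  qed
  then have "(\<integral>t. L2_inner \<Omega> (k t) v * \<psi>' t \<partial>time T)
      = (\<integral>t. L2_inner \<Omega> (f t) v * \<psi>' t - L2_inner \<Omega> c v * \<psi>' t \<partial>time T)"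
    by (rule integral_AE_eq)
  also have "\<dots> = (\<integral>t. L2_inner \<Omega> (f t) v * \<psi>' t \<partial>time T) - L2_inner \<Omega> c v * (\<integral>t. \<psi>' t \<partial>time T)"
    using integrable_mult_continuous_time[OF L2_inner_integrable[OF \<Omega> f v] cont]
      integral_time_derivative(1)[OF T der cont]
    by (subst Bochner_Integration.integral_diff) simp_all
  also have "(\<integral>t. \<psi>' t \<partial>time T) = \<psi> T - \<psi> 0"
    by (rule integral_time_derivative(2)[OF T der cont])
  finally show ?thesis .
qed

theorem corollary5p1:
  fixes \<Omega> \<Gamma>\<^sub>D \<Gamma>\<^sub>N \<Gamma>\<^sub>R :: "(real^2) set"
    and T K n\<^sub>e S\<^sub>s m M :: real
    and \<eta> h0 :: "real^2 \<Rightarrow> real"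
    and \<alpha> :: "real \<Rightarrow> real"
    and h_ext :: "real^2 \<Rightarrow> real \<Rightarrow> real"
    and S \<T> :: "real^2 \<Rightarrow> real \<Rightarrow> real"
    and \<beta> :: "real^2 \<Rightarrow> real \<Rightarrow> real \<Rightarrow> real"
    and N q g :: "real \<Rightarrow> (real^2 \<Rightarrow> real) \<Rightarrow> real"
    and h :: "real \<Rightarrow> real^2 \<Rightarrow> real"
  assumes domain: "bounded \<Omega>" "lipschitz_domain \<Omega>"
    and boundary_parts:
      "openin (top_of_set (frontier \<Omega>)) \<Gamma>\<^sub>D"
      "openin (top_of_set (frontier \<Omega>)) \<Gamma>\<^sub>N"
      "openin (top_of_set (frontier \<Omega>)) \<Gamma>\<^sub>R"
      "\<Gamma>\<^sub>D \<inter> \<Gamma>\<^sub>N = {}" "\<Gamma>\<^sub>D \<inter> \<Gamma>\<^sub>R = {}" "\<Gamma>\<^sub>N \<inter> \<Gamma>\<^sub>R = {}"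
      "frontier \<Omega> = closure \<Gamma>\<^sub>D \<union> closure \<Gamma>\<^sub>N \<union> closure \<Gamma>\<^sub>R"
      "emeasure surface_measure \<Gamma>\<^sub>D > 0"
    and time: "T > 0"
    and physical_data: "K > 0" "n\<^sub>e > 0" "S\<^sub>s \<ge> 0" "\<eta> \<in> W1_infinity \<Omega>"
    and interval: "m \<le> M"
      "\<exists>\<delta>>0. AE x in lebesgue_on \<Omega>. \<forall>r\<in>{m..M}. r - \<eta> x \<ge> \<delta>"
    and coincide:
      "\<And>x r. x \<in> \<Omega> \<Longrightarrow> r \<in> {m..M} \<Longrightarrow> S x r = S_ph n\<^sub>e S\<^sub>s \<eta> x r"
      "\<And>x r. x \<in> \<Omega> \<Longrightarrow> r \<in> {m..M} \<Longrightarrow> \<T> x r = T_ph K \<eta> x r"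
    and H1: "hyp_H1 \<Omega> S \<T>"
    and H2: "hyp_H2 \<Gamma>\<^sub>R T \<beta>"
    and H3: "hyp_H3 \<Omega> \<Gamma>\<^sub>D \<Gamma>\<^sub>N T h0 q g"
    and sol: "weak_solution \<Omega> \<Gamma>\<^sub>D \<Gamma>\<^sub>R T S \<T> \<beta> h0 q g h"
    and i: "AE (x, t) in lebesgue_on (\<Omega> \<times> {0<..<T}). h t x \<in> {m..M}"
    and ii: "\<And>x t r. x \<in> \<Gamma>\<^sub>R \<Longrightarrow> t \<in> {0<..<T} \<Longrightarrow> r \<in> {m..M} \<Longrightarrow>
               \<beta> x t r = \<alpha> r * (r - h_ext x t)"
    and iii: "AE t in lebesgue_on {0<..<T}. \<forall>v\<in>V_space \<Omega> \<Gamma>\<^sub>D. q t v = N t v"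
  shows "(AE (x, t) in lebesgue_on (\<Omega> \<times> {0<..<T}).
            S x (h t x) = S_ph n\<^sub>e S\<^sub>s \<eta> x (h t x) \<and> \<T> x (h t x) = T_ph K \<eta> x (h t x))
       \<and> weak_solution \<Omega> \<Gamma>\<^sub>D \<Gamma>\<^sub>R T (S_ph n\<^sub>e S\<^sub>s \<eta>) (T_ph K \<eta>)
            (\<lambda>x t r. \<alpha> r * (r - h_ext x t)) h0 N g h"
proof -
  have \<Omega>: "bounded \<Omega>" "open \<Omega>" using domain by (simp_all add: lipschitz_domain_def)
  interpret T: complete_measure "time T" by (rule complete_time)
  have c\<Omega>: "complete_measure (lebesgue_on \<Omega>)" using \<Omega>(2) by (intro complete_lebesgue_on) simp
  have \<Gamma>_sub: "\<Gamma>\<^sub>D \<subseteq> frontier \<Omega>" "\<Gamma>\<^sub>R \<subseteq> frontier \<Omega>"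
    using boundary_parts(1,3) by (simp_all add: openin_imp_subset)
  have \<Gamma>R_borel: "\<Gamma>\<^sub>R \<in> sets borel"
  proof -
    obtain W where "open W" "\<Gamma>\<^sub>R = frontier \<Omega> \<inter> W"
      using boundary_parts(3) by (auto simp: openin_open)
    then show ?thesis by (simp add: borel_closed)
  qed
  have c\<Gamma>: "complete_measure (surface_on \<Gamma>\<^sub>R)" by (rule complete_surface_on[OF \<Gamma>R_borel])
  have space_\<Omega>: "AE x in lebesgue_on \<Omega>. x \<in> \<Omega>" by (intro AE_I2) simp
  have space_T: "AE t in time T. t \<in> {0<..<T}" by (intro AE_I2) simp
  have range: "AE t in time T. AE x in lebesgue_on \<Omega>. h t x \<in> {m..M}"
    by (rule AE_time_slices[OF \<Omega>(2) i])
  note sol' = weak_solutionD[OF sol]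
  have h0: "h0 \<in> L2 (lebesgue_on \<Omega>)" using H3 by (simp add: hyp_H3_def)
  have h0_range: "AE x in lebesgue_on \<Omega>. h0 x \<in> {m..M}"
    by (rule initial_datum_mem[OF \<Omega> \<Gamma>_sub(1) time H1 h0 sol range])
  let ?Sp = "S_ph n\<^sub>e S\<^sub>s \<eta>" and ?Tp = "T_ph K \<eta>"
  \<comment> \<open>The difference of the two storage primitives at every level in \<open>{m..M}\<close>.\<close>
  define c where "c x = primitive S x m - primitive ?Sp x m" for x
  have c_H1: "c \<in> H1 \<Omega>"
    unfolding c_def[abs_def]
  proof (rule H1_diff[OF \<Omega>(2)])
    show "(\<lambda>x. primitive S x m) \<in> H1 \<Omega>"
      by (rule hyp_H1_primitive[OF H1 smooth_H1[OF \<Omega> C_infinity_const]])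
    have "(\<lambda>x. 1 * (n\<^sub>e * m + S\<^sub>s / 2 * m\<^sup>2) + (- (S\<^sub>s * m)) * \<eta> x) \<in> H1 \<Omega>"
      by (rule H1_lincomb(1)[OF \<Omega>(2) smooth_H1[OF \<Omega> C_infinity_const] W1_infinity_H1[OF \<Omega> physical_data(4)]])
    then show "(\<lambda>x. primitive ?Sp x m) \<in> H1 \<Omega>"
      by (simp add: primitive_S_ph algebra_simps)
  qed
  have shift: "AE x in lebesgue_on \<Omega>. \<forall>r\<in>{m..M}. primitive ?Sp x r = primitive S x r - c x"
    using hyp_H1_continuous[OF H1] space_\<Omega>
  proof eventually_elim
    case (elim x)
    have cont_Sp: "continuous_on UNIV (?Sp x)"
      unfolding S_ph_def[abs_def] by (intro continuous_intros)
    have "primitive S x r - primitive ?Sp x r = c x" if "r \<in> {m..M}" for r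
      unfolding c_def
      by (rule primitive_diff_cong[where S = S and S' = ?Sp and x
          = x, OF elim(1) cont_Sp coincide(1)[OF elim(2)] that])
    then show ?case by (auto simp: algebra_simps)
  qed
  have shift_h: "AE t in time T. AE x in lebesgue_on \<Omega>. primitive ?Sp x (h t x) = primitive S x (h t x) - c x"
    using range
  proof eventually_elim
    case (elim t)
    show ?case using shift elim by eventually_elim (rule bspec)
  qed
  have shift_h0: "AE x in lebesgue_on \<Omega>. primitive ?Sp x (h0 x) = primitive S x (h0 x) - c x"
    using shift h0_range by eventually_elim (rule bspec)
  have V_L2: "v \<in> L2 (lebesgue_on \<Omega>)" if "v \<in> V_space \<Omega> \<Gamma>\<^sub>D" for v
    using H1_D(1)[OF \<Omega>(2)] that by (simp add: V_space_def)
  have diffusion: "AE t in time T. AE x in lebesgue_on \<Omega>.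
      \<T> x (h t x) * (weak_gradient \<Omega> (h t) x \<bullet> weak_gradient \<Omega> v x)
      = ?Tp x (h t x) * (weak_gradient \<Omega> (h t) x \<bullet> weak_gradient \<Omega> v x)" for v
    using range
  proof eventually_elim
    case (elim t)
    show ?case using elim space_\<Omega> by eventually_elim (simp add: coincide(2))
  qed
  have exchange: "AE t in time T. AE x in surface_on \<Gamma>\<^sub>R.
      \<beta> x t (boundary_trace \<Omega> (h t) x) * boundary_trace \<Omega> v x
      = (\<alpha> (boundary_trace \<Omega> (h t) x) * (boundary_trace \<Omega> (h t) x - h_ext x t)) * boundary_trace \<Omega> v x" for v
  proof -
    have "AE t in time T. h t \<in> V_space \<Omega> \<Gamma>\<^sub>D"
      using sol'(3) by (simp add: bochner_L2_def strongly_measurable_def)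
    with range space_T show ?thesis
    proof eventually_elim
      case (elim t)
      have "AE x in surface_on \<Gamma>\<^sub>R. boundary_trace \<Omega> (h t) x \<in> {m..M}"
        by (rule boundary_trace_AE_mem[OF domain \<Gamma>R_borel \<Gamma>_sub(2) elim(3) _ _ elim(1)]) (use interval(1) in auto)
      moreover have "AE x in surface_on \<Gamma>\<^sub>R. x \<in> \<Gamma>\<^sub>R" by (intro AE_I2) (simp add: space_restrict_space)
      ultimately show ?case
        by eventually_elim (simp add: ii[OF _ elim(2)])
    qed
  qed
  have Bp: "(\<lambda>t x. primitive ?Sp x (h t x)) \<in> bochner_L2 T (H1 \<Omega>) (H1_norm \<Omega>)"
    by (rule bochner_L2_H1_diff[OF \<Omega>(2) sol'(4) c_H1 shift_h])
  have time_der: "\<exists>w \<in> bochner_L2 T (V_dual \<Omega> \<Gamma>\<^sub>D) (V_dual_norm \<Omega> \<Gamma>\<^sub>D).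
      has_time_derivative \<Omega> \<Gamma>\<^sub>D T (\<lambda>t x. primitive ?Sp x (h t x)) w"
  proof -
    from sol'(5) obtain w where w: "w \<in> bochner_L2 T (V_dual \<Omega> \<Gamma>\<^sub>D) (V_dual_norm \<Omega> \<Gamma>\<^sub>D)"
      "has_time_derivative \<Omega> \<Gamma>\<^sub>D T (\<lambda>t x. primitive S x (h t x)) w" by (rule bexE)
    have "has_time_derivative \<Omega> \<Gamma>\<^sub>D T (\<lambda>t x. primitive ?Sp x (h t x)) w"
      unfolding has_time_derivative_def
    proof (intro ballI)
      fix \<phi> v assume \<phi>: "\<phi> \<in> test_functions {0<..<T}" and v: "v \<in> V_space \<Omega> \<Gamma>\<^sub>D"
      note d = test_function_time_derivative[OF \<phi>]
      have "(\<integral>t. L2_inner \<Omega> (\<lambda>x. primitive ?Sp x (h t x)) v * deriv \<phi> t \<partial>time T)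
          = (\<integral>t. L2_inner \<Omega> (\<lambda>x. primitive S x (h t x)) v * deriv \<phi> t \<partial>time T) - L2_inner \<Omega> c v * (\<phi> T - \<phi> 0)"
        by (rule integral_L2_inner_diff[OF \<Omega>(2) time sol'(4) c_H1 shift_h V_L2[OF v] d(1) d(2)])
      also have "\<dots> = (\<integral>t. L2_inner \<Omega> (\<lambda>x. primitive S x (h t x)) v * deriv \<phi> t \<partial>time T)"
        by (simp add: d(3,4))
      also have "\<dots> = - (\<integral>t. w t v * \<phi> t \<partial>time T)"
        by (rule bspec[OF bspec[OF w(2)[unfolded has_time_derivative_def] \<phi>] v])
      finally show "(\<integral>t. L2_inner \<Omega> (\<lambda>x. primitive ?Sp x (h t x)) v * deriv \<phi> t \<partial>time T)
          = - (\<integral>t. w t v * \<phi> t \<partial>time T)" .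
    qed
    then show ?thesis by (rule bexI[OF _ w(1)])
  qed
  have coefficients: "AE (x, t) in lebesgue_on (\<Omega> \<times> {0<..<T}).
      S x (h t x) = ?Sp x (h t x) \<and> \<T> x (h t x) = ?Tp x (h t x)"
  proof -
    have "AE z in lebesgue_on (\<Omega> \<times> {0<..<T}). z \<in> \<Omega> \<times> {0<..<T}" by (intro AE_I2) simp
    with i show ?thesis by eventually_elim (auto simp: coincide)
  qed
  have "weak_solution \<Omega> \<Gamma>\<^sub>D \<Gamma>\<^sub>R T ?Sp ?Tp (\<lambda>x t r. \<alpha> r * (r - h_ext x t)) h0 N g h"
    unfolding weak_solution_def Let_def
  proof (intro conjI ballI allI impI)
    fix v assume v: "v \<in> V_space \<Omega> \<Gamma>\<^sub>D"
    show "iterated_integrable (time T) (lebesgue_on \<Omega>)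
        (\<lambda>t x. ?Tp x (h t x) * (weak_gradient \<Omega> (h t) x \<bullet> weak_gradient \<Omega> v x))"
      by (rule iterated_integrable_AE_eq[OF complete_time c\<Omega> diffusion sol'(6)[OF v]])
    show "iterated_integrable (time T) (surface_on \<Gamma>\<^sub>R)
        (\<lambda>t x. (\<alpha> (boundary_trace \<Omega> (h t) x) * (boundary_trace \<Omega> (h t) x - h_ext x t)) * boundary_trace \<Omega> v x)"
      by (rule iterated_integrable_AE_eq[OF complete_time c\<Gamma> exchange sol'(7)[OF v]])
  next
    fix v \<psi> \<psi>' assume v: "v \<in> V_space \<Omega> \<Gamma>\<^sub>D"
      and *: "(\<forall>t\<in>{0..T}. (\<psi> has_real_derivative \<psi>' t) (at t within {0..T})) \<and> continuous_on {0..T} \<psi>' \<and> \<psi> T = 0"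
    then have der: "\<And>t. t \<in> {0..T} \<Longrightarrow> (\<psi> has_real_derivative \<psi>' t) (at t within {0..T})"
      and cont: "continuous_on {0..T} \<psi>'" and \<psi>T: "\<psi> T = 0" by auto
    have storage: "(\<integral>t. L2_inner \<Omega> (\<lambda>x. primitive ?Sp x (h t x)) v * \<psi>' t \<partial>time T)
        = (\<integral>t. L2_inner \<Omega> (\<lambda>x. primitive S x (h t x)) v * \<psi>' t \<partial>time T) - L2_inner \<Omega> c v * (\<psi> T - \<psi> 0)"
      by (rule integral_L2_inner_diff[OF \<Omega>(2) time sol'(4) c_H1 shift_h V_L2[OF v] der cont])
    have initial: "L2_inner \<Omega> (\<lambda>x. primitive ?Sp x (h0 x)) v
        = L2_inner \<Omega> (\<lambda>x. primitive S x (h0 x)) v - L2_inner \<Omega> c v"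
      unfolding L2_inner_AE_eq[OF \<Omega>(2) shift_h0]
      by (rule L2_inner_diff[OF hyp_H1_primitive_L2[OF \<Omega> H1 h0] H1_D(1)[OF \<Omega>(2) c_H1] V_L2[OF v]])
    have source: "(\<integral>t. (q t v - g t (boundary_trace \<Omega> v)) * \<psi> t \<partial>time T)
        = (\<integral>t. (N t v - g t (boundary_trace \<Omega> v)) * \<psi> t \<partial>time T)"
      by (rule T.integral_AE_eq) (use iii in eventually_elim, simp add: v)
    \<comment> \<open>The storage term changes by \<open>- (c, v) \<psi>(0)\<close>, because \<open>\<psi>(T) = 0\<close>, and so does the initial term.\<close>
    note eq = sol'(8)[OF v der cont \<psi>T]
    from eq show "- (\<integral>t. L2_inner \<Omega> (\<lambda>x. primitive ?Sp x (h t x)) v * \<psi>' t \<partial>time T)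
      + (\<integral>t. (\<integral>x. (?Tp x (h t x) * (weak_gradient \<Omega> (h t) x \<bullet> weak_gradient \<Omega> v x)) * \<psi> t \<partial>lebesgue_on \<Omega>) \<partial>time T)
      + (\<integral>t. (\<integral>x. ((\<alpha> (boundary_trace \<Omega> (h t) x) * (boundary_trace \<Omega> (h t) x - h_ext x t))
            * boundary_trace \<Omega> v x) * \<psi> t \<partial>surface_on \<Gamma>\<^sub>R) \<partial>time T)
    = (\<integral>t. (N t v - g t (boundary_trace \<Omega> v)) * \<psi> t \<partial>time T)
      + L2_inner \<Omega> (\<lambda>x. primitive ?Sp x (h0 x)) v * \<psi> 0"
      unfolding iterated_integral_AE_eq[OF complete_time c\<Omega> diffusion]
          iterated_integral_AE_eq[OF complete_time c\<Gamma> exchange]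
        source storage initial \<psi>T
      by (simp add: algebra_simps)
  qed (fact sol'(1) sol'(2) sol'(3) Bp time_der)+
  with coefficients show ?thesis ..
qed

end
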